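(* Let $n\geq 7$ be an integer and $h$ an odd integer with $0<h<2^{n-6}$ and $h\not\equiv 0\pmod{17}$. Let $M=h\cdot 2^n+1$ or $M=h\cdot 2^n-1$, and let $M^*=(-1)^{(M-1)/2}M$, so that $M^*=(\pm h)2^n+1$. Let $\pi_1=1+2\zeta_8^3$ and $\pi_2=1-\zeta_{16}+\zeta_{16}^5$, and let $\{T_k\},\{N_k\},\{X_k\},\{Y_k\},\{Z_k\},\{W_k\}$ be the sequences defined in the context from $\pi_1,\pi_2$ and $h$. Let $Q_1,\dots,Q_7$ be the seven integers $Q$ with $1<Q<2^{n-3}$ and $Q\equiv \pm 5^{j2^{n-7}}\pmod{2^{n-3}}$ for some $j\in\{0,1,2,3\}$. Suppose that $M$ is divisible by none of $Q_1,\dots,Q_7$. Then $M$ is prime if and only if one of the following holds: (i) $M^*\equiv \pm 4\pmod{17}$, and $T_{n-3}\equiv -N_{n-3}\equiv -4\pmod{M}$; (ii) $M^*\equiv \pm 2,\pm 8\pmod{17}$, and $T_{n-3}\equiv N_{n-3}\equiv 0\pmod{M}$; (iii) $M^*\equiv \pm 3,\pm 5,\pm 6,\pm 7\pmod{17}$, and $T_{n-3}\equiv 0\pmod{M}$ and $N_{n-3}\equiv -2\pmod{M}$; (iv) $M^*\equiv -1\pmod{17}$, and $X_{n-4}\equiv -8$, $Y_{n-4}\equiv 24$, $Z_{n-4}\equiv -32$, $W_{n-4}\equiv 16\pmod{M}$.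
   Context: Let $\zeta_8=e^{2\pi i/8}$, $\zeta_{16}=e^{2\pi i/16}$, $L_1=\mathbb{Q}(\zeta_8)\subset L_2=\mathbb{Q}(\zeta_{16})$, with rings of integers $D_1=\mathbb{Z}[\zeta_8]$, $D_2=\mathbb{Z}[\zeta_{16}]$. For odd $c$, $\sigma_c$ denotes the automorphism of $L_2$ with $\zeta_{16}\mapsto\zeta_{16}^c$ (and also its restriction to $L_1$, which sends $\zeta_8\mapsto\zeta_8^c$). For nonzero $\alpha\in L_2$ and $\tau=\sum_\sigma k_\sigma\sigma\in\mathbb{Z}[\mathrm{Gal}(L_2/\mathbb{Q})]$, write $\alpha^\tau=\prod_\sigma \sigma(\alpha)^{k_\sigma}$, with $\sigma_1=1$. A bar denotes complex conjugation. Let $K_1=\mathbb{Q}(\sqrt2)$ and $K_2=\mathbb{Q}(\zeta_{16}+\zeta_{16}^{-1})$ be the maximal real subfields of $L_1,L_2$; $\mathrm{Gal}(K_2/\mathbb{Q})=\{\sigma_1,\sigma_3,\sigma_5,\sigma_7\}$ restricted to $K_2$. Set $\alpha_1=(\pi_1/\bar\pi_1)^{1+3\sigma_3}$ and $\alpha_2=(\pi_2/\bar\pi_2)^{1+3\sigma_{-5}+5\sigma_{-3}+7\sigma_7}$. Sequences $T_k,N_k$: $T_0=\mathrm{Tr}_{K_1/\mathbb{Q}}(\alpha_1^h+\bar\alpha_1^h)$, $N_0=\mathrm{N}_{K_1/\mathbb{Q}}(\alpha_1^h+\bar\alpha_1^h)$, and for $k\ge0$: $T_{k+1}=T_k^2-2N_k-4$,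 $N_{k+1}=N_k^2-2T_k^2+4N_k+4$. Sequences $X_k,Y_k,Z_k,W_k$: let $\eta=\alpha_2^h+\bar\alpha_2^h\in K_2$ and let $X_0,Y_0,Z_0,W_0$ be the first, second, third and fourth elementary symmetric polynomials in $\eta,\sigma_3(\eta),\sigma_5(\eta),\sigma_7(\eta)$ (so $X_0=\mathrm{Tr}_{K_2/\mathbb{Q}}(\eta)$, $W_0=\mathrm{N}_{K_2/\mathbb{Q}}(\eta)$). For $k\ge0$: $X_{k+1}=X_k^2-2Y_k-8$, $Y_{k+1}=Y_k^2-2X_kZ_k+2W_k-6X_k^2+12Y_k+24$, $Z_{k+1}=Z_k^2-2W_kY_k-4Y_k^2+8X_kZ_k-8W_k+12X_k^2-24Y_k-32$, $W_{k+1}=W_k^2-2Z_k^2+4W_kY_k+4Y_k^2-8X_kZ_k+8W_k-8X_k^2+16Y_k+16$. *)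

theory Defs
  imports "HOL-Analysis.Analysis" "HOL-Number_Theory.Number_Theory"
begin

definition zeta :: "nat \<Rightarrow> complex" where
  "zeta m = cis (2 * pi / real m)"

definition is_subfield :: "complex set \<Rightarrow> bool" where
  "is_subfield K \<longleftrightarrow> 1 \<in> K \<and> (\<forall>x\<in>K. \<forall>y\<in>K. x - y \<in> K \<and> x * y \<in> K) \<and> (\<forall>x\<in>K. inverse x \<in> K)"

(* The subfield Q(S) of the complex numbers. *)
definition rat_adjoin :: "complex set \<Rightarrow> complex set" where
  "rat_adjoin S = \<Inter>{K. is_subfield K \<and> S \<subseteq> K}"

definition K1 :: "complex set" where
  "K1 = rat_adjoin {complex_of_real (sqrt 2)}"

definition L2 :: "complex set" where
  "L2 = rat_adjoin {zeta 16}"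

(* Gal(K/Q) as the field automorphisms of K; every one of them fixes Q. Outside K they take
   the fixed value undefined, so that distinct members differ on K. *)
definition gal :: "complex set \<Rightarrow> (complex \<Rightarrow> complex) set" where
  "gal K = {f \<in> extensional K. bij_betw f K K \<and>
     (\<forall>x\<in>K. \<forall>y\<in>K. f (x + y) = f x + f y \<and> f (x * y) = f x * f y)}"

(* Trace and norm from K to Q, for K a finite Galois extension of Q. *)
definition field_trace :: "complex set \<Rightarrow> complex \<Rightarrow> complex" where
  "field_trace K x = (\<Sum>f\<in>gal K. f x)"

definition field_norm :: "complex set \<Rightarrow> complex \<Rightarrow> complex" where
  "field_norm K x = (\<Prod>f\<in>gal K. f x)"

(* For odd c; the restriction of sigma c to Q(zeta 8) is given by the same function. *)
definition sigma :: "int \<Rightarrow> complex \<Rightarrow> complex" where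
  "sigma c = (THE f. f \<in> gal L2 \<and> f (zeta 16) = zeta 16 powi c)"

(* (p / cnj p) to the power 1 + 3 sigma_3 of the group ring, and
   (p / cnj p) to the power 1 + 3 sigma_(-5) + 5 sigma_(-3) + 7 sigma_7. *)
definition alpha1 :: "complex \<Rightarrow> complex" where
  "alpha1 p = (let u = p / cnj p in u * sigma 3 u ^ 3)"

definition alpha2 :: "complex \<Rightarrow> complex" where
  "alpha2 p = (let u = p / cnj p in u * sigma (-5) u ^ 3 * sigma (-3) u ^ 5 * sigma 7 u ^ 7)"

definition theta :: "complex \<Rightarrow> nat \<Rightarrow> complex" where
  "theta p h = alpha1 p ^ h + cnj (alpha1 p) ^ h"

definition eta :: "complex \<Rightarrow> nat \<Rightarrow> complex" where
  "eta p h = alpha2 p ^ h + cnj (alpha2 p) ^ h"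

fun T_seq N_seq :: "complex \<Rightarrow> nat \<Rightarrow> nat \<Rightarrow> complex" where
  "T_seq p h 0 = field_trace K1 (theta p h)"
| "N_seq p h 0 = field_norm K1 (theta p h)"
| "T_seq p h (Suc k) = (T_seq p h k)\<^sup>2 - 2 * N_seq p h k - 4"
| "N_seq p h (Suc k) = (N_seq p h k)\<^sup>2 - 2 * (T_seq p h k)\<^sup>2 + 4 * N_seq p h k + 4"

fun X_seq Y_seq Z_seq W_seq :: "complex \<Rightarrow> nat \<Rightarrow> nat \<Rightarrow> complex" where
  "X_seq p h 0 = (let a = eta p h; b = sigma 3 a; c = sigma 5 a; d = sigma 7 a
     in a + b + c + d)"
| "Y_seq p h 0 = (let a = eta p h; b = sigma 3 a; c = sigma 5 a; d = sigma 7 a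
     in a * b + a * c + a * d + b * c + b * d + c * d)"
| "Z_seq p h 0 = (let a = eta p h; b = sigma 3 a; c = sigma 5 a; d = sigma 7 a
     in a * b * c + a * b * d + a * c * d + b * c * d)"
| "W_seq p h 0 = (let a = eta p h; b = sigma 3 a; c = sigma 5 a; d = sigma 7 a
     in a * b * c * d)"
| "X_seq p h (Suc k) = (X_seq p h k)\<^sup>2 - 2 * Y_seq p h k - 8"
| "Y_seq p h (Suc k) = (Y_seq p h k)\<^sup>2 - 2 * X_seq p h k * Z_seq p h k + 2 * W_seq p h k
     - 6 * (X_seq p h k)\<^sup>2 + 12 * Y_seq p h k + 24"
| "Z_seq p h (Suc k) = (Z_seq p h k)\<^sup>2 - 2 * W_seq p h k * Y_seq p h k - 4 * (Y_seq p h k)\<^sup>2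
     + 8 * X_seq p h k * Z_seq p h k - 8 * W_seq p h k + 12 * (X_seq p h k)\<^sup>2
     - 24 * Y_seq p h k - 32"
| "W_seq p h (Suc k) = (W_seq p h k)\<^sup>2 - 2 * (Z_seq p h k)\<^sup>2 + 4 * W_seq p h k * Y_seq p h k
     + 4 * (Y_seq p h k)\<^sup>2 - 8 * X_seq p h k * Z_seq p h k + 8 * W_seq p h k
     - 8 * (X_seq p h k)\<^sup>2 + 16 * Y_seq p h k + 16"

(* Congruence modulo M in the ring of rationals with denominator coprime to M. The terms of the
   sequences are rational, with powers of 17 as denominators, and not integers in general. *)
definition rat_cong :: "int \<Rightarrow> complex \<Rightarrow> complex \<Rightarrow> bool" where
  "rat_cong M x y \<longleftrightarrow>
     (\<exists>a b. b \<noteq> 0 \<and> coprime b M \<and> x - y = of_int M * (of_int a / of_int b))"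

end

theory Submission
  imports Defs
begin

text \<open>
  Let \<open>M\<close> be prime and \<open>G\<close> the Gauss sum of a character \<open>\<chi>\<close> of order \<open>d \<in> {8, 16}\<close> modulo 17.
  The Frobenius congruence \<open>G(\<chi>)\<^sup>M \<equiv> \<chi>(M)\<^sup>-\<^sup>M G(\<chi>\<^sup>M)\<close> modulo \<open>M\<close> together with the Stickelberger
  factorisation \<open>G\<^sup>d = \<alpha> \<gamma>\<^sup>d\<close>, \<open>\<gamma> \<gamma>\<^sup>c = 17\<close> (where \<open>\<gamma>\<^sup>c\<close> is the complex conjugate of \<open>\<gamma>\<close>), checked
  by computing three Jacobi sums, gives \<open>\<alpha>\<^bsup>(M-1)/d\<^esup> \<equiv> \<chi>(M)\<^sup>-\<^sup>1\<close> if \<open>M \<equiv> 1\<close> and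
  \<open>\<alpha>\<^bsup>(M+1)/d\<^esup> \<equiv> \<chi>(-M)\<close> if \<open>M \<equiv> -1\<close> modulo 16. The sequences are the elementary symmetric
  functions of the conjugates of \<open>\<alpha>\<^sup>m + \<alpha>\<^sup>-\<^sup>m\<close> for \<open>m = h 2\<^sup>k\<close>, so that this determines their values
  at \<open>k = n - 3\<close> and \<open>k = n - 4\<close>.

  Conversely, for a prime \<open>q\<close> dividing \<open>M\<close> the congruences make \<open>\<alpha>\<^sup>h\<close> an element of order divisible by
  \<open>2\<^bsup>n-3\<^esup>\<close> in \<open>\<int>[1/17, \<zeta>]\<close> modulo \<open>q\<close>, a ring in which \<open>x\<close> and its power with exponent \<open>q\<^sup>4\<close> agree.
  Hence \<open>q\<^sup>4 \<equiv> 1\<close> modulo \<open>2\<^bsup>n-3\<^esup>\<close>, so that \<open>q\<close> is an excluded divisor or exceeds \<open>2\<^bsup>n-3\<^esup>\<close>, and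
  \<open>M < 2\<^bsup>2n-6\<^esup>\<close> leaves no room for two factors of the second kind.
\<close>

text \<open>Write Mstar = 14^l modulo 17. The octic sum detects \<zeta>^(2l), whose order 2, 4 or 8
  separates (i), (ii) and (iii). For l = 8, that is Mstar = -1, this root of unity is trivial, and
  the character of order 16, whose value there is -1, takes over. The class l = 0 cannot occur,
  because Mstar - 1 is h 2^n up to sign and hence prime to 17. Three Jacobi sums suffice because
  G(\<chi>)^2 = J(\<chi>,\<chi>) G(\<chi>^2): squaring descends through the orders 16, 8, 4 to the
  quadratic Gauss sum, whose square is 17. In the converse, congruences are taken modulo the
  rational prime q and not modulo a prime ideal above it. The quotient ring then has zero divisors
  in general, but x = x^(q^4) makes it reduced, so that a nilpotent x + 1 or x^2 + 1 must vanish.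
  The exponent 4 is that of the group of units modulo 16. Case (iv) gives the weakest order, and
  this fixes the modulus 2^(n-3).\<close>

abbreviation (input) zeta16 :: complex ("\<zeta>") where "\<zeta> \<equiv> zeta 16"

lemma zeta16_pow: "\<zeta> ^ k = cis (real k * pi / 8)"
  unfolding zeta_def Complex.DeMoivre by simp

lemma zeta16_pow8: "\<zeta> ^ 8 = -1"
  unfolding zeta16_pow by simp

lemma zeta16_pow16: "\<zeta> ^ 16 = 1"
proof -
  have "\<zeta> ^ 16 = (\<zeta> ^ 8) ^ 2" by (simp flip: power_mult)
  then show ?thesis by (simp add: zeta16_pow8)
qed

lemma zeta16_pow4: "\<zeta> ^ 4 = \<i>"
  unfolding zeta16_pow by (simp add: complex_eq_iff)

lemma zeta16_nonzero [simp]: "\<zeta> \<noteq> 0"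
  by (simp add: zeta_def)

lemma zeta16_power_mod: "\<zeta> ^ (k mod 16) = \<zeta> ^ k"
proof -
  have "\<zeta> ^ k = \<zeta> ^ (16 * (k div 16) + k mod 16)" by simp
  also have "\<dots> = \<zeta> ^ (k mod 16)" unfolding power_add power_mult zeta16_pow16 by simp
  finally show ?thesis ..
qed

lemma zeta16_power_cong: "a mod 16 = b mod 16 \<Longrightarrow> \<zeta> ^ a = \<zeta> ^ b"
  by (metis zeta16_power_mod)

lemma cnj_zeta16: "cnj \<zeta> = \<zeta> ^ 15"
proof -
  have "\<zeta> * cnj \<zeta> = 1" by (simp add: zeta_def complex_eq_iff flip: power2_eq_square)
  moreover have "\<zeta> * \<zeta> ^ 15 = 1" using zeta16_pow16 by (simp flip: power_Suc)
  ultimately have "\<zeta> * cnj \<zeta> = \<zeta> * \<zeta> ^ 15" by simp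
  then show ?thesis by simp
qed

lemma zeta8_eq: "zeta 8 = \<zeta>\<^sup>2"
  unfolding zeta16_pow by (simp add: zeta_def)

lemma zeta16_sq: "\<zeta>\<^sup>2 = complex_of_real (sqrt 2 / 2) * (1 + \<i>)"
  unfolding zeta16_pow by (simp add: complex_eq_iff cos_45 sin_45)

lemma sqrt2_eq: "complex_of_real (sqrt 2) = \<zeta>\<^sup>2 + \<zeta> ^ 14"
proof -
  have "\<zeta> ^ 14 = cnj (\<zeta>\<^sup>2)" by (simp add: cnj_zeta16 zeta16_power_cong flip: power_mult)
  then show ?thesis by (simp add: zeta16_sq complex_eq_iff)
qed

subsection \<open>Quadratic towers and the automorphisms\<close>

lemma subfieldD:
  assumes "is_subfield F"
  shows "1 \<in> F" "x \<in> F \<Longrightarrow> y \<in> F \<Longrightarrow> x - y \<in> F" "x \<in> F \<Longrightarrow> y \<in> F \<Longrightarrow> x * y \<in> F"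
    "x \<in> F \<Longrightarrow> inverse x \<in> F"
  using assms by (auto simp: is_subfield_def)

lemma subfield_closed:
  assumes F: "is_subfield F"
  shows "0 \<in> F" "x \<in> F \<Longrightarrow> - x \<in> F" "x \<in> F \<Longrightarrow> y \<in> F \<Longrightarrow> x + y \<in> F"
    "x \<in> F \<Longrightarrow> y \<in> F \<Longrightarrow> x / y \<in> F" "x \<in> F \<Longrightarrow> x ^ k \<in> F" "of_nat m \<in> F" "numeral b \<in> F"
proof -
  note D = subfieldD[OF F]
  show z: "0 \<in> F" using D(2)[OF D(1) D(1)] by simp
  show m: "- x \<in> F" if "x \<in> F" for x using D(2)[OF z that] by simp
  show a: "x + y \<in> F" if "x \<in> F" "y \<in> F" for x y using D(2)[OF that(1) m[OF that(2)]] by simp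
  show "x / y \<in> F" if "x \<in> F" "y \<in> F" for x y
    using D(3)[OF that(1) D(4)[OF that(2)]] by (simp add: divide_inverse)
  show "x ^ k \<in> F" if "x \<in> F" for k using that by (induction k) (auto intro: D)
  show n: "of_nat m \<in> F" for m by (induction m) (auto intro: z a D)
  show "numeral b \<in> F" using n[of "numeral b"] by simp
qed

lemmas subfield_intros = subfieldD subfield_closed

lemma subfield_rat_adjoin: "is_subfield (rat_adjoin S)"
  unfolding rat_adjoin_def is_subfield_def by auto

lemma rat_adjoin_least: "is_subfield K \<Longrightarrow> S \<subseteq> K \<Longrightarrow> rat_adjoin S \<subseteq> K"
  unfolding rat_adjoin_def by auto

lemma rat_adjoin_superset: "S \<subseteq> rat_adjoin S"
  unfolding rat_adjoin_def by auto

lemma subfield_Rats: "is_subfield \<rat>"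
  unfolding is_subfield_def by auto

lemma subfield_Reals: "is_subfield \<real>"
  unfolding is_subfield_def by auto

lemma Rats_subset_subfield:
  assumes F: "is_subfield F"
  shows "\<rat> \<subseteq> F"
proof
  fix x :: complex assume "x \<in> \<rat>"
  then obtain a b :: int where "b > 0" "x = of_int a / of_int b"
    by (auto elim: Rats_cases')
  moreover have "of_int c \<in> F" for c
    by (cases c rule: int_cases2) (auto intro: subfield_intros[OF F])
  ultimately show "x \<in> F" by (auto intro: subfield_intros[OF F])
qed

definition quad_ext :: "complex set \<Rightarrow> complex \<Rightarrow> complex set" where
  "quad_ext F r = {a + b * r | a b. a \<in> F \<and> b \<in> F}"

lemma quad_extI: "a \<in> F \<Longrightarrow> b \<in> F \<Longrightarrow> a + b * r \<in> quad_ext F r"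
  unfolding quad_ext_def by blast

lemma quad_ext_base: "is_subfield F \<Longrightarrow> F \<subseteq> quad_ext F r"
  using quad_extI[of _ F 0 r] subfield_closed(1) by force

lemma quad_ext_gen: "is_subfield F \<Longrightarrow> r \<in> quad_ext F r"
  using quad_extI[of 0 F 1 r] subfield_closed(1) subfieldD(1) by force

lemma subfield_quad_ext:
  assumes F: "is_subfield F" and r: "r\<^sup>2 \<in> F"
  shows "is_subfield (quad_ext F r)"
  unfolding is_subfield_def
proof (intro conjI ballI)
  note I = subfield_intros[OF F]
  show "1 \<in> quad_ext F r" using quad_ext_base[OF F] I(1) by blast
  fix x assume "x \<in> quad_ext F r"
  then obtain a b where x: "x = a + b * r" "a \<in> F" "b \<in> F" unfolding quad_ext_def by blast
  {
    fix y assume "y \<in> quad_ext F r"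
    then obtain c d where y: "y = c + d * r" "c \<in> F" "d \<in> F" unfolding quad_ext_def by blast
    have "x - y = (a - c) + (b - d) * r" using x y by (simp add: algebra_simps)
    then show "x - y \<in> quad_ext F r" using x y by (metis quad_extI I(2))
    have e: "x * y = (a * c + b * d * r\<^sup>2) + (a * d + b * c) * r"
      using x y by (simp add: algebra_simps power2_eq_square)
    show "x * y \<in> quad_ext F r" unfolding e by (intro quad_extI I x y r)
  }
  show "inverse x \<in> quad_ext F r"
  \<comment> \<open>\<open>r\<close> may lie in \<open>F\<close>, so the conjugate
    \<open>a - b * r\<close> can vanish although \<open>x\<close> does not; then
    \<open>x = 2 * a\<close>.\<close>
  proof (cases "a - b * r = 0")
    case True
    then have "x = a + a" using x by simp
    then have "inverse x \<in> F" using x by (auto intro!: I)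
    then show ?thesis using quad_ext_base[OF F] by blast
  next
    case False
    let ?n = "a\<^sup>2 - b\<^sup>2 * r\<^sup>2"
    have n: "?n = x * (a - b * r)" using x by (simp add: algebra_simps power2_eq_square)
    have "inverse x = a / ?n + (- b / ?n) * r"
    proof (cases "x = 0")
      case False
      then have "?n \<noteq> 0" using n \<open>a - b * r \<noteq> 0\<close> by simp
      then have "a / ?n + (- b / ?n) * r = (a - b * r) / ?n" by (simp add: diff_divide_distrib)
      also have "\<dots> = inverse x" 
        unfolding n using \<open>a - b * r \<noteq> 0\<close> False by (metis inverse_eq_divide mult.commute
            nonzero_divide_mult_cancel_left)
      finally show ?thesis ..
    qed (simp add: n)
    moreover have "a / ?n \<in> F" "- b / ?n \<in> F" by (intro I x r)+
    ultimately show ?thesis using quad_extI by presburger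
  qed
qed

lemma quad_ext_unique:
  assumes F: "is_subfield F" and r: "r \<notin> F" and e: "a + b * r = c + d * r"
    and m: "a \<in> F" "b \<in> F" "c \<in> F" "d \<in> F"
  shows "a = c \<and> b = d"
proof (cases "b = d")
  case False
  then have "r = (c - a) / (b - d)" using e by (simp add: field_simps)
  moreover have "(c - a) / (b - d) \<in> F" using m by (intro subfield_intros[OF F])
  ultimately show ?thesis using r by simp
qed (use e in simp)

text \<open>With \<open>\<i>\<close> in the base field, a square root of a quadratic irrationality is never rational
  over the field that it generates: comparing coordinates in \<open>s\<^sup>2 = r\<close> would make \<open>r\<close> rational.\<close>
lemma sqrt_not_in_quad_ext:
  assumes F: "is_subfield F" and i: "\<i> \<in> F" and r: "r \<notin> F" "r\<^sup>2 \<in> F" and s: "s\<^sup>2 = r"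
  shows "s \<notin> quad_ext F r"
proof
  note I = subfield_intros[OF F]
  assume "s \<in> quad_ext F r"
  then obtain a b where ab: "s = a + b * r" "a \<in> F" "b \<in> F" unfolding quad_ext_def by blast
  have "(a\<^sup>2 + b\<^sup>2 * r\<^sup>2) + (2 * a * b) * r = 0 + 1 * r"
    using s unfolding ab(1) by (simp add: algebra_simps power2_eq_square)
  then have "a\<^sup>2 + b\<^sup>2 * r\<^sup>2 = 0 \<and> 2 * a * b = 1"
    by (rule quad_ext_unique[OF F r(1)]) (use ab r in \<open>auto intro!: I\<close>)
  then have e: "a\<^sup>2 + b\<^sup>2 * r\<^sup>2 = 0" and b: "b \<noteq> 0" by auto
  have "(b * r - \<i> * a) * (b * r + \<i> * a) = 0"
    using e by (simp add: algebra_simps power2_eq_square)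
  then have "b * r = \<i> * a \<or> b * r = - (\<i> * a)"
    unfolding mult_eq_0_iff by (simp add: add_eq_0_iff2)
  then have "r = \<i> * a / b \<or> r = - (\<i> * a / b)" using b by (auto simp: field_simps)
  moreover have "\<i> * a / b \<in> F" using ab i by (intro I)
  ultimately show False using r I(6) by auto
qed

section \<open>Homomorphisms on subfields and Galois groups\<close>

definition field_hom_on :: "complex set \<Rightarrow> (complex \<Rightarrow> complex) \<Rightarrow> bool" where
  "field_hom_on F f \<longleftrightarrow>
     f 1 = 1 \<and> (\<forall>x\<in>F. \<forall>y\<in>F. f (x + y) = f x + f y \<and> f (x * y) = f x * f y)"

lemma field_hom_closed:
  assumes F: "is_subfield F" and f: "field_hom_on F f"
  shows "f 1 = 1" "x \<in> F \<Longrightarrow> y \<in> F \<Longrightarrow> f (x + y) = f x + f y"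
    "x \<in> F \<Longrightarrow> y \<in> F \<Longrightarrow> f (x * y) = f x * f y"
    "f 0 = 0" "x \<in> F \<Longrightarrow> f (- x) = - f x" "x \<in> F \<Longrightarrow> y \<in> F \<Longrightarrow> f (x - y) = f x - f y"
    "x \<in> F \<Longrightarrow> f (inverse x) = inverse (f x)" "x \<in> F \<Longrightarrow> y \<in> F \<Longrightarrow> f (x / y) = f x / f y"
    "x \<in> F \<Longrightarrow> f (x ^ k) = f x ^ k" "f (of_nat m) = of_nat m" "f (numeral b) = numeral b"
proof -
  note I = subfield_intros[OF F]
  show o: "f 1 = 1" and a: "\<And>x y. x \<in> F \<Longrightarrow> y \<in> F \<Longrightarrow> f (x + y) = f x + f y"
    and m: "\<And>x y. x \<in> F \<Longrightarrow> y \<in> F \<Longrightarrow> f (x * y) = f x * f y"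
    using f unfolding field_hom_on_def by auto
  show z: "f 0 = 0" using a[OF I(5) I(5)] by simp
  show n: "f (- x) = - f x" if "x \<in> F" for x
    using a[OF that I(6)[OF that]] z by (simp add: add_eq_0_iff)
  show "f (x - y) = f x - f y" if "x \<in> F" "y \<in> F" for x y
    using a[OF that(1) I(6)[OF that(2)]] n[OF that(2)] by simp
  show v: "f (inverse x) = inverse (f x)" if "x \<in> F" for x
  proof (cases "x = 0")
    case False
    have "f x * f (inverse x) = 1" using m[OF that I(4)[OF that]] o False by simp
    then show ?thesis by (simp add: inverse_unique)
  qed (simp add: z)
  show "f (x / y) = f x / f y" if "x \<in> F" "y \<in> F" for x y
    using m[OF that(1) I(4)[OF that(2)]] v[OF that(2)] by (simp add: divide_inverse)
  show "f (x ^ k) = f x ^ k" if "x \<in> F" by (induction k) (use that in \<open>auto simp: o m I\<close>)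
  show w: "f (of_nat m) = of_nat m" for m by (induction m) (auto simp: z o a I)
  show "f (numeral b) = numeral b" using w[of "numeral b"] by simp
qed

text \<open>Coordinates with respect to 1 and \<open>r\<close> are unique, so a + b r can be sent to
  f a + f b s. Multiplicativity comes down to \<open>s\<^sup>2 = f (r\<^sup>2)\<close>; either
  square root may be chosen.\<close>

lemma field_hom_extend:
  assumes F: "is_subfield F" and f: "field_hom_on F f" and r: "r \<notin> F" "r\<^sup>2 \<in> F"
    and s: "s\<^sup>2 = f (r\<^sup>2)"
  shows "\<exists>g. field_hom_on (quad_ext F r) g \<and> (\<forall>x\<in>F. g x = f x) \<and> g r = s"
proof -
  note I = subfield_intros[OF F] and H = field_hom_closed[OF F f]
  define g where "g x = (let p = (THE p. fst p \<in> F \<and> snd p \<in> F \<and> x = fst p + snd p * r)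
    in f (fst p) + f (snd p) * s)" for x
  have g: "g (a + b * r) = f a + f b * s" if "a \<in> F" "b \<in> F" for a b
  proof -
    have "(THE p. fst p \<in> F \<and> snd p \<in> F \<and> a + b * r = fst p + snd p * r) = (a, b)"
    proof (rule the_equality)
      fix p assume "fst p \<in> F \<and> snd p \<in> F \<and> a + b * r = fst p + snd p * r"
      then have "a = fst p \<and> b = snd p" using quad_ext_unique[OF F r(1) _ that] by blast
      then show "p = (a, b)" by (simp add: prod_eq_iff)
    qed (use that in simp)
    then show ?thesis unfolding g_def by simp
  qed
  have gF: "g x = f x" if "x \<in> F" for x using g[OF that I(5)] by (simp add: H)
  have "g r = s" using g[OF I(5) I(1)] by (simp add: H)
  moreover have "field_hom_on (quad_ext F r) g"
    unfolding field_hom_on_def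
  proof (intro conjI ballI)
    show "g 1 = 1" using gF[OF I(1)] H by simp
    fix x y assume "x \<in> quad_ext F r" "y \<in> quad_ext F r"
    then obtain a b c d where x: "x = a + b * r" "a \<in> F" "b \<in> F"
      and y: "y = c + d * r" "c \<in> F" "d \<in> F" unfolding quad_ext_def by blast
    have gx: "g x = f a + f b * s" and gy: "g y = f c + f d * s"
      unfolding x(1) y(1) by (intro g x y)+
    have e: "x + y = (a + c) + (b + d) * r" using x y by (simp add: algebra_simps)
    have "g (x + y) = f (a + c) + f (b + d) * s" unfolding e by (intro g I x y)
    then show "g (x + y) = g x + g y"
      unfolding gx gy using x y by (simp add: H(2) algebra_simps)
    have e': "x * y = (a * c + b * d * r\<^sup>2) + (a * d + b * c) * r"
      using x y by (simp add: algebra_simps power2_eq_square)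
    have "g (x * y) = f (a * c + b * d * r\<^sup>2) + f (a * d + b * c) * s"
      unfolding e' by (intro g I x y r)
    also have "f (a * c + b * d * r\<^sup>2) = f a * f c + f b * f d * s\<^sup>2"
      using x y r unfolding s by (simp only: H(2,3) I(3))
    also have "f (a * d + b * c) = f a * f d + f b * f c"
      using x y by (simp only: H(2,3) I(3))
    also have "f a * f c + f b * f d * s\<^sup>2 + (f a * f d + f b * f c) * s = g x * g y"
      unfolding gx gy by (simp add: algebra_simps power2_eq_square)
    finally show "g (x * y) = g x * g y" .
  qed
  ultimately show ?thesis using gF by blast
qed

text \<open>The set on which two homomorphisms agree is a subfield containing the
  generators.\<close>

lemma field_hom_unique:
  assumes f: "field_hom_on (rat_adjoin S) f" and g: "field_hom_on (rat_adjoin S) g"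
    and e: "\<And>s. s \<in> S \<Longrightarrow> f s = g s" and x: "x \<in> rat_adjoin S"
  shows "f x = g x"
proof -
  note K = subfield_rat_adjoin[of S]
  note I = subfield_intros[OF K] and Hf = field_hom_closed[OF K f] and Hg = field_hom_closed[OF K g]
  have "is_subfield {x \<in> rat_adjoin S. f x = g x}"
    unfolding is_subfield_def by (auto simp: I Hf Hg)
  from rat_adjoin_least[OF this, of S] show ?thesis
    using e x rat_adjoin_superset[of S] by blast
qed

lemma field_hom_image:
  assumes f: "field_hom_on (rat_adjoin S) f" and e: "\<And>s. s \<in> S \<Longrightarrow> f s \<in> rat_adjoin S"
    and x: "x \<in> rat_adjoin S"
  shows "f x \<in> rat_adjoin S"
proof -
  note K = subfield_rat_adjoin[of S]
  note I = subfield_intros[OF K] and H = field_hom_closed[OF K f]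
  have "is_subfield {x \<in> rat_adjoin S. f x \<in> rat_adjoin S}"
    unfolding is_subfield_def by (auto simp: I H)
  from rat_adjoin_least[OF this, of S] show ?thesis
    using e x rat_adjoin_superset[of S] by blast
qed

text \<open>Bijectivity comes from an inverse homomorphism, so that everything is checked on
  generators.\<close>

lemma galI:
  assumes f: "field_hom_on (rat_adjoin S) f" and e: "\<And>s. s \<in> S \<Longrightarrow> f s \<in> rat_adjoin S"
    and g: "field_hom_on (rat_adjoin S) g" and e': "\<And>s. s \<in> S \<Longrightarrow> g s \<in> rat_adjoin S"
    and fg: "\<And>s. s \<in> S \<Longrightarrow> f (g s) = s" and gf: "\<And>s. s \<in> S \<Longrightarrow> g (f s) = s"
  shows "restrict f (rat_adjoin S) \<in> gal (rat_adjoin S)"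
proof -
  let ?K = "rat_adjoin S"
  note K = subfield_rat_adjoin[of S]
  note I = subfield_intros[OF K] and Hf = field_hom_closed[OF K f] and Hg = field_hom_closed[OF K g]
  note mf = field_hom_image[OF f e] and mg = field_hom_image[OF g e']
  have id: "field_hom_on ?K (\<lambda>x. x)" by (simp add: field_hom_on_def)
  have "field_hom_on ?K (\<lambda>x. f (g x))" "field_hom_on ?K (\<lambda>x. g (f x))"
    unfolding field_hom_on_def using mf mg by (auto simp: I Hf Hg)
  then have fg': "f (g x) = x" and gf': "g (f x) = x" if "x \<in> ?K" for x
    using field_hom_unique[OF _ id _ that] fg gf by blast+
  have "bij_betw f ?K ?K"
    by (rule bij_betw_byWitness[where f' = g]) (use mf mg fg' gf' in auto)
  then have "bij_betw (restrict f ?K) ?K ?K" by simp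
  then show ?thesis unfolding gal_def by (auto simp: I Hf)
qed

text \<open>The point is \<open>f 1 = 1\<close>: this value is idempotent, and injectivity separates
  it from \<open>f 0 = 0\<close>.\<close>

lemma gal_hom: "is_subfield K \<Longrightarrow> f \<in> gal K \<Longrightarrow> field_hom_on K f"
proof -
  assume K: "is_subfield K" and f: "f \<in> gal K"
  note I = subfield_intros[OF K]
  have hom: "f (x + y) = f x + f y" "f (x * y) = f x * f y" if "x \<in> K" "y \<in> K" for x y
    using f that unfolding gal_def by auto
  have "f 0 = 0" using hom(1)[of 0 0] I by simp
  moreover have "inj_on f K" using f unfolding gal_def bij_betw_def by auto
  then have "f 1 \<noteq> f 0" using I by (metis inj_on_contraD zero_neq_one)
  moreover have "f 1 * f 1 = f 1" using hom(2)[of 1 1] I by simp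
  ultimately show ?thesis using hom unfolding field_hom_on_def by auto
qed

lemma gal_extensional: "f \<in> gal K \<Longrightarrow> f \<in> extensional K"
  unfolding gal_def by auto

lemma gal_eqI:
  assumes f: "f \<in> gal (rat_adjoin S)" and g: "g \<in> gal (rat_adjoin S)"
    and e: "\<And>s. s \<in> S \<Longrightarrow> f s = g s"
  shows "f = g"
proof (rule extensionalityI[OF gal_extensional[OF f] gal_extensional[OF g]])
  fix x assume "x \<in> rat_adjoin S"
  then show "f x = g x"
    using field_hom_unique[OF gal_hom[OF subfield_rat_adjoin f] gal_hom[OF subfield_rat_adjoin g] e]
    by blast
qed

section \<open>The automorphisms of \<open>L2\<close> and \<open>K1\<close>\<close>

lemma sqrt2_not_Rats: "complex_of_real (sqrt 2) \<notin> \<rat>"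
proof
  assume "complex_of_real (sqrt 2) \<in> \<rat>"
  then have "sqrt 2 \<in> \<rat>" by simp
  then obtain m n :: nat where n: "n \<noteq> 0" and e: "\<bar>sqrt 2\<bar> = real m / real n"
    and c: "coprime m n" by (rule Rats_abs_nat_div_natE)
  have "sqrt 2 * real n = real m" using n e by (simp add: field_simps)
  then have "(sqrt 2 * real n)\<^sup>2 = (real m)\<^sup>2" by simp
  then have "real (2 * n\<^sup>2) = real (m\<^sup>2)" by (simp add: power_mult_distrib)
  then have m: "2 * n\<^sup>2 = m\<^sup>2" using of_nat_eq_iff by blast
  then have "even (m\<^sup>2)" by presburger
  then have "even m" by simp
  then obtain k where k: "m = 2 * k" by blast
  then have "n\<^sup>2 = 2 * k\<^sup>2" using m by (simp add: power_mult_distrib)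
  then have "even (n\<^sup>2)" by presburger
  then have "even n" by simp
  then show False using \<open>even m\<close> c coprime_common_divisor by fastforce
qed

lemma subfield_L2: "is_subfield L2"
  unfolding L2_def by (rule subfield_rat_adjoin)

lemma zeta16_in_L2: "\<zeta> \<in> L2"
  unfolding L2_def using rat_adjoin_superset by blast

text \<open>The map is built along Q, Q(i), Q(\<zeta>^2), Q(\<zeta>). Each generator is a square
  root of the previous one, so sending all of them to their k-th powers is compatible; at the
  bottom, k odd gives (i^k)^2 = -1. Three checks that a square root is new take the place of the
  irreducibility of x^8 + 1.\<close>

lemma zeta16_field_hom:
  assumes "odd k"
  shows "\<exists>f. field_hom_on L2 f \<and> f \<zeta> = \<zeta> ^ k"
proof -
  let ?F1 = "quad_ext \<rat> \<i>"
  let ?F2 = "quad_ext ?F1 (\<zeta>\<^sup>2)"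
  have F1: "is_subfield ?F1" by (rule subfield_quad_ext[OF subfield_Rats]) simp
  have i1: "\<i> \<in> ?F1" by (rule quad_ext_gen[OF subfield_Rats])
  have w: "(\<zeta>\<^sup>2)\<^sup>2 = \<i>" using zeta16_pow4 by (simp flip: power_mult)
  have F2: "is_subfield ?F2" by (rule subfield_quad_ext[OF F1]) (use w i1 in simp)
  have i0: "\<i> \<notin> \<rat>"
  proof
    assume "\<i> \<in> \<rat>"
    then have "\<i> \<in> \<real>" using Rats_subset_subfield[OF subfield_Reals] by blast
    then show False by (simp add: complex_is_Real_iff)
  qed
  \<comment> \<open>Comparing real parts would make sqrt 2 / 2 equal to the rational
    \<open>a\<close>.\<close>
  have w1: "\<zeta>\<^sup>2 \<notin> ?F1"
  proof
    assume "\<zeta>\<^sup>2 \<in> ?F1"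
    then obtain a b where ab: "\<zeta>\<^sup>2 = a + b * \<i>" "a \<in> \<rat>" "b \<in> \<rat>" unfolding quad_ext_def by blast
    then have "a \<in> \<real>" "b \<in> \<real>" using Rats_subset_subfield[OF subfield_Reals] by blast+
    then have "Re (\<zeta>\<^sup>2) = Re a" unfolding ab(1) by (simp add: complex_is_Real_iff)
    then have "complex_of_real (sqrt 2) = 2 * a" using \<open>a \<in> \<real>\<close>
      unfolding zeta16_sq by (simp add: complex_eq_iff complex_is_Real_iff)
    then show False using sqrt2_not_Rats ab by simp
  qed
  have z2: "\<zeta> \<notin> ?F2" by (rule sqrt_not_in_quad_ext[OF F1 i1 w1]) (use w i1 in simp_all)
  have w2: "\<zeta>\<^sup>2 \<in> ?F2" by (rule quad_ext_gen[OF F1])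
  have "field_hom_on \<rat> (\<lambda>x. x)" by (simp add: field_hom_on_def)
  moreover have "(\<i> ^ k)\<^sup>2 = \<i>\<^sup>2"
    using \<open>odd k\<close> by (simp add: power2_eq_square flip: power_mult_distrib)
  ultimately obtain f1 where f1: "field_hom_on ?F1 f1" "f1 \<i> = \<i> ^ k"
    using field_hom_extend[OF subfield_Rats _ i0, of "\<lambda>x. x" "\<i> ^ k"] by auto
  have "((\<zeta>\<^sup>2) ^ k)\<^sup>2 = ((\<zeta>\<^sup>2)\<^sup>2) ^ k" by (simp add: mult.commute flip: power_mult)
  then have "((\<zeta>\<^sup>2) ^ k)\<^sup>2 = f1 ((\<zeta>\<^sup>2)\<^sup>2)" unfolding w f1(2) .
  from field_hom_extend[OF F1 f1(1) w1 _ this]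
  obtain f2 where f2: "field_hom_on ?F2 f2" "f2 (\<zeta>\<^sup>2) = (\<zeta>\<^sup>2) ^ k"
    using w i1 by auto
  have "(\<zeta> ^ k)\<^sup>2 = f2 (\<zeta>\<^sup>2)" unfolding f2(2) by (simp add: mult.commute flip: power_mult)
  from field_hom_extend[OF F2 f2(1) z2 w2 this]
  obtain f3 where f3: "field_hom_on (quad_ext ?F2 \<zeta>) f3" "f3 \<zeta> = \<zeta> ^ k" by blast
  have "is_subfield (quad_ext ?F2 \<zeta>)" by (rule subfield_quad_ext[OF F2 w2])
  then have "L2 \<subseteq> quad_ext ?F2 \<zeta>"
    unfolding L2_def by (rule rat_adjoin_least) (simp add: quad_ext_gen[OF F2])
  then have "field_hom_on L2 f3" using f3(1) unfolding field_hom_on_def by blast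
  then show ?thesis using f3(2) by blast
qed

text \<open>Resolves the definite description in \<open>sigma\<close>. The inverse map sends \<zeta>
  to \<zeta>^l with k l = 1 modulo 16, and an automorphism of \<open>L2\<close> is determined by its
  value at \<zeta>. The natural exponent \<open>k\<close> replaces a possibly negative
  \<open>c\<close>.\<close>

lemma sigma_gal:
  assumes c: "odd c" and k: "[int k = c] (mod 16)"
  shows "sigma c \<in> gal L2" "sigma c \<zeta> = \<zeta> ^ k"
proof -
  note I = subfield_intros[OF subfield_L2]
  have "[int k = c] (mod 2)" by (rule cong_dvd_modulus[OF k]) simp
  then have "odd k" using c cong_dvd_iff[of "int k" c 2] by simp
  then have "coprime k (2 ^ 4)" by (simp only: coprime_power_right_iff coprime_right_2_iff_odd simp_thms)
  then have "coprime k 16" by simp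
  from cong_solve_coprime_nat[OF this] obtain l where l: "[k * l = 1] (mod 16)" by auto
  have "[k * l = 1] (mod 2)" by (rule cong_dvd_modulus_nat[OF l]) simp
  then have "odd l" using cong_dvd_iff[of "k * l" 1 2] by simp
  obtain f where f: "field_hom_on L2 f" "f \<zeta> = \<zeta> ^ k" using zeta16_field_hom[OF \<open>odd k\<close>] by blast
  obtain g where g: "field_hom_on L2 g" "g \<zeta> = \<zeta> ^ l" using zeta16_field_hom[OF \<open>odd l\<close>] by blast
  have "\<zeta> ^ (k * l) = \<zeta> ^ 1" using l unfolding cong_def by (rule zeta16_power_cong)
  then have kl: "(\<zeta> ^ k) ^ l = \<zeta>" "(\<zeta> ^ l) ^ k = \<zeta>"
    by (metis power_mult power_one_right, metis mult.commute power_mult power_one_right)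
  have fg: "f (g \<zeta>) = \<zeta>" "g (f \<zeta>) = \<zeta>"
    unfolding f(2) g(2) field_hom_closed(9)[OF subfield_L2 f(1) zeta16_in_L2]
      field_hom_closed(9)[OF subfield_L2 g(1) zeta16_in_L2] by (fact kl)+
  have r: "restrict f L2 \<in> gal L2"
    unfolding L2_def
    by (rule galI[where g = g], unfold L2_def[symmetric])
      (use f g fg I(9)[OF zeta16_in_L2] in auto)
  have pi: "\<zeta> powi c = \<zeta> ^ k"
  proof -
    obtain j where "c = int k + 16 * j" using k unfolding cong_iff_lin by blast
    moreover have "\<zeta> powi (16 * j) = 1"
      by (simp add: power_int_mult power_int_numeral zeta16_pow16)
    ultimately show ?thesis by (simp add: power_int_add)
  qed
  have "sigma c = restrict f L2" unfolding sigma_def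
  proof (rule the_equality)
    show "restrict f L2 \<in> gal L2 \<and> restrict f L2 \<zeta> = \<zeta> powi c"
      using r pi f zeta16_in_L2 by simp
    fix f' assume f': "f' \<in> gal L2 \<and> f' \<zeta> = \<zeta> powi c"
    show "f' = restrict f L2"
      by (rule gal_eqI[of _ "{\<zeta>}"], unfold L2_def[symmetric])
        (use f' r pi f zeta16_in_L2 in auto)
  qed
  then show "sigma c \<in> gal L2" "sigma c \<zeta> = \<zeta> ^ k" using r f zeta16_in_L2 by simp_all
qed

lemma subfield_K1: "is_subfield K1"
  unfolding K1_def by (rule subfield_rat_adjoin)

lemma K1_subset_L2: "K1 \<subseteq> L2"
  unfolding K1_def
  by (rule rat_adjoin_least[OF subfield_L2])
    (simp add: sqrt2_eq subfield_intros[OF subfield_L2] zeta16_in_L2)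

lemma K1_subset_Reals: "K1 \<subseteq> \<real>"
  unfolding K1_def by (rule rat_adjoin_least[OF subfield_Reals]) simp

lemma sqrt2_in_K1: "complex_of_real (sqrt 2) \<in> K1"
  unfolding K1_def using rat_adjoin_superset by blast

lemma sigma3_hom: "field_hom_on L2 (sigma 3)" and sigma3_zeta: "sigma 3 \<zeta> = \<zeta> ^ 3"
  using sigma_gal[of 3 3] gal_hom[OF subfield_L2] by auto

lemma sigma3_sqrt2: "sigma 3 (complex_of_real (sqrt 2)) = - complex_of_real (sqrt 2)"
proof -
  note H = field_hom_closed[OF subfield_L2 sigma3_hom]
    and I = subfield_intros[OF subfield_L2] zeta16_in_L2
  have "sigma 3 (\<zeta>\<^sup>2 + \<zeta> ^ 14) = (\<zeta> ^ 3) ^ 2 + (\<zeta> ^ 3) ^ 14"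
    by (simp add: H(2,9) I sigma3_zeta)
  \<comment> \<open>Modulo 16 the exponents 6 and 42 become 22 and 10; splitting off 8 produces the
    sign.\<close>
  also have "\<dots> = \<zeta> ^ (14 + 8) + \<zeta> ^ (2 + 8)"
    by (simp add: zeta16_power_cong[of 6 22] zeta16_power_cong[of 42 10] flip: power_mult)
  also have "\<dots> = - (\<zeta>\<^sup>2 + \<zeta> ^ 14)" unfolding power_add zeta16_pow8 by simp
  finally show ?thesis unfolding sqrt2_eq .
qed

text \<open>An automorphism sends sqrt 2 to a square root of 2. Distinctness matters because trace
  and norm run over a set of maps.\<close>

lemma gal_K1: "gal K1 = {restrict (\<lambda>x. x) K1, restrict (sigma 3) K1}"
  and gal_K1_distinct: "restrict (\<lambda>x. x) K1 \<noteq> restrict (sigma 3) K1"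
proof -
  let ?r = "complex_of_real (sqrt 2)"
  note m = sqrt2_in_K1 and I = subfield_intros[OF subfield_K1]
  have id: "field_hom_on K1 (\<lambda>x. x)" by (simp add: field_hom_on_def)
  have s: "field_hom_on K1 (sigma 3)"
    using sigma3_hom K1_subset_L2 unfolding field_hom_on_def by blast
  have r1: "restrict (\<lambda>x. x) K1 \<in> gal K1" unfolding K1_def
    by (rule galI[where g = "\<lambda>x. x"], unfold K1_def[symmetric]) (use id m in auto)
  have r2: "restrict (sigma 3) K1 \<in> gal K1" unfolding K1_def
    by (rule galI[where g = "sigma 3"], unfold K1_def[symmetric])
      (use s I(6)[OF m] field_hom_closed(5)[OF subfield_K1 s m] in \<open>auto simp: sigma3_sqrt2\<close>)
  show "restrict (\<lambda>x. x) K1 \<noteq> restrict (sigma 3) K1"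
  proof
    assume "restrict (\<lambda>x. x) K1 = restrict (sigma 3) K1"
    then have "restrict (\<lambda>x. x) K1 ?r = restrict (sigma 3) K1 ?r" by simp
    then show False using m by (simp add: sigma3_sqrt2)
  qed
  have "f = restrict (\<lambda>x. x) K1 \<or> f = restrict (sigma 3) K1" if f: "f \<in> gal K1" for f
  proof -
    note H = field_hom_closed[OF subfield_K1 gal_hom[OF subfield_K1 f]]
    have "(f ?r)\<^sup>2 = f (?r\<^sup>2)" by (rule H(9)[OF m, symmetric])
    also have "?r\<^sup>2 = 2" by (simp flip: of_real_power)
    finally have "(f ?r)\<^sup>2 = ?r\<^sup>2" by (simp add: H(11) flip: of_real_power)
    then have "f ?r = ?r \<or> f ?r = - ?r" by (simp add: power2_eq_iff)
    then show ?thesis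
    proof
      assume "f ?r = ?r"
      then have "f = restrict (\<lambda>x. x) K1"
        by (intro gal_eqI[of _ "{?r}"], unfold K1_def[symmetric]) (use f r1 m in auto)
      then show ?thesis ..
    next
      assume "f ?r = - ?r"
      then have "f = restrict (sigma 3) K1"
        by (intro gal_eqI[of _ "{?r}"], unfold K1_def[symmetric])
          (use f r2 m in \<open>auto simp: sigma3_sqrt2\<close>)
      then show ?thesis ..
    qed
  qed
  then show "gal K1 = {restrict (\<lambda>x. x) K1, restrict (sigma 3) K1}" using r1 r2 by blast
qed

lemma field_trace_K1: "x \<in> K1 \<Longrightarrow> field_trace K1 x = x + sigma 3 x"
  and field_norm_K1: "x \<in> K1 \<Longrightarrow> field_norm K1 x = x * sigma 3 x"
  unfolding field_trace_def field_norm_def gal_K1 using gal_K1_distinct by simp_all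

subsection \<open>Congruences in subrings\<close>

text \<open>A carrier set covers subrings of the complex numbers and of complex polynomials alike.
  In \<open>eqm\<close> the quotient must lie in the carrier: with arbitrary complex quotients every
  congruence modulo a nonzero \<open>q\<close> would hold.\<close>

locale subring_cong =
  fixes S :: "'a :: comm_ring_1 set"
  assumes one_closed: "1 \<in> S" and diff_closed: "x \<in> S \<Longrightarrow> y \<in> S \<Longrightarrow> x - y \<in> S"
    and mult_closed: "x \<in> S \<Longrightarrow> y \<in> S \<Longrightarrow> x * y \<in> S"
begin

lemma zero_closed: "0 \<in> S" using diff_closed[OF one_closed one_closed] by simp

lemma uminus_closed: "x \<in> S \<Longrightarrow> - x \<in> S" using diff_closed[OF zero_closed] by force

lemma add_closed: "x \<in> S \<Longrightarrow> y \<in> S \<Longrightarrow> x + y \<in> S"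
  using diff_closed[OF _ uminus_closed] by force

lemma power_closed: "x \<in> S \<Longrightarrow> x ^ k \<in> S"
  by (induction k) (auto intro: one_closed mult_closed)

lemma of_nat_closed: "of_nat k \<in> S"
  by (induction k) (auto intro: zero_closed one_closed add_closed)

lemma of_int_closed: "of_int k \<in> S"
  by (cases k rule: int_cases2) (auto intro: of_nat_closed uminus_closed)

lemma numeral_closed: "numeral b \<in> S"
  using of_nat_closed[of "numeral b"] by simp

lemma sum_closed: "(\<And>i. i \<in> I \<Longrightarrow> f i \<in> S) \<Longrightarrow> sum f I \<in> S"
  by (induction I rule: infinite_finite_induct) (auto intro: zero_closed add_closed)

lemmas closed = one_closed zero_closed diff_closed uminus_closed add_closed mult_closed
  power_closed of_nat_closed of_int_closed numeral_closed sum_closed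

definition eqm :: "int \<Rightarrow> 'a \<Rightarrow> 'a \<Rightarrow> bool" where
  "eqm q x y \<longleftrightarrow> (\<exists>r\<in>S. x - y = of_int q * r)"

lemma eqmI: "r \<in> S \<Longrightarrow> x - y = of_int q * r \<Longrightarrow> eqm q x y"
  unfolding eqm_def by blast

lemma eqm_refl [simp]: "eqm q x x"
  by (rule eqmI[OF zero_closed]) simp

lemma eqm_sym: "eqm q x y \<Longrightarrow> eqm q y x"
  unfolding eqm_def using uminus_closed by (metis minus_diff_eq mult_minus_right)

lemma eqm_add: "eqm q x y \<Longrightarrow> eqm q x' y' \<Longrightarrow> eqm q (x + x') (y + y')"
  unfolding eqm_def using add_closed by (metis add_diff_add distrib_left)

lemma eqm_uminus: "eqm q x y \<Longrightarrow> eqm q (- x) (- y)"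
  unfolding eqm_def using uminus_closed by (metis minus_diff_minus mult_minus_right)

lemma eqm_diff: "eqm q x y \<Longrightarrow> eqm q x' y' \<Longrightarrow> eqm q (x - x') (y - y')"
  using eqm_add[OF _ eqm_uminus] by force

lemma eqm_trans [trans]:
  assumes "eqm q x y" "eqm q y z"
  shows "eqm q x z"
proof -
  have "eqm q (x + y - y) (y + z - y)" by (intro eqm_add eqm_diff assms eqm_refl)
  then show ?thesis by simp
qed

lemma eqm_mult_left: "c \<in> S \<Longrightarrow> eqm q x y \<Longrightarrow> eqm q (c * x) (c * y)"
  unfolding eqm_def using mult_closed by (metis mult.left_commute right_diff_distrib)

lemma eqm_mult_right: "c \<in> S \<Longrightarrow> eqm q x y \<Longrightarrow> eqm q (x * c) (y * c)"
  using eqm_mult_left by (simp add: mult.commute)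

lemma eqm_mult: "eqm q x y \<Longrightarrow> eqm q x' y' \<Longrightarrow> x' \<in> S \<Longrightarrow> y \<in> S \<Longrightarrow> eqm q (x * x') (y * y')"
  using eqm_trans[OF eqm_mult_right eqm_mult_left] by blast

lemma eqm_power:
  assumes "eqm q x y" "x \<in> S" "y \<in> S"
  shows "eqm q (x ^ k) (y ^ k)"
  by (induction k) (auto intro!: eqm_mult assms power_closed)

lemma eqm_dvd:
  assumes "eqm m x y" "q dvd m"
  shows "eqm q x y"
proof -
  obtain r k where "r \<in> S" "x - y = of_int m * r" "m = q * k" using assms unfolding eqm_def by blast
  then show ?thesis by (intro eqmI[of "of_int k * r"]) (auto intro: closed)
qed

lemma frobenius_add:
  assumes p: "prime p" and x: "x \<in> S" and y: "y \<in> S"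
  shows "eqm (int p) ((x + y) ^ p) (x ^ p + y ^ p)"
proof -
  have p0: "p > 0" using p prime_gt_0_nat by blast
  \<comment> \<open>The quotient of the middle binomial terms by \<open>p\<close>, written out
    because it must be exhibited as an element of \<open>S\<close>.\<close>
  define r where "r = (\<Sum>k\<in>{1..<p}. of_nat ((p choose k) div p) * x ^ k * y ^ (p - k))"
  have "(x + y) ^ p = (\<Sum>k\<le>p. of_nat (p choose k) * x ^ k * y ^ (p - k))"
    by (rule binomial_ring)
  also have "{..p} = insert 0 (insert p {1..<p})" using p0 by auto
  also have "(\<Sum>k\<in>\<dots>. of_nat (p choose k) * x ^ k * y ^ (p - k)) =
      x ^ p + y ^ p + (\<Sum>k\<in>{1..<p}. of_nat (p choose k) * x ^ k * y ^ (p - k))"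
    using p0 by (simp add: add_ac)
  also have "(\<Sum>k\<in>{1..<p}. of_nat (p choose k) * x ^ k * y ^ (p - k)) = of_int (int p) * r"
    unfolding r_def sum_distrib_left
  proof (rule sum.cong)
    fix k assume k: "k \<in> {1..<p}"
    then have "p dvd (p choose k)" using p by (intro dvd_choose_prime) auto
    then have "of_nat (p choose k) = (of_int (int p) * of_nat ((p choose k) div p) :: 'a)"
      by (metis dvd_mult_div_cancel of_int_of_nat_eq of_nat_mult)
    then show "of_nat (p choose k) * x ^ k * y ^ (p - k)
        = of_int (int p) * (of_nat ((p choose k) div p) * x ^ k * y ^ (p - k))"
      by (simp add: mult.assoc)
  qed simp
  finally have "(x + y) ^ p - (x ^ p + y ^ p) = of_int (int p) * r" by simp
  moreover have "r \<in> S" unfolding r_def by (intro closed x y)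
  ultimately show ?thesis by (intro eqmI)
qed

lemma frobenius_pow_add:
  assumes p: "prime p" and x: "x \<in> S" and y: "y \<in> S"
  shows "eqm (int p) ((x + y) ^ (p ^ k)) (x ^ (p ^ k) + y ^ (p ^ k))"
proof (induction k)
  case (Suc k)
  have "eqm (int p) (((x + y) ^ (p ^ k)) ^ p) ((x ^ (p ^ k) + y ^ (p ^ k)) ^ p)"
    by (rule eqm_power[OF Suc]) (intro closed x y)+
  also have "eqm (int p) \<dots> ((x ^ (p ^ k)) ^ p + (y ^ (p ^ k)) ^ p)"
    by (intro frobenius_add p closed x y)
  finally show ?case by (simp add: mult.commute flip: power_mult)
qed simp

lemma frobenius_sum:
  assumes p: "prime p" and f: "\<And>i. i \<in> I \<Longrightarrow> f i \<in> S"
  shows "eqm (int p) (sum f I ^ p) (\<Sum>i\<in>I. f i ^ p)"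
  using f
proof (induction I rule: infinite_finite_induct)
  case (insert i I)
  have "eqm (int p) ((f i + sum f I) ^ p) (f i ^ p + sum f I ^ p)"
    by (intro frobenius_add p sum_closed insert.prems) auto
  also have "eqm (int p) \<dots> (f i ^ p + (\<Sum>i\<in>I. f i ^ p))"
    by (intro eqm_add insert.IH insert.prems) auto
  finally show ?case using insert by simp
qed (use prime_gt_0_nat[OF p] in \<open>simp_all add: power_0_left\<close>)

end

section \<open>The ring Z[1/17, \<zeta>] and its rational part\<close>

definition Zinv17 :: "complex set" where
  "Zinv17 = {of_int m / 17 ^ k | m k. True}"

text \<open>This is Z[1/17, \<zeta>]; 17 is inverted because the denominators of \<alpha> divide
  powers of 17. The explicit coordinates serve \<open>R16_fixed\<close>, which reads off the
  rational part.\<close>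

definition R16 :: "complex set" where
  "R16 = {\<Sum>i<8. a i * \<zeta> ^ i | a. \<forall>i. a i \<in> Zinv17}"

interpretation A: subring_cong Zinv17
proof
  show "1 \<in> Zinv17" unfolding Zinv17_def by (rule CollectI, rule exI[of _ 1], rule exI[of _ 0]) simp
  fix x y assume "x \<in> Zinv17" "y \<in> Zinv17"
  then obtain m k n l where x: "x = of_int m / 17 ^ k" and y: "y = of_int n / 17 ^ l"
    unfolding Zinv17_def by blast
  have "x - y = of_int (m * 17 ^ l - n * 17 ^ k) / 17 ^ (k + l)"
    unfolding x y by (simp add: field_simps power_add)
  then show "x - y \<in> Zinv17" unfolding Zinv17_def by blast
  have "x * y = of_int (m * n) / 17 ^ (k + l)" unfolding x y by (simp add: power_add)
  then show "x * y \<in> Zinv17" unfolding Zinv17_def by blast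
qed

lemma inv17_in_Zinv17: "1 / 17 \<in> Zinv17"
  unfolding Zinv17_def by (rule CollectI, rule exI[of _ 1], rule exI[of _ 1]) simp

lemma R16I: "(\<And>i. a i \<in> Zinv17) \<Longrightarrow> (\<Sum>i<8. a i * \<zeta> ^ i) \<in> R16"
  unfolding R16_def by blast

lemma Zinv17_subset_R16: "Zinv17 \<subseteq> R16"
proof
  fix x assume x: "x \<in> Zinv17"
  have "(\<Sum>i<8. (if i = 0 then x else 0) * \<zeta> ^ i) \<in> R16"
    by (rule R16I) (simp add: x A.closed)
  then show "x \<in> R16" by (simp add: if_distribR eval_nat_numeral)
qed

lemma R16_add: "x \<in> R16 \<Longrightarrow> y \<in> R16 \<Longrightarrow> x + y \<in> R16"
proof -
  assume "x \<in> R16" "y \<in> R16"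
  then obtain a b where a: "\<forall>i. a i \<in> Zinv17" "x = (\<Sum>i<8. a i * \<zeta> ^ i)"
    and b: "\<forall>i. b i \<in> Zinv17" "y = (\<Sum>i<8. b i * \<zeta> ^ i)" unfolding R16_def by blast
  have "x + y = (\<Sum>i<8. (a i + b i) * \<zeta> ^ i)" unfolding a b by (simp add: sum.distrib algebra_simps)
  then show ?thesis using R16I[of "\<lambda>i. a i + b i"] a b A.closed by auto
qed

lemma R16_scale: "c \<in> Zinv17 \<Longrightarrow> x \<in> R16 \<Longrightarrow> c * x \<in> R16"
proof -
  assume c: "c \<in> Zinv17" and "x \<in> R16"
  then obtain a where a: "\<forall>i. a i \<in> Zinv17" "x = (\<Sum>i<8. a i * \<zeta> ^ i)" unfolding R16_def by blast
  have "c * x = (\<Sum>i<8. (c * a i) * \<zeta> ^ i)" unfolding a by (simp add: sum_distrib_left mult.assoc)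
  then show ?thesis using R16I[of "\<lambda>i. c * a i"] a c A.closed by auto
qed

lemma R16_shift: "x \<in> R16 \<Longrightarrow> \<zeta> * x \<in> R16"
proof -
  assume "x \<in> R16"
  then obtain a where a: "\<forall>i. a i \<in> Zinv17" "x = (\<Sum>i<8. a i * \<zeta> ^ i)" unfolding R16_def by blast
  \<comment> \<open>Multiplication by \<zeta> rotates the coordinates; the top one wraps around with
    a sign, as \<open>\<zeta> ^ 8 = -1\<close>.\<close>
  define b where "b i = (if i = 0 then - a 7 else a (i - 1))" for i :: nat
  have "\<zeta> * x = (\<Sum>i<8. a i * \<zeta> ^ Suc i)" unfolding a sum_distrib_left by (simp add: mult_ac)
  also have "\<dots> = (\<Sum>i<7. a i * \<zeta> ^ Suc i) + a 7 * \<zeta> ^ 8"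
    using sum.lessThan_Suc[of "\<lambda>i. a i * \<zeta> ^ Suc i" 7] by simp
  also have "\<dots> = b 0 * \<zeta> ^ 0 + (\<Sum>i<7. b (Suc i) * \<zeta> ^ Suc i)"
    by (simp add: b_def zeta16_pow8)
  also have "\<dots> = (\<Sum>i<8. b i * \<zeta> ^ i)"
    using sum.lessThan_Suc_shift[of "\<lambda>i. b i * \<zeta> ^ i" 7] by simp
  finally show ?thesis using R16I[of b] a A.closed by (auto simp: b_def)
qed

lemma R16_zeta_pow_mult: "x \<in> R16 \<Longrightarrow> \<zeta> ^ k * x \<in> R16"
  by (induction k) (auto simp: mult.assoc intro: R16_shift)

interpretation R: subring_cong R16
proof
  show "1 \<in> R16" using Zinv17_subset_R16 A.one_closed by blast
  fix x y assume x: "x \<in> R16" and y: "y \<in> R16"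
  have "x + (-1) * y \<in> R16" by (intro R16_add R16_scale x y A.closed)
  then show "x - y \<in> R16" by simp
  obtain a where a: "\<forall>i. a i \<in> Zinv17" "x = (\<Sum>i<8. a i * \<zeta> ^ i)"
    using x unfolding R16_def by blast
  have "(\<Sum>i<n. a i * (\<zeta> ^ i * y)) \<in> R16" for n
  proof (induction n)
    case 0
    show ?case using Zinv17_subset_R16 A.zero_closed by auto
  next
    case (Suc n)
    have "a n * (\<zeta> ^ n * y) \<in> R16" using a(1) y by (intro R16_scale R16_zeta_pow_mult) auto
    then show ?case using Suc by (simp add: R16_add)
  qed
  then show "x * y \<in> R16" unfolding a sum_distrib_right mult.assoc .
qed

lemma zeta16_in_R16: "\<zeta> \<in> R16"
  using R16_zeta_pow_mult[OF R.one_closed, of 1] by simp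

lemma inv17_in_R16: "1 / 17 \<in> R16"
  using Zinv17_subset_R16 inv17_in_Zinv17 by blast

lemma Zinv17_induct [consumes 1, case_names one minus_one inv17 add mult]:
  assumes "x \<in> Zinv17" and "P 1" "P (-1)" "P (1 / 17)"
    and add: "\<And>x y. x \<in> Zinv17 \<Longrightarrow> y \<in> Zinv17 \<Longrightarrow> P x \<Longrightarrow> P y \<Longrightarrow> P (x + y)"
    and mult: "\<And>x y. x \<in> Zinv17 \<Longrightarrow> y \<in> Zinv17 \<Longrightarrow> P x \<Longrightarrow> P y \<Longrightarrow> P (x * y)"
  shows "P x"
proof -
  obtain m k where x: "x = of_int m / 17 ^ k" using assms(1) unfolding Zinv17_def by blast
  have p: "P ((1 / 17) ^ k)"
  proof (induction k)
    case (Suc k)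
    then show ?case unfolding power_Suc by (intro mult A.closed inv17_in_Zinv17 assms)
  qed (use assms in simp)
  have "P (1 + (-1))" by (intro add A.closed assms)
  then have z: "P 0" by simp
  have n: "P (of_nat j)" for j by (induction j) (auto intro!: add A.closed z assms)
  have "P (of_int m)"
  proof (cases m rule: int_cases2)
    case (nonpos j)
    have "P ((-1) * of_nat j)" by (intro mult A.closed n assms)
    then show ?thesis using nonpos by simp
  qed (use n in simp)
  then have "P (of_int m * (1 / 17) ^ k)" by (intro mult p A.closed inv17_in_Zinv17)
  then show ?thesis by (simp add: x power_divide)
qed

text \<open>These four elements generate the ring, so a property stable under sums and products,
  such as the Frobenius congruence, need only be tested on them.\<close>

lemma R16_induct [consumes 1, case_names one minus_one inv17 zeta add mult]:
  assumes x: "x \<in> R16" and b: "P 1" "P (-1)" "P (1 / 17)" "P \<zeta>"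
    and add: "\<And>x y. x \<in> R16 \<Longrightarrow> y \<in> R16 \<Longrightarrow> P x \<Longrightarrow> P y \<Longrightarrow> P (x + y)"
    and mult: "\<And>x y. x \<in> R16 \<Longrightarrow> y \<in> R16 \<Longrightarrow> P x \<Longrightarrow> P y \<Longrightarrow> P (x * y)"
  shows "P x"
proof -
  have A: "P c" if "c \<in> Zinv17" for c
    using that by (induction rule: Zinv17_induct) (use b add mult Zinv17_subset_R16 in \<open>blast+\<close>)
  have z: "P (\<zeta> ^ i)" for i by (induction i) (auto intro!: b mult R.closed zeta16_in_R16)
  obtain a where a: "\<forall>i. a i \<in> Zinv17" "x = (\<Sum>i<8. a i * \<zeta> ^ i)"
    using x unfolding R16_def by blast
  have "P (\<Sum>i<k. a i * \<zeta> ^ i)" for k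
  proof (induction k)
    case (Suc k)
    have "a i \<in> R16" for i using a Zinv17_subset_R16 by blast
    then show ?case unfolding sum.lessThan_Suc
      by (intro add mult A z R.closed zeta16_in_R16 Suc) (use a in auto)
  qed (use A A.closed in simp)
  then show ?thesis using a by blast
qed

text \<open>Modulo \<open>p\<close> both the power map and \<open>f\<close> respect sums and
  products, and they agree on generators. In the applications \<open>f\<close> is the identity or
  \<open>cnj\<close>, according to whether \<open>p ^ k\<close> is 1 or -1 modulo 16.\<close>

lemma R16_frobenius:
  assumes p: "prime p" "odd p" and x: "x \<in> R16"
    and f: "\<And>x y. f (x + y) = f x + f y" "\<And>x y. f (x * y) = f x * f y"
      "f 1 = 1" "f (-1) = -1" "f (1 / 17) = 1 / 17" "f \<zeta> = \<zeta> ^ (p ^ k)"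
    and cl: "\<And>x. x \<in> R16 \<Longrightarrow> f x \<in> R16"
  shows "R.eqm (int p) (x ^ (p ^ k)) (f x)"
proof -
  have add: "R.eqm (int p) ((x + y) ^ (p ^ k)) (f (x + y))"
    if "x \<in> R16" "y \<in> R16" "R.eqm (int p) (x ^ (p ^ k)) (f x)" "R.eqm (int p) (y ^ (p ^ k)) (f y)"
    for x y
    unfolding f by (rule R.eqm_trans[OF R.frobenius_pow_add R.eqm_add]) (use that p in auto)
  have pos: "R.eqm (int p) (of_nat j ^ (p ^ k)) (of_nat j)" for j
  proof (induction j)
    case (Suc j)
    have "R.eqm (int p) ((1 + of_nat j) ^ (p ^ k)) (1 ^ (p ^ k) + of_nat j ^ (p ^ k))"
      by (intro R.frobenius_pow_add p R.closed)
    also have "R.eqm (int p) \<dots> (1 + of_nat j)" using Suc by (intro R.eqm_add) auto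
    finally show ?case by simp
  qed (use prime_gt_0_nat[OF p(1)] in \<open>simp add: power_0_left\<close>)
  show ?thesis using x
  proof (induction rule: R16_induct)
    case inv17
    let ?N = "p ^ k"
    \<comment> \<open>Fermat's congruence for 17, multiplied by the inverse of
      \<open>17 ^ (?N + 1)\<close>.\<close>
    have "R.eqm (int p) ((1/17) ^ ?N * (1/17) * 17 ^ ?N) ((1/17) ^ ?N * (1/17) * 17)"
      by (rule R.eqm_mult_left, intro R.closed inv17_in_R16) (use pos[of 17] in simp)
    then have "R.eqm (int p) (1/17) ((1/17) ^ ?N)" by (simp add: power_divide)
    then show ?case unfolding f by (rule R.eqm_sym)
  next
    case (mult x y)
    then show ?case unfolding f power_mult_distrib
      by (intro R.eqm_mult R.closed cl)
  qed (use add f p in auto)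
qed

lemma R16_subset_L2: "R16 \<subseteq> L2"
proof
  note I = subfield_intros[OF subfield_L2] zeta16_in_L2
  fix x assume "x \<in> R16"
  then show "x \<in> L2" by (induction rule: R16_induct) (intro I | assumption)+
qed

lemma hom_fixes_Rats:
  assumes F: "is_subfield F" and f: "field_hom_on F f" and x: "x \<in> \<rat>"
  shows "f x = x"
proof -
  note H = field_hom_closed[OF F f] and I = subfield_intros[OF F]
  obtain a b :: int where b: "b > 0" and x: "x = of_int a / of_int b"
    using x by (auto elim: Rats_cases')
  have m: "of_int c \<in> F" for c by (cases c rule: int_cases2) (auto intro: I)
  have "f (of_int c) = of_int c" for c
    by (cases c rule: int_cases2) (auto simp: H I)
  then show ?thesis unfolding x by (simp add: H(8) m)
qed

lemma Zinv17_subset_Rats: "Zinv17 \<subseteq> \<rat>"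
  unfolding Zinv17_def by auto

text \<open>The factor \<open>c\<close> makes the rule iterable: each application of
  \<open>f\<close> multiplies it by \<open>k\<close>.\<close>

lemma hom_R16_sum:
  assumes f: "field_hom_on L2 f" and k: "f \<zeta> = \<zeta> ^ k" and a: "\<And>i. a i \<in> Zinv17"
  shows "f (\<Sum>i<n. a i * \<zeta> ^ (c * i)) = (\<Sum>i<n. a i * \<zeta> ^ (k * c * i))"
proof (induction n)
  case 0
  show ?case using field_hom_closed(4)[OF subfield_L2 f] by simp
next
  case (Suc n)
  note H = field_hom_closed[OF subfield_L2 f] and I = subfield_intros[OF subfield_L2] zeta16_in_L2
  have m: "a i \<in> L2" for i using a Zinv17_subset_R16 R16_subset_L2 by blast
  have "a i \<in> R16" for i using a Zinv17_subset_R16 by blast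
  then have "(\<Sum>i<n. a i * \<zeta> ^ (c * i)) \<in> R16" by (intro R.closed zeta16_in_R16)
  then have s: "(\<Sum>i<n. a i * \<zeta> ^ (c * i)) \<in> L2" using R16_subset_L2 by blast
  have "f (a n * \<zeta> ^ (c * n)) = f (a n) * f \<zeta> ^ (c * n)" by (simp add: H(3,9) I m)
  also have "f (a n) = a n"
    using hom_fixes_Rats[OF subfield_L2 f] a Zinv17_subset_Rats by blast
  also have "f \<zeta> ^ (c * n) = \<zeta> ^ (k * c * n)" unfolding k by (simp add: mult.assoc flip: power_mult)
  finally show ?case using Suc by (simp add: H(2) s I m)
qed

lemma hom_R16_closed:
  assumes f: "field_hom_on L2 f" and k: "f \<zeta> = \<zeta> ^ k" and x: "x \<in> R16"
  shows "f x \<in> R16"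
proof -
  obtain a where a: "\<forall>i. a i \<in> Zinv17" "x = (\<Sum>i<8. a i * \<zeta> ^ i)"
    using x unfolding R16_def by blast
  have "a i \<in> R16" for i using a Zinv17_subset_R16 by blast
  then have "(\<Sum>i<8. a i * \<zeta> ^ (k * 1 * i)) \<in> R16" by (intro R.closed zeta16_in_R16)
  then show ?thesis using hom_R16_sum[OF f k, where a = a and n = 8 and c = 1] a by simp
qed

lemma cnj_hom: "field_hom_on F cnj"
  by (simp add: field_hom_on_def)

lemma cnj_R16: "x \<in> R16 \<Longrightarrow> cnj x \<in> R16"
  by (rule hom_R16_closed[OF cnj_hom cnj_zeta16])

lemma zeta16_power_reduce: "8 \<le> k \<Longrightarrow> \<zeta> ^ k = - (\<zeta> ^ (k - 8))"
  using power_add[of \<zeta> "k - 8" 8] zeta16_pow8 by simp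

lemmas zeta16_numeral_reduce = zeta16_power_reduce[of "numeral k" for k]

text \<open>The Galois group is generated by \<open>sigma 3\<close> and \<open>cnj\<close>, since 3
  and -1 generate the units modulo 16. The eight conjugates of \<open>x\<close> add up to
  \<open>8 * x\<close>; on coordinates the sum is \<open>8 * a 0\<close>, because \<zeta>^i has
  trace 0 for 0 < i < 8.\<close>

lemma R16_fixed:
  assumes x: "x \<in> R16" and s: "sigma 3 x = x" and c: "cnj x = x"
  shows "x \<in> Zinv17"
proof -
  obtain a where a: "\<forall>i. a i \<in> Zinv17" "x = (\<Sum>i<8. a i * \<zeta> ^ i)"
    using x unfolding R16_def by blast
  then have a': "a i \<in> Zinv17" for i by blast
  define F where "F c = (\<Sum>i<8. a i * \<zeta> ^ (c * i))" for c
  have F1: "F 1 = x" unfolding F_def using a by simp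
  have s3: "sigma 3 (F c) = F (3 * c)" for c
    unfolding F_def by (rule hom_R16_sum[OF sigma3_hom sigma3_zeta a'])
  have cc: "cnj (F c) = F (15 * c)" for c
    unfolding F_def by (rule hom_R16_sum[OF cnj_hom cnj_zeta16 a'])
  have F3: "F 3 = x" using s3[of 1] F1 s by simp
  have F9: "F 9 = x" using s3[of 3] F3 s by simp
  have F27: "F 27 = x" using s3[of 9] F9 s by simp
  have "8 * x = (F 1 + F 3 + F 9 + F 27) + (F (15 * 1) + F (15 * 3) + F (15 * 9) + F (15 * 27))"
    unfolding cc[symmetric] F1 F3 F9 F27 c by simp
  \<comment> \<open>The exponents are 3^s and 15 * 3^s for s < 4, which represent all units modulo
    16.\<close>
  also have "\<dots> = (\<Sum>i<8. a i * (\<Sum>j\<in>{1,3,9,27,15,45,135,405}. \<zeta> ^ (j * i)))"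
    unfolding F_def by (simp add: distrib_left sum.distrib)
  also have "\<dots> = (\<Sum>i<8. a i * (if i = 0 then 8 else 0))"
  proof (rule sum.cong[OF refl])
    fix i :: nat assume "i \<in> {..<8}"
    then have "i \<in> {0,1,2,3,4,5,6,7}" by auto
    then show "a i * (\<Sum>j\<in>{1,3,9,27,15,45,135,405}. \<zeta> ^ (j * i)) = a i * (if i = 0 then 8 else 0)"
      by (elim insertE) (simp_all add: zeta16_numeral_reduce)
  qed
  also have "\<dots> = 8 * a 0" by (simp add: sum.delta if_distrib cong: if_cong)
  finally show ?thesis using a' by simp
qed

lemma R16_Rats: "x \<in> R16 \<Longrightarrow> x \<in> \<rat> \<Longrightarrow> x \<in> Zinv17"
  by (rule R16_fixed)
    (simp_all add: hom_fixes_Rats[OF subfield_L2 sigma3_hom] hom_fixes_Rats[OF subfield_L2 cnj_hom])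

text \<open>\<open>rat_cong\<close> admits any denominator prime to \<open>M\<close>,
  \<open>R.eqm\<close> only powers of 17. As \<open>x - y\<close> has a power of 17 as denominator,
  the factor \<open>b\<close> cancels; conversely, the quotient is a rational element of
  \<open>R16\<close> and so lies in \<open>Zinv17\<close>.\<close>

lemma rat_cong_iff_eqm:
  assumes M: "coprime M 17" "M \<noteq> 0" and x: "x \<in> Zinv17" and y: "y \<in> Zinv17"
  shows "rat_cong M x y \<longleftrightarrow> R.eqm M x y"
proof
  assume "rat_cong M x y"
  then obtain a b where b: "b \<noteq> 0" "coprime b M" and e: "x - y = of_int M * (of_int a / of_int b)"
    unfolding rat_cong_def by blast
  have "x - y \<in> Zinv17" by (intro A.closed x y)
  then obtain m k where m: "x - y = of_int m / 17 ^ k" unfolding Zinv17_def by blast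
  then have "(of_int (m * b) :: complex) = of_int (M * a * 17 ^ k)"
    using e b by (simp add: field_simps)
  then have "m * b = M * (a * 17 ^ k)" unfolding of_int_eq_iff by simp
  then have "M dvd m * b" by simp
  then have "M dvd m" using b(2) by (simp add: coprime_commute coprime_dvd_mult_left_iff)
  then obtain m' where "m = M * m'" by blast
  then have "x - y = of_int M * (of_int m' / 17 ^ k)" using m by simp
  moreover have "of_int m' / 17 ^ k \<in> Zinv17" unfolding Zinv17_def by blast
  ultimately show "R.eqm M x y" using R.eqmI Zinv17_subset_R16 by blast
next
  assume "R.eqm M x y"
  then obtain r where r: "r \<in> R16" and e: "x - y = of_int M * r" unfolding R.eqm_def by blast
  have "x - y \<in> \<rat>" using A.diff_closed[OF x y] Zinv17_subset_Rats by blast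
  moreover have "r = (x - y) / of_int M" using e M by simp
  ultimately have "r \<in> \<rat>" by simp
  then have "r \<in> Zinv17" by (rule R16_Rats[OF r])
  then obtain m k where m: "r = of_int m / 17 ^ k" unfolding Zinv17_def by blast
  moreover have "coprime (17 ^ k) M" using M by (simp add: coprime_commute)
  ultimately show "rat_cong M x y" unfolding rat_cong_def
    by (intro exI[of _ m] exI[of _ "17 ^ k"]) (simp add: e)
qed

text \<open>Otherwise -2/q would be a rational element of \<open>R16\<close>, hence in Z[1/17], and
  \<open>q\<close> would divide 2 * 17^k.\<close>

lemma minus_one_not_eqm_one:
  assumes q: "prime q" "odd q" "q \<noteq> 17"
  shows "\<not> R.eqm (int q) (-1) 1"
proof
  assume "R.eqm (int q) (-1) 1"
  then obtain r where r: "r \<in> R16" and e: "-2 = of_int (int q) * r" unfolding R.eqm_def by auto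
  have q0: "q \<noteq> 0" using q by auto
  have "r = -2 / of_int (int q)" using e q0 by (simp add: field_simps)
  then have "r \<in> Zinv17" by (intro R16_Rats[OF r]) simp
  then obtain m k where m: "r = of_int m / 17 ^ k" unfolding Zinv17_def by blast
  have "(of_int (- 2 * 17 ^ k) :: complex) = of_int (int q * m)"
    using e unfolding m by (simp add: field_simps)
  then have "- 2 * 17 ^ k = int q * m" unfolding of_int_eq_iff .
  then have "2 * 17 ^ k = int q * (- m)" by simp
  then have "int q dvd 2 * 17 ^ k" by (rule dvdI)
  moreover have pq: "prime (int q)" using q by simp
  ultimately have "int q dvd 2 \<or> int q dvd 17"
    using prime_dvd_mult_iff[OF pq] prime_dvd_power[OF pq] by metis
  moreover have "prime (2 :: int)" "prime (17 :: int)" by simp_all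
  ultimately have "int q = 2 \<or> int q = 17" using primes_dvd_imp_eq[OF pq] by metis
  then show False using q by auto
qed

subsection \<open>Gauss sums modulo 17\<close>

text \<open>The Gauss sum of the character \<open>14\<^sup>i \<mapsto> \<zeta>\<^sup>e\<^sup>i\<close> modulo 17. The primitive root 14 is chosen
  because \<open>\<zeta> \<mapsto> 1/14\<close> is the reduction of \<open>\<int>[\<zeta>]\<close> modulo \<open>1 - \<zeta> + \<zeta>\<^sup>5\<close>, so that Stickelberger's
  factorisation of these sums is the one in the exponents of \<open>alpha1\<close> and \<open>alpha2\<close>.\<close>
definition gs :: "nat \<Rightarrow> complex \<Rightarrow> complex" where
  "gs e w = (\<Sum>i<16. \<zeta> ^ (e * i) * w ^ (14 ^ i))"

lemma sum_periodic_shift: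
  fixes F :: "nat \<Rightarrow> complex"
  assumes "\<And>i. F (i + n) = F i"
  shows "(\<Sum>i<n. F (i + l)) = (\<Sum>i<n. F i)"
proof (induction l)
  case (Suc l)
  have "(\<Sum>i<Suc n. F (i + l)) = F l + (\<Sum>i<n. F (Suc i + l))"
    using sum.lessThan_Suc_shift[of "\<lambda>i. F (i + l)" n] by simp
  moreover have "(\<Sum>i<Suc n. F (i + l)) = (\<Sum>i<n. F (i + l)) + F l"
    using assms[of l] by (simp add: add.commute)
  ultimately show ?case using Suc by simp
qed simp

lemma root17_power_cong:
  fixes w :: complex
  assumes "w ^ 17 = 1" "a mod 17 = b mod 17"
  shows "w ^ a = w ^ b"
proof -
  have "w ^ k = w ^ (k mod 17)" for k
  proof -
    have "w ^ k = w ^ (17 * (k div 17) + k mod 17)" by simp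
    also have "\<dots> = w ^ (k mod 17)" unfolding power_add power_mult assms(1) by simp
    finally show ?thesis .
  qed
  from this[of a] this[of b] show ?thesis using assms(2) by simp
qed

lemma power14_periodic: "14 ^ (i + 16) mod 17 = (14 ^ i mod 17 :: nat)"
proof -
  have "(14 ^ i * 14 ^ 16) mod 17 = (14 ^ i * (14 ^ 16 mod 17)) mod (17 :: nat)"
    by (simp only: mod_mult_right_eq)
  then show ?thesis unfolding power_add by simp
qed

lemma gs_cong: "e mod 16 = f mod 16 \<Longrightarrow> gs e w = gs f w"
  unfolding gs_def
  by (intro sum.cong refl arg_cong2[where f = times] zeta16_power_cong) (rule mod_mult_cong; simp)

text \<open>Shift the summation index by \<open>l\<close> over a full period. The factor 15 stands
  for -1 in exponents of \<zeta>, here and below, so this is the inverse character value at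
  14^l.\<close>

lemma gs_shift:
  assumes w: "w ^ 17 = 1"
  shows "gs e (w ^ (14 ^ l)) = \<zeta> ^ (15 * e * l) * gs e w"
proof -
  define F where "F i = \<zeta> ^ (e * i) * w ^ (14 ^ i)" for i :: nat
  have per: "F (i + 16) = F i" for i
    unfolding F_def using zeta16_power_cong[of "e * (i + 16)" "e * i"]
      root17_power_cong[OF w power14_periodic[of i]] by (simp add: algebra_simps)
  have "\<zeta> ^ (e * l) * gs e (w ^ (14 ^ l)) = (\<Sum>i<16. F (i + l))"
    unfolding gs_def F_def sum_distrib_left
    by (intro sum.cong refl) (simp add: algebra_simps power_add flip: power_mult)
  also have "\<dots> = gs e w" unfolding sum_periodic_shift[of F, OF per] unfolding gs_def F_def ..
  finally have "\<zeta> ^ (15 * e * l) * (\<zeta> ^ (e * l) * gs e (w ^ (14 ^ l))) = \<zeta> ^ (15 * e * l) * gs e w"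
    by simp
  moreover have "\<zeta> ^ (15 * e * l) * \<zeta> ^ (e * l) = 1"
    unfolding power_add[symmetric] using zeta16_power_cong[of "15 * e * l + e * l" 0] by simp
  ultimately show ?thesis by (simp flip: mult.assoc)
qed

text \<open>Let \<open>d\<close> be the difference of the two summation indices and use 14^i +
  14^(i+d) = 14^i (1 + 14^d).\<close>

lemma gs_mult:
  assumes w: "w ^ 17 = 1"
  shows "gs e w * gs f w = (\<Sum>d<16. \<zeta> ^ (f * d) * gs (e + f) (w ^ (1 + 14 ^ d)))"
proof -
  define F where "F i = \<zeta> ^ (f * i) * w ^ (14 ^ i)" for i :: nat
  have per: "F (i + 16) = F i" for i
    unfolding F_def using zeta16_power_cong[of "f * (i + 16)" "f * i"]
      root17_power_cong[OF w power14_periodic[of i]] by (simp add: algebra_simps)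
  have "gs e w * gs f w = (\<Sum>i<16. \<zeta> ^ (e * i) * w ^ (14 ^ i) * (\<Sum>d<16. F d))"
    unfolding gs_def F_def sum_distrib_right ..
  also have "\<dots> = (\<Sum>i<16. \<zeta> ^ (e * i) * w ^ (14 ^ i) * (\<Sum>d<16. F (d + i)))"
    unfolding sum_periodic_shift[of F, OF per] ..
  also have "\<dots> = (\<Sum>d<16. \<Sum>i<16. \<zeta> ^ (e * i) * w ^ (14 ^ i) * F (d + i))"
    unfolding sum_distrib_left by (rule sum.swap)
  also have "\<dots> = (\<Sum>d<16. \<zeta> ^ (f * d) * gs (e + f) (w ^ (1 + 14 ^ d)))"
    unfolding gs_def F_def sum_distrib_left
    by (intro sum.cong refl) (simp add: algebra_simps power_add flip: power_mult)
  finally show ?thesis .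
qed

lemma lessThan_16: "{..<16 :: nat} = {0, 1, 2, 3, 4, 5, 6, 7, 8, 9, 10, 11, 12, 13, 14, 15}"
  by (auto simp: lessThan_nat_numeral)

text \<open>Zech logarithms: \<open>1 + 14\<^sup>d \<equiv> 14\<^sup>z\<close> modulo 17 for \<open>d \<noteq> 8\<close>. The entry at 8 is junk:
  \<open>1 + 14\<^sup>8 \<equiv> 0\<close>.\<close>
definition zech :: "nat \<Rightarrow> nat" where
  "zech d = [14, 6, 11, 10, 1, 4, 8, 3, 0, 12, 2, 15, 13, 7, 9, 5] ! d"

lemma zech:
  assumes "d < 16" "d \<noteq> 8"
  shows "(1 + 14 ^ d) mod 17 = (14 ^ zech d :: nat) mod 17"
proof -
  have "d \<in> {..<16} - {8}" using assms by simp
  then show ?thesis unfolding lessThan_16 by (auto simp: zech_def)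
qed

text \<open>The Jacobi sum of \<chi>^e and \<chi>^f: for x = 14^d the term is \<chi>^f(x) divided by
  \<chi>^(e+f)(1+x), that is \<chi>^f(y) \<chi>^e(1-y) for y = x/(1+x). The index 8 is x =
  -1.\<close>

definition jac :: "nat \<Rightarrow> nat \<Rightarrow> complex" where
  "jac e f = (\<Sum>d\<in>{..<16} - {8}. \<zeta> ^ (f * d + 15 * (e + f) * zech d))"

lemma gs_mult_expand:
  assumes w: "w ^ 17 = 1"
  shows "gs e w * gs f w = \<zeta> ^ (f * 8) * gs (e + f) 1 + jac e f * gs (e + f) w"
proof -
  have "w ^ (1 + 14 ^ 8) = w ^ 0" by (rule root17_power_cong[OF w]) simp
  then have e8: "\<zeta> ^ (f * 8) * gs (e + f) (w ^ (1 + 14 ^ 8)) = \<zeta> ^ (f * 8) * gs (e + f) 1" by simp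
  have "gs e w * gs f w = \<zeta> ^ (f * 8) * gs (e + f) (w ^ (1 + 14 ^ 8)) +
      (\<Sum>d\<in>{..<16} - {8}. \<zeta> ^ (f * d) * gs (e + f) (w ^ (1 + 14 ^ d)))"
    unfolding gs_mult[OF w] by (rule sum.remove) auto
  also have "(\<Sum>d\<in>{..<16} - {8}. \<zeta> ^ (f * d) * gs (e + f) (w ^ (1 + 14 ^ d))) = jac e f * gs (e + f) w"
    unfolding jac_def sum_distrib_right
  proof (rule sum.cong[OF refl])
    fix d :: nat assume d: "d \<in> {..<16} - {8}"
    then have "w ^ (1 + 14 ^ d) = w ^ (14 ^ zech d)" using zech by (intro root17_power_cong[OF w]) auto
    then show "\<zeta> ^ (f * d) * gs (e + f) (w ^ (1 + 14 ^ d))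
        = \<zeta> ^ (f * d + 15 * (e + f) * zech d) * gs (e + f) w"
      using gs_shift[OF w] by (simp add: power_add)
  qed
  finally show ?thesis using e8 by simp
qed

lemma gs_at_1: "e \<in> {1, 2, 4, 8} \<Longrightarrow> gs e 1 = 0"
  unfolding gs_def lessThan_16 by (elim insertE) (simp_all add: zeta16_numeral_reduce)

section \<open>Conjugates of the two primes and the factorised Jacobi sums\<close>

definition prime16 :: "nat \<Rightarrow> complex" where
  "prime16 k = 1 - \<zeta> ^ k + \<zeta> ^ (5 * k)"

text \<open>Like \<open>prime16\<close> for \<pi>_2, this is the image of \<pi>_1 under \<zeta> ->
  \<zeta>^k for odd k; the 6 comes from \<open>zeta 8 ^ 3 = \<zeta> ^ 6\<close>.\<close>

definition prime8 :: "nat \<Rightarrow> complex" where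
  "prime8 k = 1 + 2 * \<zeta> ^ (6 * k)"

lemma prime16_values:
  "prime16 1 = 1 - \<zeta> + \<zeta> ^ 5" "prime16 3 = 1 - \<zeta> ^ 3 - \<zeta> ^ 7" "prime16 5 = 1 - \<zeta> ^ 5 - \<zeta>"
  "prime16 7 = 1 - \<zeta> ^ 7 + \<zeta> ^ 3" "prime16 9 = 1 + \<zeta> - \<zeta> ^ 5" "prime16 11 = 1 + \<zeta> ^ 3 + \<zeta> ^ 7"
  "prime16 13 = 1 + \<zeta> ^ 5 + \<zeta>" "prime16 15 = 1 + \<zeta> ^ 7 - \<zeta> ^ 3"
  unfolding prime16_def by (simp_all add: zeta16_numeral_reduce)

lemma prime8_values:
  "prime8 1 = 1 + 2 * \<zeta> ^ 6" "prime8 3 = 1 + 2 * \<zeta>\<^sup>2"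
  "prime8 13 = 1 - 2 * \<zeta> ^ 6" "prime8 15 = 1 - 2 * \<zeta>\<^sup>2"
  unfolding prime8_def by (simp_all add: zeta16_numeral_reduce)

lemma jac_values:
  "jac 1 1 = 2 * \<zeta> + 2 * \<zeta>\<^sup>2 - \<zeta> ^ 4 + 2 * \<zeta> ^ 6 - 2 * \<zeta> ^ 7"
  "jac 2 2 = - 3 - 2 * \<zeta>\<^sup>2 - 2 * \<zeta> ^ 6"
  "jac 4 4 = - 1 + 4 * \<zeta> ^ 4"
  unfolding jac_def lessThan_16 zech_def by (simp_all add: insert_Diff_if zeta16_numeral_reduce)

text \<open>Turns an identity in Z[\<zeta>] into a polynomial one: at each use \<open>c\<close> is
  the explicit quotient of the difference by x^8 + 1.\<close>

lemma zeta16_eqI: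
  assumes "x - y = (\<zeta> ^ 8 + 1) * c"
  shows "x = y"
  using assms zeta16_pow8 by simp

lemma prime16_products:
  "prime16 15 * prime16 3 = 1 - 2 * \<zeta> ^ 3 + 2 * \<zeta> ^ 6"
  "prime16 5 * prime16 9 = 1 - 2 * \<zeta>\<^sup>2 - 2 * \<zeta> ^ 5"
  "prime16 15 * prime16 13 = 1 + \<zeta> - \<zeta> ^ 3 - 2 * \<zeta> ^ 4 + \<zeta> ^ 5 + \<zeta> ^ 7"
  "prime16 5 * prime16 7 = 1 - \<zeta> + \<zeta> ^ 3 - 2 * \<zeta> ^ 4 - \<zeta> ^ 5 - \<zeta> ^ 7"
  "prime16 11 * prime16 7 = 1 + 2 * \<zeta> ^ 3 + 2 * \<zeta> ^ 6"
  "prime16 1 * prime16 13 = 1 - 2 * \<zeta>\<^sup>2 + 2 * \<zeta> ^ 5"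
  unfolding prime16_values
  by (rule zeta16_eqI[where c = "- (\<zeta> ^ 6)"], simp add: power_numeral_reduce algebra_simps,
      rule zeta16_eqI[where c = "\<zeta>\<^sup>2"], simp add: power_numeral_reduce algebra_simps,
      rule zeta16_eqI[where c = "\<zeta> ^ 4"], simp add: power_numeral_reduce algebra_simps,
      rule zeta16_eqI[where c = "\<zeta> ^ 4"], simp add: power_numeral_reduce algebra_simps,
      rule zeta16_eqI[where c = "- (\<zeta> ^ 6)"], simp add: power_numeral_reduce algebra_simps,
      rule zeta16_eqI[where c = "\<zeta>\<^sup>2"], simp add: power_numeral_reduce algebra_simps)

text \<open>The second and third sums lie in Q(\<zeta>^2) and are factored twice, for use with
  either order. The units - \<zeta>^4 and -1 disappear in the eighth power of \<open>jac 1 1\<close>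
  and the square of \<open>jac 4 4\<close>.\<close>

lemma jac_factors:
  "jac 1 1 = - (\<zeta> ^ 4) * ((prime16 15 * prime16 3) * (prime16 5 * prime16 9))"
  "jac 2 2 = (prime16 15 * prime16 13) * (prime16 5 * prime16 7)"
  "jac 2 2 = prime8 15 * prime8 13"
  "jac 4 4 = - ((prime16 15 * prime16 3) * (prime16 11 * prime16 7))"
  "jac 4 4 = - (prime8 15 * prime8 3)"
  unfolding jac_values prime16_products prime8_values
  by (rule zeta16_eqI[where c = "2 * \<zeta> + 2 * \<zeta>\<^sup>2 - 4 * \<zeta> ^ 7"], simp add: power_numeral_reduce algebra_simps,
      rule zeta16_eqI[where c = "- 4 - \<zeta>\<^sup>2 + 2 * \<zeta> ^ 4 + \<zeta> ^ 6"], simp add: power_numeral_reduce algebra_simps,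
      rule zeta16_eqI[where c = "- 4"], simp add: power_numeral_reduce algebra_simps,
      rule zeta16_eqI[where c = "4 * \<zeta> ^ 4"], simp add: power_numeral_reduce algebra_simps,
      simp add: power_numeral_reduce algebra_simps)

text \<open>The norm of \<pi>_2, grouped as a product of two conjugate factors; the first becomes
  \<open>gamma2\<close>.\<close>

lemma prime16_norm:
  "(prime16 15 * prime16 3 * (prime16 5 * prime16 9)) *
   (prime16 1 * prime16 13 * (prime16 11 * prime16 7)) = 17"
proof -
  have a: "prime16 15 * prime16 3 * (prime16 5 * prime16 9) =
      1 - 2 * \<zeta>\<^sup>2 + 2 * \<zeta> ^ 3 + 2 * \<zeta> ^ 5 + 2 * \<zeta> ^ 6"
    unfolding prime16_products by (rule zeta16_eqI[where c = "- 4 * \<zeta> ^ 3"], simp add: power_numeral_reduce algebra_simps)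
  have b: "prime16 1 * prime16 13 * (prime16 11 * prime16 7) =
      1 - 2 * \<zeta>\<^sup>2 - 2 * \<zeta> ^ 3 - 2 * \<zeta> ^ 5 + 2 * \<zeta> ^ 6"
    unfolding prime16_products by (rule zeta16_eqI[where c = "4 * \<zeta> ^ 3"], simp add: power_numeral_reduce algebra_simps)
  show ?thesis unfolding a b
    by (rule zeta16_eqI[where c = "- 16 - 4 * \<zeta>\<^sup>2 + 4 * \<zeta> ^ 4"], simp add: power_numeral_reduce algebra_simps)
qed

lemma prime8_norm: "(prime8 15 * prime8 13) * (prime8 1 * prime8 3) = 17"
  unfolding prime8_values
  by (rule zeta16_eqI[where c = "- 16 - 4 * \<zeta> ^ 4 + 16 * \<zeta> ^ 8"], simp add: power_numeral_reduce algebra_simps)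

section \<open>Powers of the Gauss sums\<close>

lemma root17_sum:
  fixes w :: complex
  assumes "w ^ 17 = 1"
  shows "(\<Sum>k<17. w ^ k) = (if w = 1 then 17 else 0)"
proof (cases "w = 1")
  case False
  have "(1 - w) * (\<Sum>k<17. w ^ k) = 1 - w ^ 17" by (rule one_diff_power_eq[symmetric])
  then show ?thesis using False assms by simp
qed simp

lemma gs_0:
  assumes w: "w ^ 17 = 1" "w \<noteq> 1"
  shows "gs 0 w = -1"
proof -
  have "gs 0 w = (\<Sum>i<16. w ^ (14 ^ i mod 17))"
    unfolding gs_def by (intro sum.cong) (auto intro: root17_power_cong[OF w(1)])
  also have "\<dots> = (\<Sum>k<16. w ^ k) + w ^ 16 - 1"
    unfolding lessThan_16 by simp
  also have "(\<Sum>k<16. w ^ k) + w ^ 16 = (\<Sum>k<17. w ^ k)"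
    using sum.lessThan_Suc[of "\<lambda>k. w ^ k" 16] by simp
  also have "\<dots> = 0" using root17_sum[OF w(1)] w(2) by simp
  finally show ?thesis by simp
qed

text \<open>The product character is trivial, so \<open>gs_mult_expand\<close> involves
  \<open>gs 0 1 = 16\<close> and \<open>gs 0 w = -1\<close>. The Jacobi sum is a vanishing full
  character sum minus its term at 8, hence - \<chi>^e(-1).\<close>

lemma gs_dual:
  assumes e: "e \<in> {1, 2, 4, 8}" and w: "w ^ 17 = 1" "w \<noteq> 1"
  shows "gs e w * gs (15 * e) w = 17 * \<zeta> ^ (8 * e)"
proof -
  have g0: "gs (e + 15 * e) v = gs 0 v" for v by (rule gs_cong) simp
  have z: "\<zeta> ^ (15 * e * 8) = \<zeta> ^ (8 * e)" by (rule zeta16_power_cong) (use e in auto)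
  have "jac e (15 * e) = (\<Sum>d\<in>{..<16} - {8}. \<zeta> ^ (15 * e * d))"
    unfolding jac_def
  proof (intro sum.cong refl zeta16_power_cong)
    fix d
    have eq: "15 * e * d + 15 * (e + 15 * e) * zech d = 15 * e * d + 16 * (15 * e * zech d)" by simp
    show "(15 * e * d + 15 * (e + 15 * e) * zech d) mod 16 = (15 * e * d) mod 16"
      unfolding eq by (rule mod_mult_self2)
  qed
  also have "\<dots> = (\<Sum>d<16. \<zeta> ^ (15 * e * d)) - \<zeta> ^ (15 * e * 8)"
    by (subst sum.remove[of "{..<16}" 8]) auto
  also have "(\<Sum>d<16. \<zeta> ^ (15 * e * d)) = cnj (gs e 1)"
    unfolding gs_def by (simp add: cnj_zeta16 mult.assoc flip: power_mult)
  finally have j: "jac e (15 * e) = - (\<zeta> ^ (8 * e))" using gs_at_1[OF e] z by simp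
  have "gs 0 1 = 16" by (simp add: gs_def)
  then show ?thesis unfolding gs_mult_expand[OF w(1)] g0 j z gs_0[OF w] by simp
qed

lemma gs_square:
  assumes "w ^ 17 = 1" and e: "e \<in> {1, 2, 4}"
  shows "gs e w * gs e w = jac e e * gs (2 * e) w"
proof -
  have "gs (2 * e) 1 = 0" by (rule gs_at_1) (use e in auto)
  then show ?thesis using gs_mult_expand[OF assms(1), of e e] by (simp add: mult_2)
qed

lemma gs_8_square:
  assumes w: "w ^ 17 = 1" "w \<noteq> 1"
  shows "gs 8 w * gs 8 w = 17"
proof -
  have "gs (15 * 8) w = gs 8 w" by (rule gs_cong) simp
  then show ?thesis using gs_dual[of 8, OF _ w] zeta16_power_cong[of 64 0] by simp
qed

lemma gs_2_power8:
  assumes w: "w ^ 17 = 1" "w \<noteq> 1"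
  shows "gs 2 w ^ 8 = 17 * jac 2 2 ^ 4 * jac 4 4 ^ 2"
proof -
  have "gs 2 w ^ 8 = (gs 2 w * gs 2 w) ^ 4" by (simp add: power_mult_distrib flip: power_add)
  also have "\<dots> = jac 2 2 ^ 4 * (gs 4 w * gs 4 w) ^ 2"
    using gs_square[OF w(1), of 2] by (simp add: power_mult_distrib flip: power_add)
  also have "\<dots> = jac 2 2 ^ 4 * (jac 4 4 ^ 2 * (gs 8 w * gs 8 w))"
    using gs_square[OF w(1), of 4] by (simp add: power_mult_distrib power2_eq_square)
  finally show ?thesis unfolding gs_8_square[OF w] by simp
qed

text \<open>The extra factor \<open>gs 2 w\<close> makes the identity true at \<open>w = 1\<close>
  as well, where the sum vanishes. It then holds at all 17th roots of unity, as required by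
  \<open>coeff1_cong\<close>.\<close>

lemma gs_2_power:
  assumes w: "w ^ 17 = 1"
  shows "gs 2 w ^ 9 = 17 * jac 2 2 ^ 4 * jac 4 4 ^ 2 * gs 2 w"
proof (cases "w = 1")
  case False
  then show ?thesis using power_Suc2[of "gs 2 w" 8] gs_2_power8[OF w] by simp
qed (simp add: gs_at_1)

lemma gs_1_power:
  assumes w: "w ^ 17 = 1"
  shows "gs 1 w ^ 17 = 17 * jac 1 1 ^ 8 * jac 2 2 ^ 4 * jac 4 4 ^ 2 * gs 1 w"
proof (cases "w = 1")
  case True
  then show ?thesis using gs_at_1[of 1] by simp
next
  case False
  have "gs 1 w ^ 16 = (gs 1 w * gs 1 w) ^ 8" by (simp add: power_mult_distrib flip: power_add)
  also have "\<dots> = jac 1 1 ^ 8 * gs 2 w ^ 8"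
    using gs_square[OF w, of 1] by (simp add: power_mult_distrib)
  also have "\<dots> = 17 * jac 1 1 ^ 8 * jac 2 2 ^ 4 * jac 4 4 ^ 2"
    unfolding gs_2_power8[OF w False] by simp
  finally show ?thesis using power_Suc2[of "gs 1 w" 16] by simp
qed

lemma gs_power_iterate:
  assumes "gs e w ^ (d + 1) = k * gs e w"
  shows "gs e w ^ (d * m + 1) = k ^ m * gs e w"
proof (induction m)
  case (Suc m)
  have "gs e w ^ (d * Suc m + 1) = gs e w ^ (d * m + 1) * gs e w ^ d"
    by (simp add: algebra_simps flip: power_add)
  also have "\<dots> = k ^ m * gs e w ^ (d + 1)" unfolding Suc by (simp add: mult_ac)
  finally show ?case unfolding assms by (simp add: mult_ac)
qed simp

subsection \<open>Reciprocity\<close>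

interpretation RX: subring_cong "{p :: complex poly. \<forall>i. Polynomial.coeff p i \<in> R16}"
proof
  fix p q :: "complex poly"
  assume p: "p \<in> {p. \<forall>i. Polynomial.coeff p i \<in> R16}" and q: "q \<in> {p. \<forall>i. Polynomial.coeff p i \<in> R16}"
  show "p - q \<in> {p. \<forall>i. Polynomial.coeff p i \<in> R16}" using p q by (simp add: R.diff_closed)
  show "p * q \<in> {p. \<forall>i. Polynomial.coeff p i \<in> R16}"
    using p q by (auto simp: coeff_mult intro!: R.sum_closed R.mult_closed)
qed (simp add: R.closed coeff_1)

definition xi17 :: complex ("\<xi>") where
  "\<xi> = exp (2 * of_real pi * \<i> * of_nat 1 / of_nat 17)"

lemma xi17_power_eq_1: "\<xi> ^ k = 1 \<longleftrightarrow> 17 dvd k"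
proof -
  have "\<xi> ^ k = exp (2 * of_real pi * \<i> * of_nat k / of_nat 17)"
    unfolding xi17_def exp_of_nat_mult[symmetric] by (simp add: mult_ac)
  then show ?thesis using complex_root_unity_eq_1[of 17 k] by simp
qed

lemma xi17_root: "(\<xi> ^ k) ^ 17 = 1"
  using xi17_power_eq_1[of "k * 17"] by (simp add: power_mult)

text \<open>The coefficient of \<open>x\<close> after reduction modulo \<open>x\<^sup>1\<^sup>7 - 1\<close>, by Fourier inversion; it keeps
  \<open>\<xi>\<close> out of the ring in which the congruences live.\<close>
definition coeff1 :: "complex poly \<Rightarrow> complex" where
  "coeff1 p = 1 / 17 * (\<Sum>k<17. \<xi> ^ (16 * k) * poly p (\<xi> ^ k))"

lemma coeff1_cong:
  assumes "\<And>w. w ^ 17 = 1 \<Longrightarrow> poly p w = c * poly q w"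
  shows "coeff1 p = c * coeff1 q"
  unfolding coeff1_def using assms[OF xi17_root] by (simp add: sum_distrib_left mult_ac)

lemma coeff1_add: "coeff1 (p + q) = coeff1 p + coeff1 q"
  unfolding coeff1_def by (simp add: algebra_simps sum.distrib add_divide_distrib)

text \<open>The condition says that \<open>n\<close> is 1 modulo 17.\<close>

lemma coeff1_monom:
  "coeff1 (Polynomial.monom c n) = (if 17 dvd 16 + n then c else 0)"
proof -
  have "(\<Sum>k<17. \<xi> ^ (16 * k) * poly (Polynomial.monom c n) (\<xi> ^ k)) = c * (\<Sum>k<17. (\<xi> ^ (16 + n)) ^ k)"
    unfolding sum_distrib_left poly_monom
    by (intro sum.cong refl) (simp add: algebra_simps power_add flip: power_mult)
  also have "(\<Sum>k<17. (\<xi> ^ (16 + n)) ^ k) = (if 17 dvd 16 + n then 17 else 0)"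
    using root17_sum[OF xi17_root] xi17_power_eq_1 by simp
  finally show ?thesis unfolding coeff1_def by simp
qed

lemma coeff1_sum: "coeff1 (sum f I) = (\<Sum>i\<in>I. coeff1 (f i))"
  by (induction I rule: infinite_finite_induct; simp add: coeff1_add; simp add: coeff1_def)

lemma coeff1_closed:
  assumes "\<forall>i. Polynomial.coeff p i \<in> R16"
  shows "coeff1 p \<in> R16"
proof -
  have "coeff1 p = (\<Sum>i\<le>degree p. coeff1 (Polynomial.monom (Polynomial.coeff p i) i))"
    by (simp add: poly_as_sum_of_monoms flip: coeff1_sum)
  also have "\<dots> \<in> R16" unfolding coeff1_monom by (intro R.sum_closed) (simp add: assms R.closed)
  finally show ?thesis .
qed

lemma coeff1_eqm:
  assumes "RX.eqm q p p'"
  shows "R.eqm q (coeff1 p) (coeff1 p')"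
proof -
  obtain r where r: "\<forall>i. Polynomial.coeff r i \<in> R16" "p - p' = of_int q * r"
    using assms unfolding RX.eqm_def by blast
  have "coeff1 p = coeff1 (p' + of_int q * r)" using r(2) by (simp flip: r(2))
  also have "\<dots> = coeff1 p' + of_int q * coeff1 r"
    unfolding coeff1_add using coeff1_cong[of "of_int q * r" "of_int q" r] by simp
  finally show ?thesis using coeff1_closed[OF r(1)] by (intro R.eqmI) auto
qed

definition gpoly :: "nat \<Rightarrow> complex poly" where
  "gpoly e = (\<Sum>i<16. Polynomial.monom (\<zeta> ^ (e * i)) (14 ^ i))"

lemma poly_gpoly: "poly (gpoly e) w = gs e w"
  unfolding gpoly_def gs_def by (simp add: poly_sum poly_monom)

lemma gpoly_closed: "gpoly e \<in> {p. \<forall>i. Polynomial.coeff p i \<in> R16}"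
  unfolding gpoly_def
  by (rule RX.sum_closed) (auto intro: R.closed zeta16_in_R16)

text \<open>Only \<open>i = 0\<close> gives 14^i = 1 modulo 17. A scalar multiple of
  \<open>gpoly e\<close> is therefore identified by this coefficient.\<close>

lemma coeff1_gpoly: "coeff1 (gpoly e) = 1"
  unfolding gpoly_def coeff1_sum coeff1_monom lessThan_16 by simp

lemma gpoly_frobenius:
  assumes p: "prime p"
  obtains f where "RX.eqm (int p) (gpoly e ^ p) f" "\<And>w. poly f w = gs (e * p) (w ^ p)"
proof
  show "RX.eqm (int p) (gpoly e ^ p) (\<Sum>i<16. Polynomial.monom (\<zeta> ^ (e * i)) (14 ^ i) ^ p)"
    unfolding gpoly_def by (rule RX.frobenius_sum[OF p]) (auto intro: R.closed zeta16_in_R16)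
  show "poly (\<Sum>i<16. Polynomial.monom (\<zeta> ^ (e * i)) (14 ^ i) ^ p) w = gs (e * p) (w ^ p)" for w
    unfolding gs_def by (simp add: poly_sum poly_monom power_mult_distrib mult_ac flip: power_mult)
qed

context
  fixes p e d l :: nat and \<kappa> :: complex
  assumes p: "prime p" and e: "e \<in> {1, 2}" and l: "[p = 14 ^ l] (mod 17)"
    and \<kappa>: "\<And>w. w ^ 17 = 1 \<Longrightarrow> gs e w ^ (d + 1) = \<kappa> * gs e w"
begin

text \<open>G^p is computed twice: as \<kappa>^m G, and by Frobenius as the Gauss sum of \<chi>^p =
  \<chi> at w^p = w^(14^l).\<close>

lemma gauss_reciprocity_plus:
  assumes p1: "[p = 1] (mod 16)" and m: "p = d * m + 1"
  shows "R.eqm (int p) (\<kappa> ^ m) (\<zeta> ^ (15 * e * l))"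
proof -
  obtain f where f: "RX.eqm (int p) (gpoly e ^ p) f" "\<And>w. poly f w = gs (e * p) (w ^ p)"
    using gpoly_frobenius[OF p] by metis
  have "coeff1 (gpoly e ^ p) = \<kappa> ^ m * coeff1 (gpoly e)"
    unfolding m by (rule coeff1_cong) (simp only: poly_power poly_gpoly gs_power_iterate[OF \<kappa>])
  moreover have "coeff1 f = \<zeta> ^ (15 * e * l) * coeff1 (gpoly e)"
  proof (rule coeff1_cong)
    fix w :: complex assume w: "w ^ 17 = 1"
    have "gs (e * p) v = gs e v" for v
      using p1 unfolding cong_def by (intro gs_cong) (metis mod_mult_right_eq mult.right_neutral)
    moreover have "w ^ p = w ^ (14 ^ l)" using l unfolding cong_def by (rule root17_power_cong[OF w])
    ultimately have "poly f w = gs e (w ^ (14 ^ l))" by (simp only: f(2))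
    then show "poly f w = \<zeta> ^ (15 * e * l) * poly (gpoly e) w"
      unfolding poly_gpoly by (simp only: gs_shift[OF w])
  qed
  ultimately show ?thesis using coeff1_eqm[OF f(1)] by (simp add: coeff1_gpoly)
qed

text \<open>Here \<chi>^p is the inverse of \<chi>, and multiplying by G^2 gives \<kappa>^m G on one
  side and 17 \<chi>(-1) G, up to a root of unity, on the other. With G instead of G^2 both the
  validity at \<open>w = 1\<close> and the readable coefficient of x would be lost.\<close>

lemma gauss_reciprocity_minus:
  assumes p1: "[p = 15] (mod 16)" and m: "p + 1 = d * m"
  shows "R.eqm (int p) (\<kappa> ^ m) (17 * \<zeta> ^ (8 * e) * \<zeta> ^ (e * l))"
proof -
  obtain f where f: "RX.eqm (int p) (gpoly e ^ p) f" "\<And>w. poly f w = gs (e * p) (w ^ p)"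
    using gpoly_frobenius[OF p] by metis
  have f': "RX.eqm (int p) (gpoly e ^ p * gpoly e ^ 2) (f * gpoly e ^ 2)"
    by (intro RX.eqm_mult_right f RX.power_closed gpoly_closed)
  have "coeff1 (gpoly e ^ p * gpoly e ^ 2) = \<kappa> ^ m * coeff1 (gpoly e)"
  proof (rule coeff1_cong)
    fix w :: complex assume w: "w ^ 17 = 1"
    have "gs e w ^ p * gs e w ^ 2 = gs e w ^ (d * m + 1)"
      unfolding m[symmetric] by (simp add: power2_eq_square mult_ac)
    then show "poly (gpoly e ^ p * gpoly e ^ 2) w = \<kappa> ^ m * poly (gpoly e) w"
      by (simp only: poly_mult poly_power poly_gpoly gs_power_iterate[OF \<kappa>[OF w]])
  qed
  moreover have "coeff1 (f * gpoly e ^ 2) = (17 * \<zeta> ^ (8 * e) * \<zeta> ^ (e * l)) * coeff1 (gpoly e)"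
  proof (rule coeff1_cong)
    fix w :: complex assume w: "w ^ 17 = 1"
    have g: "gs (e * p) v = gs (15 * e) v" for v
      using p1 unfolding cong_def by (intro gs_cong) (metis mod_mult_right_eq mult.commute)
    have "w ^ p = w ^ (14 ^ l)" using l unfolding cong_def by (rule root17_power_cong[OF w])
    then have "poly f w = gs (15 * e) (w ^ (14 ^ l))" by (simp only: f(2) g)
    then have fw: "poly f w = \<zeta> ^ (15 * (15 * e) * l) * gs (15 * e) w"
      by (simp only: gs_shift[OF w])
    have eq: "15 * (15 * e) * l = e * l + 16 * (14 * (e * l))" by simp
    have z: "\<zeta> ^ (15 * (15 * e) * l) = \<zeta> ^ (e * l)"
      by (rule zeta16_power_cong) (unfold eq, rule mod_mult_self2)
    have g2: "gs e w * (gs e w * gs (15 * e) w) = gs e w * (17 * \<zeta> ^ (8 * e))"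
    proof (cases "w = 1")
      case True
      then have "gs e w = 0" using gs_at_1[of e] e by auto
      then show ?thesis by simp
    next
      case False
      have "e \<in> {1, 2, 4, 8}" using e by auto
      then show ?thesis using gs_dual[OF _ w False] by simp
    qed
    have "poly (f * gpoly e ^ 2) w = \<zeta> ^ (e * l) * (gs e w * (gs e w * gs (15 * e) w))"
      unfolding poly_mult poly_power poly_gpoly fw z power2_eq_square by (simp only: mult_ac)
    then show "poly (f * gpoly e ^ 2) w = (17 * \<zeta> ^ (8 * e) * \<zeta> ^ (e * l)) * poly (gpoly e) w"
      unfolding g2 poly_gpoly by (simp only: mult_ac)
  qed
  ultimately show ?thesis using coeff1_eqm[OF f'] by (simp add: coeff1_gpoly)
qed

end

section \<open>Conjugation of the primes and the Stickelberger factorisation\<close>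

lemma prime_cong:
  assumes "j mod 16 = k mod 16"
  shows "prime16 j = prime16 k" "prime8 j = prime8 k"
proof -
  have "\<zeta> ^ j = \<zeta> ^ k" by (rule zeta16_power_cong[OF assms])
  moreover have "\<zeta> ^ (c * j) = \<zeta> ^ (c * k)" for c
    by (rule zeta16_power_cong, rule mod_mult_cong[OF refl assms])
  ultimately show "prime16 j = prime16 k" "prime8 j = prime8 k"
    unfolding prime16_def prime8_def by simp_all
qed

lemma prime_closed: "prime16 k \<in> R16" "prime8 k \<in> R16"
  unfolding prime16_def prime8_def by (intro R.closed zeta16_in_R16)+

lemma hom_prime:
  assumes f: "field_hom_on L2 f" and k: "f \<zeta> = \<zeta> ^ k" and l: "(k * j) mod 16 = l mod 16"
  shows "f (prime16 j) = prime16 l" "f (prime8 j) = prime8 l"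
proof -
  note H = field_hom_closed[OF subfield_L2 f] and I = subfield_intros[OF subfield_L2] zeta16_in_L2
  have p: "f (\<zeta> ^ i) = \<zeta> ^ (k * i)" for i by (simp add: H(9) I k flip: power_mult)
  have "f (prime16 j) = 1 - f (\<zeta> ^ j) + f (\<zeta> ^ (5 * j))"
    unfolding prime16_def by (simp only: H(1,2,6) I)
  also have "\<dots> = prime16 (k * j)" unfolding p prime16_def by (simp add: mult_ac)
  finally show "f (prime16 j) = prime16 l" using prime_cong[OF l] by simp
  have "f (prime8 j) = 1 + 2 * f (\<zeta> ^ (6 * j))"
    unfolding prime8_def by (simp only: H(1,2,3,11) I)
  also have "\<dots> = prime8 (k * j)" unfolding p prime8_def by (simp add: mult_ac)
  finally show "f (prime8 j) = prime8 l" using prime_cong[OF l] by simp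
qed

lemma cnj_prime:
  assumes "(15 * j) mod 16 = l mod 16"
  shows "cnj (prime16 j) = prime16 l" "cnj (prime8 j) = prime8 l"
  using hom_prime[OF cnj_hom cnj_zeta16 assms] by simp_all

lemma cnj_prime_values:
  "cnj (prime8 1) = prime8 15" "cnj (prime8 3) = prime8 13"
  "cnj (prime8 13) = prime8 3" "cnj (prime8 15) = prime8 1"
  "cnj (prime16 1) = prime16 15" "cnj (prime16 3) = prime16 13"
  "cnj (prime16 5) = prime16 11" "cnj (prime16 7) = prime16 9"
  "cnj (prime16 9) = prime16 7" "cnj (prime16 11) = prime16 5"
  "cnj (prime16 13) = prime16 3" "cnj (prime16 15) = prime16 1"
  by (rule cnj_prime; simp)+

lemma sigma_hom:
  assumes "odd c" "[int k = c] (mod 16)"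
  shows "field_hom_on L2 (sigma c)" "sigma c \<zeta> = \<zeta> ^ k"
  using sigma_gal[OF assms] gal_hom[OF subfield_L2] by blast+

lemma sigma_homs:
  "field_hom_on L2 (sigma 5)" "sigma 5 \<zeta> = \<zeta> ^ 5"
  "field_hom_on L2 (sigma 7)" "sigma 7 \<zeta> = \<zeta> ^ 7"
  "field_hom_on L2 (sigma (-5))" "sigma (-5) \<zeta> = \<zeta> ^ 11"
  "field_hom_on L2 (sigma (-3))" "sigma (-3) \<zeta> = \<zeta> ^ 13"
  using sigma_hom[of 5 5] sigma_hom[of 7 7] sigma_hom[of "-5" 11] sigma_hom[of "-3" 13]
  by (simp_all add: cong_def)

lemma hom_R16_divide:
  assumes "field_hom_on L2 f" "x \<in> R16" "y \<in> R16"
  shows "f (x / y) = f x / f y"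
  using field_hom_closed(8)[OF subfield_L2 assms(1)] assms R16_subset_L2 by blast

lemma alpha1_eq:
  "alpha1 (prime8 1) = (prime8 1 / prime8 15) * (prime8 3 / prime8 13) ^ 3"
proof -
  have "sigma 3 (prime8 1 / prime8 15) = prime8 3 / prime8 13"
    unfolding hom_R16_divide[OF sigma3_hom prime_closed(2) prime_closed(2)]
    using hom_prime(2)[OF sigma3_hom sigma3_zeta, of 1 3]
      hom_prime(2)[OF sigma3_hom sigma3_zeta, of 15 13] by simp
  then show ?thesis unfolding alpha1_def Let_def using cnj_prime_values by simp
qed

lemma alpha2_eq:
  "alpha2 (prime16 1) = (prime16 1 / prime16 15) * (prime16 11 / prime16 5) ^ 3
     * (prime16 13 / prime16 3) ^ 5 * (prime16 7 / prime16 9) ^ 7"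
proof -
  note D = hom_R16_divide[OF _ prime_closed(1) prime_closed(1)] and S = sigma_homs
  have "sigma (-5) (prime16 1 / prime16 15) = prime16 11 / prime16 5"
    unfolding D[OF S(5)] using hom_prime(1)[OF S(5,6), of 1 11] hom_prime(1)[OF S(5,6), of 15 5] by simp
  moreover have "sigma (-3) (prime16 1 / prime16 15) = prime16 13 / prime16 3"
    unfolding D[OF S(7)] using hom_prime(1)[OF S(7,8), of 1 13] hom_prime(1)[OF S(7,8), of 15 3] by simp
  moreover have "sigma 7 (prime16 1 / prime16 15) = prime16 7 / prime16 9"
    unfolding D[OF S(3)] using hom_prime(1)[OF S(3,4), of 1 7] hom_prime(1)[OF S(3,4), of 15 9] by simp
  ultimately show ?thesis unfolding alpha2_def Let_def using cnj_prime_values by simp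
qed

lemma prime_nonzero:
  "k \<in> {1, 3, 5, 7, 9, 11, 13, 15} \<Longrightarrow> prime16 k \<noteq> 0" "k \<in> {1, 3, 13, 15} \<Longrightarrow> prime8 k \<noteq> 0"
  using prime16_norm prime8_norm by auto

lemma R16_inverse:
  assumes "x * y = 17" "y \<in> R16"
  shows "inverse x \<in> R16"
proof -
  have "x \<noteq> 0" using assms by auto
  have "inverse x = y * (1 / 17)"
    using assms(1) \<open>x \<noteq> 0\<close> by (simp add: field_simps)
  then show ?thesis using assms(2) by (simp only: R.closed inv17_in_R16)
qed

text \<open>In G^8 the primes \<open>prime8\<close> 1, 3, 13, 15 have exponents 1, 3, 5, 7.
  Conjugate primes have exponents adding up to 8, so dividing by the eighth power of those with
  exponent above 4 leaves \<open>alpha1\<close>. Likewise \<open>gamma2\<close> collects the indices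
  9, 3, 5, 15, with exponents 9, 11, 13, 15 in G^16.\<close>

definition gamma1 :: complex where "gamma1 = prime8 15 * prime8 13"

definition gamma2 :: complex where "gamma2 = prime16 15 * prime16 3 * (prime16 5 * prime16 9)"

lemma gamma_closed: "gamma1 \<in> R16" "gamma2 \<in> R16"
  unfolding gamma1_def gamma2_def by (intro R.closed prime_closed)+

lemma gamma_norm: "gamma1 * cnj gamma1 = 17" "gamma2 * cnj gamma2 = 17"
proof -
  have "cnj gamma1 = prime8 1 * prime8 3"
    unfolding gamma1_def complex_cnj_mult cnj_prime_values ..
  then show "gamma1 * cnj gamma1 = 17" unfolding gamma1_def using prime8_norm by simp
  have "cnj gamma2 = prime16 1 * prime16 13 * (prime16 11 * prime16 7)"
    unfolding gamma2_def complex_cnj_mult cnj_prime_values ..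
  then show "gamma2 * cnj gamma2 = 17" unfolding gamma2_def using prime16_norm by simp
qed

lemma gauss8_factorisation: "17 * jac 2 2 ^ 4 * jac 4 4 ^ 2 = alpha1 (prime8 1) * gamma1 ^ 8"
proof -
  define u v where "u = prime8 1 / prime8 15" and "v = prime8 3 / prime8 13"
  then have uv: "prime8 1 = u * prime8 15" "prime8 3 = v * prime8 13"
    using prime_nonzero(2) by simp_all
  have id: "x * y * (u * x * (v * y)) * (x * y) ^ 4 * (- (x * (v * y))) ^ 2 = u * v ^ 3 * (x * y) ^ 8"
    for x y :: complex
    by (simp add: power_numeral_reduce mult_ac)
  show ?thesis
    unfolding jac_factors(3,5) prime8_norm[symmetric] alpha1_eq gamma1_def
      u_def[symmetric] v_def[symmetric] unfolding uv
    by (rule id)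
qed

lemma gauss16_factorisation:
  "17 * jac 1 1 ^ 8 * jac 2 2 ^ 4 * jac 4 4 ^ 2 = alpha2 (prime16 1) * gamma2 ^ 16"
proof -
  define a b c d where "a = prime16 1 / prime16 15" and "b = prime16 11 / prime16 5"
    and "c = prime16 13 / prime16 3" and "d = prime16 7 / prime16 9"
  then have abcd: "prime16 1 = a * prime16 15" "prime16 11 = b * prime16 5"
    "prime16 13 = c * prime16 3" "prime16 7 = d * prime16 9"
    using prime_nonzero(1) by simp_all
  have "\<zeta> ^ 32 = 1" using zeta16_power_cong[of 32 0] by simp
  then have j: "jac 1 1 ^ 8 = ((prime16 15 * prime16 3) * (prime16 5 * prime16 9)) ^ 8"
    unfolding jac_factors(1) power_mult_distrib by (simp flip: power_mult)
  have id: "x * y * (z * t) * (a * x * (c * y) * (b * z * (d * t))) * (x * y * (z * t)) ^ 8 *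
      (x * (c * y) * (z * (d * t))) ^ 4 * (- (x * y * (b * z * (d * t)))) ^ 2 =
      a * b ^ 3 * c ^ 5 * d ^ 7 * (x * y * (z * t)) ^ 16" for x y z t :: complex
    by (simp add: power_numeral_reduce mult_ac)
  show ?thesis
    unfolding j jac_factors(2,4) prime16_norm[symmetric] alpha2_eq gamma2_def
      a_def[symmetric] b_def[symmetric] c_def[symmetric] d_def[symmetric] unfolding abcd
    by (rule id)
qed

lemma alpha_closed: "alpha1 (prime8 1) \<in> R16" "alpha2 (prime16 1) \<in> R16"
proof -
  \<comment> \<open>Each denominator divides 17, so its inverse is the cofactor divided by
    17.\<close>
  have i: "x / y \<in> R16" if "y * z = 17" "x \<in> R16" "z \<in> R16" for x y z
    using R16_inverse[OF that(1,3)] that(2) by (simp add: divide_inverse R.mult_closed)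
  have "prime8 1 / prime8 15 \<in> R16"
    by (rule i[of _ "prime8 13 * (prime8 1 * prime8 3)"])
      (use prime8_norm in \<open>simp_all only: mult_ac R.mult_closed prime_closed\<close>)
  moreover have "prime8 3 / prime8 13 \<in> R16"
    by (rule i[of _ "prime8 15 * (prime8 1 * prime8 3)"])
      (use prime8_norm in \<open>simp_all only: mult_ac R.mult_closed prime_closed\<close>)
  ultimately show "alpha1 (prime8 1) \<in> R16" unfolding alpha1_eq by (intro R.closed)
  let ?b = "prime16 1 * prime16 13 * (prime16 11 * prime16 7)"
  have "prime16 1 / prime16 15 \<in> R16"
    by (rule i[of _ "prime16 3 * (prime16 5 * prime16 9) * ?b"])
      (use prime16_norm in \<open>simp_all only: mult_ac R.mult_closed prime_closed\<close>)
  moreover have "prime16 11 / prime16 5 \<in> R16"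
    by (rule i[of _ "prime16 15 * prime16 3 * prime16 9 * ?b"])
      (use prime16_norm in \<open>simp_all only: mult_ac R.mult_closed prime_closed\<close>)
  moreover have "prime16 13 / prime16 3 \<in> R16"
    by (rule i[of _ "prime16 15 * prime16 5 * prime16 9 * ?b"])
      (use prime16_norm in \<open>simp_all only: mult_ac R.mult_closed prime_closed\<close>)
  moreover have "prime16 7 / prime16 9 \<in> R16"
    by (rule i[of _ "prime16 15 * prime16 3 * prime16 5 * ?b"])
      (use prime16_norm in \<open>simp_all only: mult_ac R.mult_closed prime_closed\<close>)
  ultimately show "alpha2 (prime16 1) \<in> R16" unfolding alpha2_eq by (intro R.closed)
qed

lemma alpha_norm:
  "alpha1 (prime8 1) * cnj (alpha1 (prime8 1)) = 1"
  "alpha2 (prime16 1) * cnj (alpha2 (prime16 1)) = 1"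
proof -
  have nz: "prime8 1 \<noteq> 0" "prime8 3 \<noteq> 0" "prime8 13 \<noteq> 0" "prime8 15 \<noteq> 0"
    using prime_nonzero(2) by auto
  show "alpha1 (prime8 1) * cnj (alpha1 (prime8 1)) = 1"
    unfolding alpha1_eq complex_cnj_mult complex_cnj_power complex_cnj_divide
      cnj_prime_values
    using nz by (simp add: field_simps)
  have nz: "prime16 1 \<noteq> 0" "prime16 3 \<noteq> 0" "prime16 5 \<noteq> 0" "prime16 7 \<noteq> 0"
    "prime16 9 \<noteq> 0" "prime16 11 \<noteq> 0" "prime16 13 \<noteq> 0" "prime16 15 \<noteq> 0"
    using prime_nonzero(1) by auto
  show "alpha2 (prime16 1) * cnj (alpha2 (prime16 1)) = 1"
    unfolding alpha2_eq complex_cnj_mult complex_cnj_power complex_cnj_divide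
      cnj_prime_values
    using nz by (simp add: field_simps)
qed

lemma eqm_hom:
  assumes f: "field_hom_on L2 f" "f \<zeta> = \<zeta> ^ k" and e: "R.eqm q x y" and x: "x \<in> R16" and y: "y \<in> R16"
  shows "R.eqm q (f x) (f y)"
proof -
  note H = field_hom_closed[OF subfield_L2 f(1)]
  obtain r where r: "r \<in> R16" "x - y = of_int q * r" using e unfolding R.eqm_def by blast
  have m: "r \<in> L2" "x \<in> L2" "y \<in> L2" "of_int q \<in> L2"
    using r x y R.of_int_closed[of q] R16_subset_L2 by blast+
  have "f x - f y = f (of_int q * r)" using r(2) H(6)[OF m(2,3)] by simp
  also have "\<dots> = of_int q * f r"
    using H(3)[OF m(4,1)] hom_fixes_Rats[OF subfield_L2 f(1), of "of_int q"] by simp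
  finally show ?thesis using hom_R16_closed[OF f r(1)] by (intro R.eqmI)
qed

text \<open>\<alpha>^m is \<zeta>^(-el) or \<zeta>^(el) according to the sign, and adding the
  conjugate hides the difference. Frobenius applied to \<gamma> removes \<gamma>^(dm) from the Gauss
  sum congruence.\<close>

lemma power_residue:
  assumes p: "prime p" "p \<noteq> 17" "odd p" and e: "e \<in> {1, 2}" and l: "[Mstar = 14 ^ l] (mod 17)"
    and \<kappa>: "\<And>w. w ^ 17 = 1 \<Longrightarrow> gs e w ^ (d + 1) = \<alpha> * \<gamma> ^ d * gs e w"
    and \<alpha>: "\<alpha> \<in> R16" "\<alpha> * cnj \<alpha> = 1" and \<gamma>: "\<gamma> \<in> R16" "\<gamma> * cnj \<gamma> = 17"
    and Mstar: "[p = 1] (mod 16) \<and> p = d * m + 1 \<and> Mstar = int p \<or>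
      [p = 15] (mod 16) \<and> p + 1 = d * m \<and> Mstar = - int p"
  shows "R.eqm (int p) (\<alpha> ^ m + cnj \<alpha> ^ m) (\<zeta> ^ (e * l) + \<zeta> ^ (15 * (e * l)))"
proof -
  have c: "\<zeta> ^ i = cnj (\<zeta> ^ (15 * i))" "\<zeta> ^ (15 * i) = cnj (\<zeta> ^ i)" for i
    using zeta16_power_cong[of "15 * (15 * i)" i] mod_mult_self2[of i 16 "14 * i"]
    by (simp_all add: cnj_zeta16 flip: power_mult)
  have "R.eqm (int p) (\<alpha> ^ m) (\<zeta> ^ (e * l)) \<or> R.eqm (int p) (\<alpha> ^ m) (\<zeta> ^ (15 * (e * l)))"
    using Mstar
  proof (elim disjE conjE)
    assume 1: "[p = 1] (mod 16)" "p = d * m + 1" "Mstar = int p"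
    have "[int p = int (14 ^ l)] (mod int 17)" using l unfolding 1(3) by simp
    then have l': "[p = 14 ^ l] (mod 17)" unfolding cong_int_iff .
    have r: "R.eqm (int p) ((\<alpha> * \<gamma> ^ d) ^ m) (\<zeta> ^ (15 * e * l))"
      by (rule gauss_reciprocity_plus[OF p(1) e l' \<kappa> 1(1,2)])
    have "\<zeta> ^ p = \<zeta>" using zeta16_power_cong[of p 1] 1(1) unfolding cong_def by simp
    then have "R.eqm (int p) (\<gamma> ^ (p ^ 1)) \<gamma>"
      by (intro R16_frobenius[where f = "\<lambda>x. x", OF p(1,3) \<gamma>(1)]) simp_all
    \<comment> \<open>Multiplying by the inverse \<open>cnj \<gamma> / 17\<close> of \<gamma> gives
      \<gamma>^(p-1) = 1.\<close>
    then have "R.eqm (int p) (cnj \<gamma> * (1 / 17) * \<gamma> ^ p) (cnj \<gamma> * (1 / 17) * \<gamma>)"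
      by (intro R.eqm_mult_left R.closed cnj_R16 \<gamma> inv17_in_R16) simp
    also have "cnj \<gamma> * (1 / 17) * \<gamma> = 1" using \<gamma>(2) by (simp add: mult_ac)
    also have "cnj \<gamma> * (1 / 17) * \<gamma> ^ p = \<gamma> ^ (d * m) * ((\<gamma> * cnj \<gamma>) * (1 / 17))"
      unfolding 1(2) by (simp add: mult_ac)
    finally have g: "R.eqm (int p) (\<gamma> ^ (d * m)) 1" unfolding \<gamma>(2) by simp
    have "R.eqm (int p) (\<alpha> ^ m * \<gamma> ^ (d * m)) (\<alpha> ^ m * 1)"
      by (intro R.eqm_mult_left g R.closed \<alpha>)
    then have "R.eqm (int p) (\<alpha> ^ m) ((\<alpha> * \<gamma> ^ d) ^ m)"
      using R.eqm_sym by (simp add: power_mult_distrib power_mult)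
    from R.eqm_trans[OF this r] show ?thesis by (simp add: mult.assoc)
  next
    assume 2: "[p = 15] (mod 16)" "p + 1 = d * m" "Mstar = - int p"
    have "[- Mstar = - (14 ^ l)] (mod 17)" using l by (simp add: cong_minus_minus_iff)
    \<comment> \<open>As -1 = 14^8 modulo 17, the logarithm of \<open>p\<close> is
      \<open>l + 8\<close>; the resulting sign cancels \<chi>^e(-1) =
      \<open>\<zeta> ^ (8 * e)\<close>.\<close>
    also have "[- (14 ^ l) = 14 ^ l * (14 ^ 8 :: int)] (mod 17)"
      using cong_mult[OF cong_refl, of "-1" "14 ^ 8 :: int" 17 "14 ^ l"] by (simp add: cong_def)
    finally have "[int p = int (14 ^ (l + 8))] (mod int 17)" using 2(3) by (simp add: power_add)
    then have l': "[p = 14 ^ (l + 8)] (mod 17)" unfolding cong_int_iff .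
    have r: "R.eqm (int p) ((\<alpha> * \<gamma> ^ d) ^ m) (17 * \<zeta> ^ (8 * e) * \<zeta> ^ (e * (l + 8)))"
      by (rule gauss_reciprocity_minus[OF p(1) e l' \<kappa> 2(1,2)])
    have "\<zeta> ^ (8 * e) * \<zeta> ^ (e * (l + 8)) = \<zeta> ^ (e * l + 16 * e)"
      by (simp add: algebra_simps flip: power_add)
    also have "\<dots> = \<zeta> ^ (e * l)" by (rule zeta16_power_cong) simp
    finally have z: "17 * \<zeta> ^ (8 * e) * \<zeta> ^ (e * (l + 8)) = 17 * \<zeta> ^ (e * l)" by simp
    have "cnj \<zeta> = \<zeta> ^ p"
      unfolding cnj_zeta16 using zeta16_power_cong[of 15 p] 2(1) unfolding cong_def by simp
    then have "R.eqm (int p) (\<gamma> ^ (p ^ 1)) (cnj \<gamma>)"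
      by (intro R16_frobenius[where f = cnj, OF p(1,3) \<gamma>(1)]) (simp_all add: cnj_R16)
    \<comment> \<open>Now \<gamma>^(p+1) = 17, which cancels the 17 contributed by
      \<open>gs_dual\<close>.\<close>
    then have "R.eqm (int p) (\<gamma> * \<gamma> ^ p) (\<gamma> * cnj \<gamma>)"
      by (intro R.eqm_mult_left \<gamma>) simp
    also have "\<gamma> * \<gamma> ^ p = \<gamma> ^ (d * m)" unfolding 2(2)[symmetric] by simp
    finally have g: "R.eqm (int p) (\<gamma> ^ (d * m)) 17" unfolding \<gamma>(2) .
    have "R.eqm (int p) (\<alpha> ^ m * \<gamma> ^ (d * m)) (\<alpha> ^ m * 17)"
      by (intro R.eqm_mult_left g R.closed \<alpha>)
    then have "R.eqm (int p) (\<alpha> ^ m * 17) ((\<alpha> * \<gamma> ^ d) ^ m)"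
      using R.eqm_sym by (simp add: power_mult_distrib power_mult)
    from R.eqm_trans[OF this r] have "R.eqm (int p) (\<alpha> ^ m * 17) (17 * \<zeta> ^ (e * l))" unfolding z .
    then have "R.eqm (int p) (\<alpha> ^ m * 17 * (1 / 17)) (17 * \<zeta> ^ (e * l) * (1 / 17))"
      by (intro R.eqm_mult_right inv17_in_R16)
    then show ?thesis by simp
  qed
  then show ?thesis
  proof
    assume a: "R.eqm (int p) (\<alpha> ^ m) (\<zeta> ^ (e * l))"
    have "R.eqm (int p) (cnj (\<alpha> ^ m)) (cnj (\<zeta> ^ (e * l)))"
      by (intro eqm_hom[OF cnj_hom cnj_zeta16 a] R.closed \<alpha> zeta16_in_R16)
    from R.eqm_add[OF a this] show ?thesis unfolding c(2) by simp
  next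
    assume a: "R.eqm (int p) (\<alpha> ^ m) (\<zeta> ^ (15 * (e * l)))"
    have "R.eqm (int p) (cnj (\<alpha> ^ m)) (cnj (\<zeta> ^ (15 * (e * l))))"
      by (intro eqm_hom[OF cnj_hom cnj_zeta16 a] R.closed \<alpha> zeta16_in_R16)
    from R.eqm_add[OF a this] show ?thesis unfolding c(1)[symmetric] by (simp add: add.commute)
  qed
qed

subsection \<open>The recurrence sequences\<close>

lemma hom_L2_image:
  assumes "field_hom_on L2 f" "f \<zeta> = \<zeta> ^ k" "x \<in> L2"
  shows "f x \<in> L2"
  using field_hom_image[of "{\<zeta>}" f x, folded L2_def] assms
    subfield_closed(5)[OF subfield_L2 zeta16_in_L2] by auto

lemma hom_comp_eq:
  assumes f: "field_hom_on L2 f" "f \<zeta> = \<zeta> ^ i" and g: "field_hom_on L2 g" "g \<zeta> = \<zeta> ^ j"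
    and f': "field_hom_on L2 f'" "f' \<zeta> = \<zeta> ^ i'" and g': "field_hom_on L2 g'" "g' \<zeta> = \<zeta> ^ j'"
    and c: "(i * j) mod 16 = (i' * j') mod 16" and x: "x \<in> L2"
  shows "f (g x) = f' (g' x)"
proof -
  have hom: "field_hom_on L2 (\<lambda>x. f (g x))" "(f (g \<zeta>)) = \<zeta> ^ (i * j)"
    if f: "field_hom_on L2 f" "f \<zeta> = \<zeta> ^ i" and g: "field_hom_on L2 g" "g \<zeta> = \<zeta> ^ j" for f g i j
  proof -
    show "field_hom_on L2 (\<lambda>x. f (g x))"
      using f(1) g(1) hom_L2_image[OF g] unfolding field_hom_on_def by auto
    show "f (g \<zeta>) = \<zeta> ^ (i * j)"
      unfolding g(2) field_hom_closed(9)[OF subfield_L2 f(1) zeta16_in_L2] f(2) by (simp add: power_mult)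
  qed
  show ?thesis
    by (rule field_hom_unique[of "{\<zeta>}", folded L2_def, OF hom(1)[OF f g] hom(1)[OF f' g'] _ x])
      (use hom(2)[OF f g] hom(2)[OF f' g'] zeta16_power_cong[OF c] in auto)
qed

lemma alpha1_quad: "alpha1 (prime8 1) \<in> quad_ext K1 \<i>"
proof -
  have F: "is_subfield (quad_ext K1 \<i>)"
    by (rule subfield_quad_ext[OF subfield_K1]) (simp add: subfield_intros[OF subfield_K1])
  note I = subfield_intros[OF F]
  have k: "complex_of_real (sqrt 2) / 2 \<in> K1"
    by (intro subfield_intros[OF subfield_K1] sqrt2_in_K1)
  have "complex_of_real (sqrt 2) / 2 + complex_of_real (sqrt 2) / 2 * \<i> \<in> quad_ext K1 \<i>"
    by (rule quad_extI[OF k k])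
  then have z: "\<zeta>\<^sup>2 \<in> quad_ext K1 \<i>" unfolding zeta16_sq by (simp add: distrib_left)
  have "prime8 k = 1 + 2 * (\<zeta>\<^sup>2) ^ (3 * k)" for k
    unfolding prime8_def by (simp flip: power_mult)
  then have "prime8 k \<in> quad_ext K1 \<i>" for k by (simp only:) (intro I z)
  then show ?thesis unfolding alpha1_eq by (intro I)
qed

text \<open>The formulas for trace and norm apply inside \<open>K1\<close> only. Since \<alpha>^h =
  a + b i over the real field \<open>K1\<close>, adding the conjugate leaves 2 a.\<close>

lemma theta_in_K1: "theta (prime8 1) h \<in> K1"
proof -
  have F: "is_subfield (quad_ext K1 \<i>)"
    by (rule subfield_quad_ext[OF subfield_K1]) (simp add: subfield_intros[OF subfield_K1])
  have "alpha1 (prime8 1) ^ h \<in> quad_ext K1 \<i>" by (intro subfield_closed(5)[OF F] alpha1_quad)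
  then obtain a b where ab: "alpha1 (prime8 1) ^ h = a + b * \<i>" "a \<in> K1" "b \<in> K1"
    unfolding quad_ext_def by blast
  then have "a \<in> \<real>" "b \<in> \<real>" using K1_subset_Reals by blast+
  then have "cnj (alpha1 (prime8 1) ^ h) = a - b * \<i>" unfolding ab(1) by (simp add: Reals_cnj_iff)
  then have t: "theta (prime8 1) h = a + a" unfolding theta_def using ab(1) by simp
  show ?thesis unfolding t by (intro subfield_closed(3)[OF subfield_K1] ab)
qed

lemma K1_trace_norm_Rats:
  assumes "x \<in> K1"
  shows "x + sigma 3 x \<in> \<rat>" "x * sigma 3 x \<in> \<rat>"
proof -
  let ?r = "complex_of_real (sqrt 2)"
  have r2: "?r * ?r = 2" by (simp flip: of_real_mult)
  have "is_subfield (quad_ext \<rat> ?r)"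
    by (rule subfield_quad_ext[OF subfield_Rats]) (simp add: power2_eq_square r2)
  then have "K1 \<subseteq> quad_ext \<rat> ?r"
    unfolding K1_def by (rule rat_adjoin_least) (simp add: quad_ext_gen[OF subfield_Rats])
  then obtain a b where x: "x = a + b * ?r" "a \<in> \<rat>" "b \<in> \<rat>" using assms unfolding quad_ext_def by blast
  note H = field_hom_closed[OF subfield_L2 sigma3_hom]
  have m: "a \<in> L2" "b \<in> L2" "?r \<in> L2" "b * ?r \<in> L2"
    using x Rats_subset_subfield[OF subfield_L2] sqrt2_in_K1 K1_subset_L2 subfieldD(3)[OF subfield_L2]
    by blast+
  have s: "sigma 3 x = a - b * ?r"
    unfolding x(1) H(2)[OF m(1,4)] H(3)[OF m(2,3)] sigma3_sqrt2
    using hom_fixes_Rats[OF subfield_L2 sigma3_hom] x by simp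
  have "x * sigma 3 x = a * a - b * b * (?r * ?r)" unfolding s unfolding x(1) by (simp only: algebra_simps)
  then have "x * sigma 3 x = a * a - 2 * (b * b)" unfolding r2 by simp
  moreover have "x + sigma 3 x = 2 * a" unfolding s unfolding x(1) by simp
  ultimately show "x + sigma 3 x \<in> \<rat>" "x * sigma 3 x \<in> \<rat>" using x(2,3) by simp_all
qed

definition trace_pow :: "complex \<Rightarrow> nat \<Rightarrow> complex" where
  "trace_pow \<alpha> m = \<alpha> ^ m + cnj \<alpha> ^ m"

lemma trace_pow_double:
  assumes "\<alpha> * cnj \<alpha> = 1"
  shows "trace_pow \<alpha> (m * 2) = (trace_pow \<alpha> m)\<^sup>2 - 2"
proof -
  have "(\<alpha> ^ m) * (cnj \<alpha> ^ m) = 1" using assms by (simp flip: power_mult_distrib)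
  then show ?thesis unfolding trace_pow_def power_mult
    by (simp add: power2_eq_square algebra_simps)
qed

lemma trace_pow_closed: "\<alpha> \<in> R16 \<Longrightarrow> trace_pow \<alpha> m \<in> R16"
  unfolding trace_pow_def by (intro R.closed cnj_R16)

lemma hom_trace_pow_double:
  assumes f: "field_hom_on L2 f" and \<alpha>: "\<alpha> \<in> R16" "\<alpha> * cnj \<alpha> = 1"
  shows "f (trace_pow \<alpha> (m * 2)) = (f (trace_pow \<alpha> m))\<^sup>2 - 2"
proof -
  note H = field_hom_closed[OF subfield_L2 f] and I = subfield_intros[OF subfield_L2]
  have "trace_pow \<alpha> m \<in> L2" using trace_pow_closed[OF \<alpha>(1)] R16_subset_L2 by blast
  then show ?thesis unfolding trace_pow_double[OF \<alpha>(2)] by (simp only: H(6,9,11) I)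
qed

abbreviation (input) tr1 :: "nat \<Rightarrow> nat \<Rightarrow> complex" where
  "tr1 h k \<equiv> trace_pow (alpha1 (prime8 1)) (h * 2 ^ k)"

abbreviation (input) tr2 :: "nat \<Rightarrow> nat \<Rightarrow> complex" where
  "tr2 h k \<equiv> trace_pow (alpha2 (prime16 1)) (h * 2 ^ k)"

lemma T_N_seq_eq:
  "T_seq (prime8 1) h k = tr1 h k + sigma 3 (tr1 h k) \<and>
   N_seq (prime8 1) h k = tr1 h k * sigma 3 (tr1 h k)"
proof (induction k)
  case 0
  have "trace_pow (alpha1 (prime8 1)) h = theta (prime8 1) h" unfolding trace_pow_def theta_def ..
  then show ?case using field_trace_K1[OF theta_in_K1] field_norm_K1[OF theta_in_K1] by simp
next
  case (Suc k)
  have e: "h * 2 ^ Suc k = h * 2 ^ k * 2" by simp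
  define A B where "A = tr1 h k" and "B = sigma 3 (tr1 h k)"
  have s: "tr1 h (Suc k) = A\<^sup>2 - 2" "sigma 3 (tr1 h (Suc k)) = B\<^sup>2 - 2"
    unfolding A_def B_def e by (rule trace_pow_double[OF alpha_norm(1)],
        rule hom_trace_pow_double[OF sigma3_hom alpha_closed(1) alpha_norm(1)])
  show ?case
    unfolding s(2) unfolding s(1) using Suc[folded A_def B_def] by (simp add: power2_eq_square algebra_simps)
qed

lemma T_N_seq_Zinv17: "T_seq (prime8 1) h k \<in> Zinv17 \<and> N_seq (prime8 1) h k \<in> Zinv17"
proof (induction k)
  case 0
  let ?t = "theta (prime8 1) h"
  have t: "?t \<in> R16" unfolding theta_def by (intro R.closed cnj_R16 alpha_closed)
  then have "sigma 3 ?t \<in> R16" by (rule hom_R16_closed[OF sigma3_hom sigma3_zeta])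
  with t have "?t + sigma 3 ?t \<in> Zinv17" "?t * sigma 3 ?t \<in> Zinv17"
    using K1_trace_norm_Rats[OF theta_in_K1] by (simp_all add: R16_Rats R.closed)
  then show ?case using field_trace_K1[OF theta_in_K1] field_norm_K1[OF theta_in_K1] by simp
next
  case (Suc k)
  then show ?case by (simp add: A.closed)
qed

lemma XYZW_seq_eq:
  defines "a \<equiv> \<lambda>h k. tr2 h k" and "b \<equiv> \<lambda>h k. sigma 3 (tr2 h k)"
    and "c \<equiv> \<lambda>h k. sigma 5 (tr2 h k)" and "d \<equiv> \<lambda>h k. sigma 7 (tr2 h k)"
  shows "X_seq (prime16 1) h k = a h k + b h k + c h k + d h k \<and>
    Y_seq (prime16 1) h k = a h k * b h k + a h k * c h k + a h k * d h k + b h k * c h k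
      + b h k * d h k + c h k * d h k \<and>
    Z_seq (prime16 1) h k = a h k * b h k * c h k + a h k * b h k * d h k + a h k * c h k * d h k
      + b h k * c h k * d h k \<and>
    W_seq (prime16 1) h k = a h k * b h k * c h k * d h k"
proof (induction k)
  case 0
  have "trace_pow (alpha2 (prime16 1)) h = eta (prime16 1) h" unfolding trace_pow_def eta_def ..
  then show ?case unfolding a_def b_def c_def d_def by (simp add: Let_def)
next
  case (Suc k)
  note D = hom_trace_pow_double[OF _ alpha_closed(2) alpha_norm(2)]
  have e: "h * 2 ^ Suc k = h * 2 ^ k * 2" by simp
  have s: "a h (Suc k) = (a h k)\<^sup>2 - 2" "b h (Suc k) = (b h k)\<^sup>2 - 2"
    "c h (Suc k) = (c h k)\<^sup>2 - 2" "d h (Suc k) = (d h k)\<^sup>2 - 2"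
    unfolding a_def b_def c_def d_def e
    by (rule trace_pow_double[OF alpha_norm(2)], rule D[OF sigma3_hom],
        rule D[OF sigma_homs(1)], rule D[OF sigma_homs(3)])
  define A B C E where "A = a h k" and "B = b h k" and "C = c h k" and "E = d h k"
  note IH = Suc[folded A_def B_def C_def E_def]
  show ?case
    unfolding s A_def[symmetric] B_def[symmetric] C_def[symmetric] E_def[symmetric]
      X_seq.simps Y_seq.simps Z_seq.simps W_seq.simps
    by (simp only: IH, intro conjI) (simp_all add: power2_eq_square algebra_simps)
qed

lemma XYZW_seq_Zinv17:
  "X_seq (prime16 1) h k \<in> Zinv17 \<and> Y_seq (prime16 1) h k \<in> Zinv17 \<and>
   Z_seq (prime16 1) h k \<in> Zinv17 \<and> W_seq (prime16 1) h k \<in> Zinv17"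
proof (induction k)
  case 0
  define t where "t = eta (prime16 1) h"
  note H3 = field_hom_closed[OF subfield_L2 sigma3_hom] and I = subfield_intros[OF subfield_L2]
  have tR: "t \<in> R16" unfolding t_def eta_def by (intro R.closed cnj_R16 alpha_closed)
  then have t: "t \<in> L2" using R16_subset_L2 by blast
  have ct: "cnj t = t" unfolding t_def eta_def by (simp add: add.commute)
  note S3 = sigma3_hom sigma3_zeta and S5 = sigma_homs(1,2) and S7 = sigma_homs(3,4)
    and Sc = cnj_hom[of L2] cnj_zeta16
  have id: "field_hom_on L2 (\<lambda>x. x)" "(\<lambda>x. x) \<zeta> = \<zeta> ^ 1" by (simp_all add: field_hom_on_def)
  have m: "sigma 3 t \<in> R16" "sigma 5 t \<in> R16" "sigma 7 t \<in> R16"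
    using hom_R16_closed[OF S3 tR] hom_R16_closed[OF S5 tR] hom_R16_closed[OF S7 tR] by auto
  have m': "sigma 3 t \<in> L2" "sigma 5 t \<in> L2" "sigma 7 t \<in> L2" using m R16_subset_L2 by blast+
  \<comment> \<open>Since \<open>cnj\<close> fixes \<open>t\<close>, exponents count up to sign: 9
    is 7 and 15 is 1. Hence \<open>sigma 3\<close> permutes the conjugates with indices 1, 3, 7, 5
    cyclically and fixes their symmetric functions.\<close>
  have s: "sigma 3 (sigma 3 t) = sigma 7 t" "sigma 3 (sigma 7 t) = sigma 5 t" "sigma 3 (sigma 5 t) = t"
    using hom_comp_eq[OF S3 S3 S7 Sc _ t] hom_comp_eq[OF S3 S7 S5 id _ t]
      hom_comp_eq[OF S3 S5 id Sc _ t] ct by simp_all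
  have c: "cnj (sigma 3 t) = sigma 3 t" "cnj (sigma 5 t) = sigma 5 t" "cnj (sigma 7 t) = sigma 7 t"
    using hom_comp_eq[OF Sc S3 S3 Sc _ t] hom_comp_eq[OF Sc S5 S5 Sc _ t]
      hom_comp_eq[OF Sc S7 S7 Sc _ t] ct by simp_all
  show ?case
    unfolding X_seq.simps Y_seq.simps Z_seq.simps W_seq.simps Let_def t_def[symmetric]
    by (intro conjI; rule R16_fixed; (intro R.closed tR m)?; simp only: H3 I t m' s c ct
        complex_cnj_add complex_cnj_mult; simp only: ac_simps)
next
  case (Suc k)
  then show ?case by (simp add: A.closed)
qed

subsection \<open>Divisors of \<open>M\<close>\<close>

lemma odd_power4_mod16:
  fixes q :: nat
  assumes "odd q"
  shows "q ^ 4 mod 16 = 1"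
proof -
  obtain a where a: "q = 2 * a + 1" using assms by (blast elim: oddE)
  have "even (a * (a + 1))" by simp
  then obtain c where c: "a * (a + 1) = 2 * c" by blast
  have "q ^ 2 = 4 * (a * (a + 1)) + 1" unfolding a by (simp add: power2_eq_square algebra_simps)
  then have "q ^ 2 = 8 * c + 1" unfolding c by simp
  then have "(q ^ 2) ^ 2 = 1 + 16 * (4 * c ^ 2 + c)" by (simp add: power2_eq_square algebra_simps)
  then have "q ^ 4 = 1 + 16 * (4 * c ^ 2 + c)" by (simp flip: power_mult)
  then show ?thesis by (simp only: mod_mult_self2) simp
qed

lemma R16_frobenius4:
  assumes q: "prime q" "odd q" and x: "x \<in> R16"
  shows "R.eqm (int q) (x ^ (q ^ 4)) x"
proof -
  have "\<zeta> ^ (q ^ 4) = \<zeta>" using zeta16_power_cong[of "q ^ 4" 1] odd_power4_mod16[OF q(2)] by simp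
  then show ?thesis by (intro R16_frobenius[where f = "\<lambda>x. x", OF q x]) simp_all
qed

text \<open>\<open>x\<close> is congruent to x^(q^4), a multiple of x^j because j is at most 8 and
  q^4 at least 81. The bound 8 is the largest exponent that arises below.\<close>

lemma R16_nilpotent:
  assumes q: "prime q" "odd q" and x: "x \<in> R16" and j: "R.eqm (int q) (x ^ j) 0" "j \<le> 8"
  shows "R.eqm (int q) x 0"
proof -
  have "3 \<le> q" using q prime_ge_2_nat[OF q(1)] by (cases "q = 2") auto
  then have "3 ^ 4 \<le> q ^ 4" by (rule power_mono) simp
  then have "j + (q ^ 4 - j) = q ^ 4" using j(2) by simp
  then have e: "x ^ (q ^ 4) = x ^ (q ^ 4 - j) * x ^ j" by (simp add: add.commute flip: power_add)
  have "R.eqm (int q) x (x ^ (q ^ 4))" by (rule R.eqm_sym[OF R16_frobenius4[OF q x]])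
  also have "R.eqm (int q) (x ^ (q ^ 4)) (x ^ (q ^ 4 - j) * 0)"
    unfolding e by (intro R.eqm_mult_left R.closed x j)
  finally show ?thesis by simp
qed

text \<open>As \<open>b\<close> has the inverse \<open>cnj b\<close>, Frobenius yields b^(q^4-1) =
  1. If q^4 - 1 = 2^s t with t odd and s at most k, raising this to the power 2^(k-s) gives 1 =
  (-1)^t = -1.\<close>

lemma two_power_dvd_of_order:
  assumes q: "prime q" "odd q" "q \<noteq> 17" and b: "b \<in> R16" "b * cnj b = 1"
    and k: "R.eqm (int q) (b ^ (2 ^ k)) (-1)"
  shows "2 ^ Suc k dvd q ^ 4 - 1"
proof (rule ccontr)
  assume nd: "\<not> 2 ^ Suc k dvd q ^ 4 - 1"
  have q1: "q > 1" using q(1) prime_gt_1_nat by blast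
  then have q4: "1 < q ^ 4" by (rule one_less_power) simp
  then have "q ^ 4 - 1 \<noteq> 0" by simp
  moreover have "\<not> is_unit (2 :: nat)" by simp
  ultimately obtain t where "q ^ 4 - 1 = 2 ^ multiplicity 2 (q ^ 4 - 1) * t" "odd t"
    by (rule multiplicity_decompose')
  then obtain s where t: "q ^ 4 - 1 = 2 ^ s * t" "odd t" by blast
  have "s \<le> k"
  proof (rule ccontr)
    assume "\<not> s \<le> k"
    then have "(2 :: nat) ^ Suc k dvd 2 ^ s" by (intro le_imp_power_dvd) simp
    then have "2 ^ Suc k dvd 2 ^ s * t" by (rule dvd_mult2)
    then show False using nd unfolding t(1) by (rule notE[rotated])
  qed
  then have ks: "2 ^ k = 2 ^ s * (2 ^ (k - s) :: nat)" by (simp flip: power_add)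
  have "R.eqm (int q) (b ^ (q ^ 4) * cnj b) (b * cnj b)"
    by (intro R.eqm_mult_right R16_frobenius4[OF q(1,2)] b cnj_R16)
  also have "b ^ (q ^ 4) = b ^ (q ^ 4 - 1) * b" using q4 by (intro power_minus_mult[symmetric]) linarith
  also have "b ^ (q ^ 4 - 1) * b * cnj b = b ^ (q ^ 4 - 1) * (b * cnj b)" by (rule mult.assoc)
  finally have "R.eqm (int q) (b ^ (q ^ 4 - 1)) 1" unfolding b(2) by simp
  then have "R.eqm (int q) ((b ^ (q ^ 4 - 1)) ^ (2 ^ (k - s))) (1 ^ (2 ^ (k - s)))"
    by (rule R.eqm_power) (intro R.closed b)+
  moreover have "(b ^ (q ^ 4 - 1)) ^ (2 ^ (k - s)) = (b ^ (2 ^ k)) ^ t"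
    unfolding t(1) ks power_mult[symmetric] by (simp only: mult_ac)
  moreover have "R.eqm (int q) ((b ^ (2 ^ k)) ^ t) ((-1) ^ t)"
    by (rule R.eqm_power[OF k]) (intro R.closed b)+
  ultimately have "R.eqm (int q) ((-1) ^ t) (1 ^ (2 ^ (k - s)))" using R.eqm_trans R.eqm_sym by metis
  then show False using t(2) minus_one_not_eqm_one[OF q] by simp
qed

section \<open>Fourth roots of unity modulo a power of 2\<close>

lemma five_power: "\<exists>u :: int. odd u \<and> 5 ^ (2 ^ k) = 1 + 4 * 2 ^ k * u"
proof (induction k)
  case 0
  show ?case by (intro exI[of _ 1]) simp
next
  case (Suc k)
  then obtain u :: int where u: "odd u" "5 ^ (2 ^ k) = 1 + 4 * 2 ^ k * u" by blast
  define P :: int where "P = 2 ^ k"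
  have "(5 :: int) ^ (2 ^ Suc k) = (5 ^ (2 ^ k)) ^ 2" unfolding power_Suc2 power_mult ..
  also have "\<dots> = 1 + 4 * (2 * P) * (u + 2 * P * u ^ 2)"
    unfolding u(2) P_def[symmetric] by (simp add: power2_eq_square algebra_simps)
  finally have "(5 :: int) ^ (2 ^ Suc k) = 1 + 4 * 2 ^ Suc k * (u + 2 * P * u ^ 2)"
    unfolding P_def power_Suc .
  moreover have "odd (u + 2 * P * u ^ 2)" using u(1) by simp
  ultimately show ?case by blast
qed

text \<open>The classes 1 + 4 * 2^k c form a cyclic group of order 4 modulo 2^(k+4), generated by
  5^(2^k).\<close>

lemma fourth_root_of_unity_pos:
  fixes q :: int
  assumes q: "q = 1 + 4 * 2 ^ k * c"
  shows "\<exists>j\<in>{0, 1, 2, 3 :: nat}. [q = 5 ^ (j * 2 ^ k)] (mod 2 ^ (k + 4))"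
proof -
  obtain u :: int where u: "odd u" "5 ^ (2 ^ k) = 1 + 4 * 2 ^ k * u" using five_power by blast
  define P x where "P = (2 :: int) ^ k" and "x = 4 * P * u"
  have f: "(5 :: int) ^ (j * 2 ^ k) = (1 + x) ^ j" for j
    unfolding x_def P_def u(2)[symmetric] mult.commute[of j "2 ^ k"] power_mult ..
  have M: "(2 :: int) ^ (k + 4) = 16 * P" unfolding P_def by (simp add: power_add)
  obtain a where a: "u = 2 * a + 1" using u(1) by (blast elim: oddE)
  \<comment> \<open>Modulo 2^(k+4) the j-th power of 1 + x is 1 + j x, so \<open>j * u\<close> must
    be \<open>c\<close> modulo 4; as u^2 = 1 modulo 4, the solution is \<open>c * u\<close>.\<close>
  define j v where "j = nat (c * u mod 4)" and "v = (c * u div 4) * u - c * (a\<^sup>2 + a)"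
  have ij: "int j = c * u mod 4" unfolding j_def by simp
  have "c - (c * u mod 4) * u = c - (c * u - 4 * (c * u div 4)) * u"
    by (simp only: minus_mult_div_eq_mod)
  also have "\<dots> = 4 * (c * u div 4) * u + c * (1 - u * u)" by (simp add: algebra_simps)
  also have "u * u = 4 * (a\<^sup>2 + a) + 1" unfolding a by (simp add: power2_eq_square algebra_simps)
  also have "4 * (c * u div 4) * u + c * (1 - (4 * (a\<^sup>2 + a) + 1)) = 4 * v"
    unfolding v_def by (simp add: algebra_simps)
  finally have v: "c - int j * u = 4 * v" unfolding ij .
  have "j < 4" using ij pos_mod_bound[of 4 "c * u"] by linarith
  then have j: "j \<in> {0, 1, 2, 3}" by auto
  have c: "c = int j * u + 4 * v" using v by simp
  have id: "1 + 4 * P * (m * u + 4 * v) - (1 + x) ^ 0 = 16 * P * v" if "m = 0" for m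
    using that by simp
  have "1 + 4 * P * (1 * u + 4 * v) - (1 + x) ^ 1 = 16 * P * v"
    "1 + 4 * P * (2 * u + 4 * v) - (1 + x) ^ 2 = 16 * P * (v - P * (u * u))"
    "1 + 4 * P * (3 * u + 4 * v) - (1 + x) ^ 3 = 16 * P * (v - 3 * (P * (u * u)) - 4 * (P * P * (u * u * u)))"
    unfolding x_def by (simp_all add: power2_eq_square power3_eq_cube algebra_simps)
  then have "16 * P dvd 1 + 4 * P * (int j * u + 4 * v) - (1 + x) ^ j"
    using j id by (elim insertE) (simp_all only: of_nat_0 of_nat_1 of_nat_numeral dvd_triv_left empty_iff)
  then have "[q = (1 + x) ^ j] (mod 16 * P)"
    unfolding cong_iff_dvd_diff q P_def[symmetric] c[symmetric] .
  then show ?thesis unfolding M f using j by blast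
qed

text \<open>q^2 + 1 is twice an odd number, and so is one of q - 1 and q + 1. Two factors 2 are thus
  lost, leaving q = 1 or -1 modulo 2^(k+2).\<close>

lemma fourth_root_of_unity:
  fixes q :: int
  assumes q: "odd q" "2 ^ (k + 4) dvd q ^ 4 - 1"
  shows "\<exists>j\<in>{0, 1, 2, 3 :: nat}. [q = 5 ^ (j * 2 ^ k)] (mod 2 ^ (k + 4)) \<or>
           [q = - (5 ^ (j * 2 ^ k))] (mod 2 ^ (k + 4))"
proof -
  have half: "2 ^ i dvd x" if "2 ^ Suc i dvd 2 * x * y" "odd y" for i and x y :: int
  proof -
    have "(2 :: int) ^ i dvd x * y" using that(1) by (simp add: mult.assoc)
    moreover have "coprime ((2 :: int) ^ i) y" using that(2) by simp
    ultimately show ?thesis by (simp add: coprime_dvd_mult_left_iff)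
  qed
  obtain a where a: "q = 2 * a + 1" using q(1) by (blast elim: oddE)
  have "q ^ 4 - 1 = 2 * (q ^ 2 - 1) * (2 * (a ^ 2 + a) + 1)"
    unfolding a by (simp add: power4_eq_xxxx power2_eq_square algebra_simps)
  then have "2 ^ Suc (k + 3) dvd 2 * (q ^ 2 - 1) * (2 * (a ^ 2 + a) + 1)"
    using q(2) by (simp add: numeral_eq_Suc)
  then have d: "2 ^ (k + 3) dvd q ^ 2 - 1" by (rule half) simp
  have sq: "q ^ 2 - 1 = 2 * (2 * a) * (a + 1)" "q ^ 2 - 1 = 2 * (2 * (a + 1)) * a"
    unfolding a by (simp_all add: power2_eq_square algebra_simps)
  have e: "(2 :: int) ^ Suc (k + 2) = 2 ^ (k + 3)" by (simp add: numeral_eq_Suc)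
  have p: "(2 :: int) ^ (k + 2) = 4 * 2 ^ k" by (simp add: power_add)
  show ?thesis
  proof (cases "even a")
    case True
    have "2 ^ Suc (k + 2) dvd 2 * (2 * a) * (a + 1)" using d unfolding sq(1) e .
    then have "2 ^ (k + 2) dvd 2 * a" by (rule half) (use True in simp)
    then obtain c where "2 * a = 4 * 2 ^ k * c" unfolding p by blast
    then have "q = 1 + 4 * 2 ^ k * c" using a by simp
    then show ?thesis using fourth_root_of_unity_pos by blast
  next
    case False
    have "2 ^ Suc (k + 2) dvd 2 * (2 * (a + 1)) * a" using d unfolding sq(2) e .
    then have "2 ^ (k + 2) dvd 2 * (a + 1)" by (rule half) (use False in simp)
    then obtain c where "2 * (a + 1) = 4 * 2 ^ k * c" unfolding p by blast
    then have "- q = 1 + 4 * 2 ^ k * (- c)" using a by simp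
    from fourth_root_of_unity_pos[OF this] obtain j where
      j: "j \<in> {0, 1, 2, 3 :: nat}" "[- q = 5 ^ (j * 2 ^ k)] (mod 2 ^ (k + 4))" by blast
    then have "[q = - (5 ^ (j * 2 ^ k))] (mod 2 ^ (k + 4))"
      using cong_minus_minus_iff[of "- q" "5 ^ (j * 2 ^ k)"] by simp
    then show ?thesis using j by blast
  qed
qed

lemma dlog_14:
  fixes a :: int
  assumes "\<not> 17 dvd a"
  shows "\<exists>l<16. [a = 14 ^ l] (mod 17)"
proof -
  have "0 \<le> a mod 17" "a mod 17 < 17" "a mod 17 \<noteq> 0" using assms by (simp_all add: dvd_eq_mod_eq_0)
  then have "a mod 17 \<in> {1, 2, 3, 4, 5, 6, 7, 8, 9, 10, 11, 12, 13, 14, 15, 16}" by simp presburger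
  moreover have "\<exists>l<16. r = 14 ^ l mod (17 :: int)"
    if "r \<in> {1, 2, 3, 4, 5, 6, 7, 8, 9, 10, 11, 12, 13, 14, 15, 16}" for r
  proof -
    have "r \<in> (\<lambda>l. 14 ^ l mod 17) ` {..<16}" using that unfolding lessThan_16 by auto
    then show ?thesis by auto
  qed
  ultimately show ?thesis unfolding cong_def by blast
qed

subsection \<open>The primality criterion\<close>

context
  fixes \<alpha> :: complex and m q :: nat and x t :: complex
  assumes q: "prime q" "odd q" and \<alpha>: "\<alpha> \<in> R16" "\<alpha> * cnj \<alpha> = 1"
  defines "x \<equiv> \<alpha> ^ m" and "t \<equiv> trace_pow \<alpha> m"
begin

private lemma x_closed: "x \<in> R16"
  unfolding x_def by (intro R.closed \<alpha>)

private lemma x_mult_t: "x * t = x * x + 1"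
proof -
  have "\<alpha> ^ m * cnj \<alpha> ^ m = 1" using \<alpha>(2) by (simp flip: power_mult_distrib)
  then show ?thesis unfolding x_def t_def trace_pow_def by (simp add: distrib_left)
qed

private lemma t_closed: "t \<in> R16"
  unfolding t_def by (rule trace_pow_closed[OF \<alpha>(1)])

private lemma nilpotent_shift:
  assumes "y \<in> R16" "R.eqm (int q) ((y + 1) ^ j) 0" "j \<le> 8"
  shows "R.eqm (int q) y (-1)"
proof -
  have "R.eqm (int q) (y + 1) 0"
    using R16_nilpotent[OF q _ assms(2,3)] R.add_closed[OF assms(1) R.one_closed] by blast
  then show ?thesis using R.eqm_diff[of "int q" "y + 1" 0 1 1] by simp
qed

text \<open>As t = x + 1/x, (x + 1)^2 = x (t + 2), so x + 1 is nilpotent.\<close>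

lemma power_eqm_minus_one_quartic:
  assumes "R.eqm (int q) ((t + 2) ^ 4) 0"
  shows "R.eqm (int q) x (-1)"
proof (rule nilpotent_shift[OF x_closed, of 8])
  have "(x + 1) ^ 8 = ((x + 1) * (x + 1)) ^ 4" by (simp add: power_mult_distrib flip: power_add)
  also have "(x + 1) * (x + 1) = x * (t + 2)" using x_mult_t by (simp add: algebra_simps)
  also have "(x * (t + 2)) ^ 4 = x ^ 4 * (t + 2) ^ 4" by (rule power_mult_distrib)
  finally show "R.eqm (int q) ((x + 1) ^ 8) 0"
    using R.eqm_mult_left[OF R.power_closed[OF x_closed] assms, of 4] by simp
qed simp

lemma power_eqm_minus_one_quadratic:
  assumes "R.eqm (int q) (t\<^sup>2) (- 4 * t - 4)"
  shows "R.eqm (int q) x (-1)"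
proof (rule power_eqm_minus_one_quartic)
  have "R.eqm (int q) (t\<^sup>2 + (4 * t + 4)) (- 4 * t - 4 + (4 * t + 4))"
    by (intro R.eqm_add assms R.eqm_refl)
  then have "R.eqm (int q) ((t + 2) * (t + 2)) 0" by (simp add: power2_eq_square algebra_simps)
  then have "R.eqm (int q) ((t + 2) * (t + 2) * ((t + 2) * (t + 2))) (0 * ((t + 2) * (t + 2)))"
    by (intro R.eqm_mult_right R.closed t_closed)
  then show "R.eqm (int q) ((t + 2) ^ 4) 0" by (simp add: power4_eq_xxxx mult.assoc)
qed

text \<open>Here x^2 + 1 = x t is nilpotent.\<close>

lemma power_eqm_minus_one_square:
  assumes "R.eqm (int q) (t\<^sup>2) 0"
  shows "R.eqm (int q) (x\<^sup>2) (-1)"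
proof (rule nilpotent_shift[of _ 2])
  have "(x\<^sup>2 + 1)\<^sup>2 = (x * t)\<^sup>2" unfolding x_mult_t by (simp add: power2_eq_square)
  also have "\<dots> = x\<^sup>2 * t\<^sup>2" by (rule power_mult_distrib)
  finally show "R.eqm (int q) ((x\<^sup>2 + 1)\<^sup>2) 0"
    using R.eqm_mult_left[OF R.power_closed[OF x_closed] assms, of 2] by simp
qed (intro R.closed x_closed, simp)

text \<open>This is x^4 + 1 = x^2 (t^2 - 2).\<close>

lemma power_eqm_minus_one_fourth:
  assumes "R.eqm (int q) (t\<^sup>2) 2"
  shows "R.eqm (int q) (x ^ 4) (-1)"
proof -
  have e: "x\<^sup>2 * t\<^sup>2 = x ^ 4 + 2 * x\<^sup>2 + 1"
    unfolding power_mult_distrib[symmetric] x_mult_t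
    by (simp add: power2_eq_square power4_eq_xxxx algebra_simps)
  have "R.eqm (int q) (x\<^sup>2 * t\<^sup>2) (x\<^sup>2 * 2)"
    by (intro R.eqm_mult_left assms R.closed x_closed)
  then have "R.eqm (int q) (x ^ 4 + 2 * x\<^sup>2 + 1 - (2 * x\<^sup>2 + 1)) (x\<^sup>2 * 2 - (2 * x\<^sup>2 + 1))"
    unfolding e by (intro R.eqm_diff R.eqm_refl)
  then show ?thesis by simp
qed

end

text \<open>\<open>t\<close> is a root of (X - t)(X - s), whose coefficients are known modulo
  \<open>q\<close>.\<close>

lemma quadratic_root_eqm:
  assumes "t \<in> R16" "R.eqm q (t + s) a" "R.eqm q (t * s) b"
  shows "R.eqm q (t\<^sup>2) (a * t - b)"
proof -
  have "R.eqm q ((t + s) * t - t * s) (a * t - b)"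
    by (intro R.eqm_diff R.eqm_mult_right assms)
  then show ?thesis by (simp add: power2_eq_square algebra_simps)
qed

text \<open>The prescribed symmetric functions are those of (X + 2)^4, and \<open>t\<close> is a
  root of the quartic with roots \<open>t\<close>, \<open>b\<close>, \<open>c\<close>,
  \<open>d\<close>.\<close>

lemma quartic_root_eqm:
  assumes t: "t \<in> R16" and X: "R.eqm q (t + b + c + d) (-8)"
    and Y: "R.eqm q (t * b + t * c + t * d + b * c + b * d + c * d) 24"
    and Z: "R.eqm q (t * b * c + t * b * d + t * c * d + b * c * d) (-32)"
    and W: "R.eqm q (t * b * c * d) 16"
  shows "R.eqm q ((t + 2) ^ 4) 0"
proof -
  let ?X = "t + b + c + d" and ?Y = "t * b + t * c + t * d + b * c + b * d + c * d"
    and ?Z = "t * b * c + t * b * d + t * c * d + b * c * d" and ?W = "t * b * c * d"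
  have "R.eqm q (?X * t ^ 3 - ?Y * t\<^sup>2 + ?Z * t - ?W) ((-8) * t ^ 3 - 24 * t\<^sup>2 + (-32) * t - 16)"
    by (intro R.eqm_diff R.eqm_add R.eqm_mult_right X Y Z W R.closed t)
  also have "?X * t ^ 3 - ?Y * t\<^sup>2 + ?Z * t - ?W = t ^ 4"
    by (simp add: power2_eq_square power3_eq_cube power4_eq_xxxx algebra_simps)
  finally have "R.eqm q (t ^ 4 + (8 * t ^ 3 + 24 * t\<^sup>2 + 32 * t + 16))
      ((-8) * t ^ 3 - 24 * t\<^sup>2 + (-32) * t - 16 + (8 * t ^ 3 + 24 * t\<^sup>2 + 32 * t + 16))"
    by (intro R.eqm_add R.eqm_refl)
  moreover have "t ^ 4 + (8 * t ^ 3 + 24 * t\<^sup>2 + 32 * t + 16) = (t + 2) ^ 4"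
    by (simp add: power2_eq_square power3_eq_cube power4_eq_xxxx algebra_simps)
  ultimately show ?thesis by simp
qed

lemma prime_of_large_divisors:
  fixes M B :: int
  assumes M: "1 < M" "M < B\<^sup>2" "0 \<le> B" and B: "\<And>q. prime q \<Longrightarrow> int q dvd M \<Longrightarrow> B \<le> int q"
  shows "prime M"
proof -
  have "nat M \<noteq> 1" using M by simp
  then obtain q where q: "prime q" "q dvd nat M" using prime_factor_nat by blast
  then obtain c where c: "nat M = q * c" by blast
  then have Mc: "M = int q * int c" using M by (simp flip: of_nat_mult)
  show ?thesis
  proof (cases "c = 1")
    case True
    then show ?thesis using Mc q by simp
  next
    case False
    then obtain r where r: "prime r" "r dvd c" using prime_factor_nat by blast
    have "int r dvd M" "int q dvd M" unfolding Mc using r by simp_all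
    then have "B \<le> int r" "B \<le> int q" using B r q by blast+
    moreover have "int r \<le> int c" using r(2) Mc M by (intro zdvd_imp_le) (auto intro: Nat.gr0I)
    ultimately have "B * B \<le> int q * int c" using M(3) by (intro mult_mono) auto
    then show ?thesis using M Mc by (simp add: power2_eq_square)
  qed
qed

text \<open>\<omega>' is the image of \<omega> under \<zeta> -> \<zeta>^3, with 90 = 3 * 15 * 2. For
  odd \<open>l\<close> the two values are sqrt 2 = \<zeta>^2 - \<zeta>^6 and its negative.\<close>

lemma octic_trace_values:
  fixes l :: nat
  defines "\<omega> \<equiv> \<zeta> ^ (2 * l) + \<zeta> ^ (15 * (2 * l))" and "\<omega>' \<equiv> \<zeta> ^ (6 * l) + \<zeta> ^ (90 * l)"
  shows "l \<in> {4, 12} \<Longrightarrow> \<omega> + \<omega>' = -4 \<and> \<omega> * \<omega>' = 4"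
    and "l \<in> {2, 6, 10, 14} \<Longrightarrow> \<omega> + \<omega>' = 0 \<and> \<omega> * \<omega>' = 0"
    and "l \<in> {1, 3, 5, 7, 9, 11, 13, 15} \<Longrightarrow> \<omega> + \<omega>' = 0 \<and> \<omega> * \<omega>' = -2"
proof -
  assume "l \<in> {4, 12}"
  then show "\<omega> + \<omega>' = -4 \<and> \<omega> * \<omega>' = 4"
    unfolding \<omega>_def \<omega>'_def by (elim insertE) (simp_all add: zeta16_numeral_reduce)
next
  assume "l \<in> {2, 6, 10, 14}"
  then show "\<omega> + \<omega>' = 0 \<and> \<omega> * \<omega>' = 0"
    unfolding \<omega>_def \<omega>'_def by (elim insertE) (simp_all add: zeta16_numeral_reduce)
next
  assume "l \<in> {1, 3, 5, 7, 9, 11, 13, 15}"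
  then have "(\<omega> = \<zeta>\<^sup>2 - \<zeta> ^ 6 \<and> \<omega>' = - (\<zeta>\<^sup>2 - \<zeta> ^ 6)) \<or> (\<omega> = - (\<zeta>\<^sup>2 - \<zeta> ^ 6) \<and> \<omega>' = \<zeta>\<^sup>2 - \<zeta> ^ 6)"
    unfolding \<omega>_def \<omega>'_def by (elim insertE) (simp_all add: zeta16_numeral_reduce)
  moreover have "(\<zeta>\<^sup>2 - \<zeta> ^ 6) * (\<zeta>\<^sup>2 - \<zeta> ^ 6) = 2"
    by (rule zeta16_eqI[where c = "\<zeta> ^ 4 - 2"]) (simp add: power_numeral_reduce algebra_simps)
  ultimately show "\<omega> + \<omega>' = 0 \<and> \<omega> * \<omega>' = -2"
    by (elim disjE conjE) (simp_all only: mult_minus_left mult_minus_right, simp_all)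
qed

context
  fixes n h :: nat and M Mstar :: int
  assumes n: "n \<ge> 7" and h: "0 < h" "\<not> [h = 0] (mod 17)"
    and M: "M = int h * 2 ^ n + 1 \<or> M = int h * 2 ^ n - 1"
    and Mstar_def: "Mstar = (-1) ^ nat ((M - 1) div 2) * M"
begin

lemma M_ge: "127 \<le> M"
proof -
  have "(2 :: int) ^ 7 \<le> 2 ^ n" using n by (intro power_increasing) auto
  then have "1 * 2 ^ 7 \<le> int h * 2 ^ n" using h by (intro mult_mono) auto
  then show ?thesis using M by auto
qed

lemma Mstar_cases:
  "M = int h * 2 ^ n + 1 \<and> Mstar = M \<or> M = int h * 2 ^ n - 1 \<and> Mstar = - M"
proof -
  obtain i where i: "n = Suc (Suc i)" using n by (intro that[of "n - 2"]) simp
  have e: "int h * 2 ^ n = 2 * (2 * (int h * 2 ^ i))" unfolding i by simp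
  show ?thesis using M
  proof
    assume 1: "M = int h * 2 ^ n + 1"
    then have "(M - 1) div 2 = 2 * (int h * 2 ^ i)" unfolding e by simp
    then have "nat ((M - 1) div 2) = 2 * (h * 2 ^ i)" by (simp add: nat_mult_distrib nat_power_eq)
    then have "even (nat ((M - 1) div 2))" by simp
    then show ?thesis using 1 Mstar_def by simp
  next
    assume 2: "M = int h * 2 ^ n - 1"
    then have "M - 1 = 2 * (2 * (int h * 2 ^ i) - 1)" unfolding e by simp
    then have d: "(M - 1) div 2 = 2 * (int h * 2 ^ i) - 1" by simp
    moreover have "0 \<le> (M - 1) div 2" using M_ge by simp
    ultimately have "odd (nat ((M - 1) div 2))" by (simp add: even_nat_iff)
    then show ?thesis using 2 Mstar_def by simp
  qed
qed

text \<open>Excludes the one nonzero class modulo 17 that is absent from (i) to (iv).\<close>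

lemma Mstar_not_1: "\<not> [Mstar = 1] (mod 17)"
proof
  assume "[Mstar = 1] (mod 17)"
  then have "17 dvd Mstar - 1" by (simp add: cong_iff_dvd_diff)
  moreover have "Mstar - 1 = int h * 2 ^ n \<or> Mstar - 1 = - (int h * 2 ^ n)" using Mstar_cases by auto
  ultimately have "17 dvd int h * 2 ^ n" by auto
  moreover have p17: "prime (17 :: int)" by simp
  ultimately have "17 dvd int h \<or> (17 :: int) dvd 2 ^ n" using prime_dvd_mult_iff by blast
  moreover have "\<not> (17 :: int) dvd 2 ^ n" using prime_dvd_power[OF p17, of 2 n] by auto
  ultimately have "int 17 dvd int h" by simp
  then show False using h(2) unfolding int_dvd_int_iff by (simp add: cong_0_iff)
qed

lemma M_coprime_17:
  assumes "\<not> [Mstar = 0] (mod 17)"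
  shows "coprime M 17"
proof -
  have "\<not> 17 dvd M" using assms Mstar_cases by (auto simp: cong_0_iff)
  then show ?thesis using prime_imp_coprime[of 17 M] by (simp add: coprime_commute)
qed

lemma power_residue_M:
  assumes p: "prime M" and l: "[Mstar = 14 ^ l] (mod 17)"
  shows "R.eqm M (tr1 h (n - 3)) (\<zeta> ^ (2 * l) + \<zeta> ^ (15 * (2 * l)))"
    and "R.eqm M (tr2 h (n - 4)) (\<zeta> ^ (1 * l) + \<zeta> ^ (15 * (1 * l)))"
proof -
  define p where "p = nat M"
  have Mp: "int p = M" unfolding p_def using M_ge by simp
  have pp: "prime p" using assms(1) Mp by (metis prime_int_nat_transfer prime_nat_int_transfer)
  have p17: "p \<noteq> 17" using Mp M_ge by linarith
  obtain i where i: "n = i + 4" using n by (intro that[of "n - 4"]) simp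
  have e: "h * 2 ^ n = 16 * (h * 2 ^ i)" unfolding i by (simp add: power_add)
  have oddp: "odd p"
  proof -
    have "odd M" using M e[THEN arg_cong, of int] by auto
    then show ?thesis using Mp by auto
  qed
  \<comment> \<open>The exponents of \<alpha> at the two stages are (M - 1)/8 and (M - 1)/16, or (M
    + 1)/8 and (M + 1)/16.\<close>
  have e8: "8 * (h * 2 ^ (n - 3)) = 16 * (h * 2 ^ i)" and e16: "16 * (h * 2 ^ (n - 4)) = 16 * (h * 2 ^ i)"
    unfolding i by simp_all
  have ii: "int h * 2 ^ n = int (16 * (h * 2 ^ i))" unfolding e[symmetric] by simp
  have cases: "[p = 1] (mod 16) \<and> p = 16 * (h * 2 ^ i) + 1 \<and> Mstar = int p \<or>
      [p = 15] (mod 16) \<and> p + 1 = 16 * (h * 2 ^ i) \<and> Mstar = - int p"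
    using Mstar_cases
  proof
    assume 1: "M = int h * 2 ^ n + 1 \<and> Mstar = M"
    then have "p = 16 * (h * 2 ^ i) + 1" using Mp unfolding ii by linarith
    moreover from this have "[p = 1] (mod 16)" by (simp add: cong_def)
    ultimately show ?thesis using 1 unfolding Mp by blast
  next
    assume 2: "M = int h * 2 ^ n - 1 \<and> Mstar = - M"
    then have p1: "p + 1 = 16 * (h * 2 ^ i)" using Mp unfolding ii by linarith
    have "(p + 1) mod 16 = 0" unfolding p1 by simp
    then have "p mod 16 = 15" by presburger
    then have "[p = 15] (mod 16)" by (simp add: cong_def)
    then show ?thesis using 2 p1 unfolding Mp by blast
  qed
  show "R.eqm M (tr1 h (n - 3)) (\<zeta> ^ (2 * l) + \<zeta> ^ (15 * (2 * l)))"
    unfolding Mp[symmetric] trace_pow_def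
  proof (rule power_residue[OF pp p17 oddp _ l _ alpha_closed(1) alpha_norm(1) gamma_closed(1) gamma_norm(1)])
    show "gs 2 w ^ (8 + 1) = alpha1 (prime8 1) * gamma1 ^ 8 * gs 2 w" if "w ^ 17 = 1" for w
      using gs_2_power[OF that] gauss8_factorisation by simp
    show "[p = 1] (mod 16) \<and> p = 8 * (h * 2 ^ (n - 3)) + 1 \<and> Mstar = int p \<or>
        [p = 15] (mod 16) \<and> p + 1 = 8 * (h * 2 ^ (n - 3)) \<and> Mstar = - int p"
      unfolding e8 by (rule cases)
  qed simp
  show "R.eqm M (tr2 h (n - 4)) (\<zeta> ^ (1 * l) + \<zeta> ^ (15 * (1 * l)))"
    unfolding Mp[symmetric] trace_pow_def
  proof (rule power_residue[OF pp p17 oddp _ l _ alpha_closed(2) alpha_norm(2) gamma_closed(2) gamma_norm(2)])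
    show "gs 1 w ^ (16 + 1) = alpha2 (prime16 1) * gamma2 ^ 16 * gs 1 w" if "w ^ 17 = 1" for w
      using gs_1_power[OF that] gauss16_factorisation by simp
    show "[p = 1] (mod 16) \<and> p = 16 * (h * 2 ^ (n - 4)) + 1 \<and> Mstar = int p \<or>
        [p = 15] (mod 16) \<and> p + 1 = 16 * (h * 2 ^ (n - 4)) \<and> Mstar = - int p"
      unfolding e16 by (rule cases)
  qed simp
qed

end

theorem theorem3p1:
  fixes n h :: nat and M Mstar :: int and \<pi>\<^sub>1 \<pi>\<^sub>2 :: complex
  assumes "n \<ge> 7"
    and "odd h" and "0 < h" and "h < 2 ^ (n - 6)" and "\<not> [h = 0] (mod 17)"
    and "M = int h * 2 ^ n + 1 \<or> M = int h * 2 ^ n - 1"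
    and "Mstar = (-1) ^ nat ((M - 1) div 2) * M"
    and "\<pi>\<^sub>1 = 1 + 2 * zeta 8 ^ 3"
    and "\<pi>\<^sub>2 = 1 - zeta 16 + zeta 16 ^ 5"
    and "\<And>Q :: int. 1 < Q \<Longrightarrow> Q < 2 ^ (n - 3) \<Longrightarrow>
           (\<exists>j\<in>{0, 1, 2, 3 :: nat}. [Q = 5 ^ (j * 2 ^ (n - 7))] (mod 2 ^ (n - 3)) \<or>
                                [Q = - (5 ^ (j * 2 ^ (n - 7)))] (mod 2 ^ (n - 3))) \<Longrightarrow>
           \<not> Q dvd M"
  shows "prime M \<longleftrightarrow>
      (\<exists>r\<in>{4, -4}. [Mstar = r] (mod 17)) \<and>
        rat_cong M (T_seq \<pi>\<^sub>1 h (n - 3)) (- N_seq \<pi>\<^sub>1 h (n - 3)) \<and>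
        rat_cong M (- N_seq \<pi>\<^sub>1 h (n - 3)) (-4)
    \<or> (\<exists>r\<in>{2, -2, 8, -8}. [Mstar = r] (mod 17)) \<and>
        rat_cong M (T_seq \<pi>\<^sub>1 h (n - 3)) (N_seq \<pi>\<^sub>1 h (n - 3)) \<and>
        rat_cong M (N_seq \<pi>\<^sub>1 h (n - 3)) 0
    \<or> (\<exists>r\<in>{3, -3, 5, -5, 6, -6, 7, -7}. [Mstar = r] (mod 17)) \<and>
        rat_cong M (T_seq \<pi>\<^sub>1 h (n - 3)) 0 \<and>
        rat_cong M (N_seq \<pi>\<^sub>1 h (n - 3)) (-2)
    \<or> [Mstar = -1] (mod 17) \<and>
        rat_cong M (X_seq \<pi>\<^sub>2 h (n - 4)) (-8) \<and>
        rat_cong M (Y_seq \<pi>\<^sub>2 h (n - 4)) 24 \<and>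
        rat_cong M (Z_seq \<pi>\<^sub>2 h (n - 4)) (-32) \<and>
        rat_cong M (W_seq \<pi>\<^sub>2 h (n - 4)) 16"
proof -
  note n = assms(1) and h = assms(3,5) and h_less = assms(4) and M = assms(6)
    and Mstar = assms(7) and Q = assms(10)
  note ctx = n h M Mstar
  have \<pi>: "\<pi>\<^sub>1 = prime8 1" "\<pi>\<^sub>2 = prime16 1"
    unfolding assms(8,9) prime8_def prime16_def zeta8_eq by (simp_all flip: power_mult)
  define T N where "T = T_seq (prime8 1) h (n - 3)" and "N = N_seq (prime8 1) h (n - 3)"
  define X Y Z W where "X = X_seq (prime16 1) h (n - 4)" and "Y = Y_seq (prime16 1) h (n - 4)"
    and "Z = Z_seq (prime16 1) h (n - 4)" and "W = W_seq (prime16 1) h (n - 4)"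
  define t where "t = tr1 h (n - 3)"
  define a where "a = tr2 h (n - 4)"
  have t: "t \<in> R16" unfolding t_def by (rule trace_pow_closed[OF alpha_closed(1)])
  have a: "a \<in> R16" unfolding a_def by (rule trace_pow_closed[OF alpha_closed(2)])
  have TN: "T = t + sigma 3 t" "N = t * sigma 3 t" unfolding T_def N_def t_def using T_N_seq_eq by blast+
  have XYZW: "X = a + sigma 3 a + sigma 5 a + sigma 7 a"
    "Y = a * sigma 3 a + a * sigma 5 a + a * sigma 7 a + sigma 3 a * sigma 5 a
      + sigma 3 a * sigma 7 a + sigma 5 a * sigma 7 a"
    "Z = a * sigma 3 a * sigma 5 a + a * sigma 3 a * sigma 7 a + a * sigma 5 a * sigma 7 a
      + sigma 3 a * sigma 5 a * sigma 7 a"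
    "W = a * sigma 3 a * sigma 5 a * sigma 7 a"
    unfolding X_def Y_def Z_def W_def a_def using XYZW_seq_eq by blast+
  have mem: "T \<in> Zinv17" "N \<in> Zinv17" "- N \<in> Zinv17" "X \<in> Zinv17" "Y \<in> Zinv17" "Z \<in> Zinv17" "W \<in> Zinv17"
    unfolding T_def N_def X_def Y_def Z_def W_def
    using T_N_seq_Zinv17 XYZW_seq_Zinv17 A.uminus_closed by blast+
  have lit: "-4 \<in> Zinv17" "0 \<in> Zinv17" "-2 \<in> Zinv17" "-8 \<in> Zinv17" "24 \<in> Zinv17" "-32 \<in> Zinv17" "16 \<in> Zinv17"
    by (intro A.closed)+
  have M0: "M \<noteq> 0" using M_ge[OF ctx] by simp
  have r: "rat_cong M x y \<longleftrightarrow> R.eqm M x y"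
    if "\<not> [Mstar = 0] (mod 17)" "x \<in> Zinv17" "y \<in> Zinv17" for x y
    by (rule rat_cong_iff_eqm[OF M_coprime_17[OF ctx that(1)] M0 that(2,3)])
  let ?i = "(\<exists>r\<in>{4, -4}. [Mstar = r] (mod 17)) \<and> rat_cong M T (- N) \<and> rat_cong M (- N) (-4)"
  let ?ii = "(\<exists>r\<in>{2, -2, 8, -8}. [Mstar = r] (mod 17)) \<and> rat_cong M T N \<and> rat_cong M N 0"
  let ?iii = "(\<exists>r\<in>{3, -3, 5, -5, 6, -6, 7, -7}. [Mstar = r] (mod 17)) \<and>
    rat_cong M T 0 \<and> rat_cong M N (-2)"
  let ?iv = "[Mstar = -1] (mod 17) \<and> rat_cong M X (-8) \<and> rat_cong M Y 24 \<and>
    rat_cong M Z (-32) \<and> rat_cong M W 16"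
  have "prime M \<longleftrightarrow> ?i \<or> ?ii \<or> ?iii \<or> ?iv"
  proof
    assume p: "prime M"
    have "\<not> 17 dvd M"
    proof
      assume "17 dvd M"
      then have "M = 17" using p primes_dvd_imp_eq[of 17 M] by simp
      then show False using M_ge[OF ctx] by simp
    qed
    then have nd: "\<not> 17 dvd Mstar" using Mstar_cases[OF ctx] by (metis dvd_minus_iff)
    then have n0: "\<not> [Mstar = 0] (mod 17)" by (simp add: cong_0_iff)
    note r = r[OF n0]
    obtain l where l: "l < 16" "[Mstar = 14 ^ l] (mod 17)" using dlog_14[OF nd] by blast
    have "l \<noteq> 0" using l(2) Mstar_not_1[OF ctx] by (intro notI) simp
    have z: "\<zeta> ^ i \<in> R16" for i by (intro R.closed zeta16_in_R16)
    note H3 = field_hom_closed[OF subfield_L2 sigma3_hom]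
    have zL: "\<zeta> ^ i \<in> L2" for i using z R16_subset_L2 by blast
    have s3: "sigma 3 (\<zeta> ^ i) = \<zeta> ^ (3 * i)" for i
      by (simp add: H3(9)[OF zeta16_in_L2] sigma3_zeta power_mult)
    define \<omega> \<omega>' where "\<omega> = \<zeta> ^ (2 * l) + \<zeta> ^ (15 * (2 * l))" and "\<omega>' = \<zeta> ^ (6 * l) + \<zeta> ^ (90 * l)"
    have \<omega>: "\<omega> \<in> R16" unfolding \<omega>_def by (intro R.closed z)
    have t\<omega>: "R.eqm M t \<omega>" unfolding t_def \<omega>_def by (rule power_residue_M(1)[OF ctx p l(2)])
    have "sigma 3 \<omega> = \<omega>'" unfolding \<omega>_def \<omega>'_def H3(2)[OF zL zL] s3 by simp
    then have s\<omega>: "R.eqm M (sigma 3 t) \<omega>'" using eqm_hom[OF sigma3_hom sigma3_zeta t\<omega> t \<omega>] by simp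
    have T: "R.eqm M T (\<omega> + \<omega>')" unfolding TN by (intro R.eqm_add t\<omega> s\<omega>)
    have N: "R.eqm M N (\<omega> * \<omega>')"
      unfolding TN by (intro R.eqm_mult t\<omega> s\<omega> \<omega> hom_R16_closed[OF sigma3_hom sigma3_zeta t])
    note v = octic_trace_values[of l, folded \<omega>_def \<omega>'_def]
    \<comment> \<open>The cases are the orders 2, 4, 8 and 1 of \<zeta>^(2l).\<close>
    have "l \<in> {..<16} - {0}" using l \<open>l \<noteq> 0\<close> by simp
    then consider (i) "l \<in> {4, 12}" | (ii) "l \<in> {2, 6, 10, 14}"
      | (iii) "l \<in> {1, 3, 5, 7, 9, 11, 13, 15}" | (iv) "l = 8"
      unfolding lessThan_16 by blast
    then show "?i \<or> ?ii \<or> ?iii \<or> ?iv"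
    proof cases
      case i
      then have "\<exists>r\<in>{4, -4}. [Mstar = r] (mod 17)" using l(2) by (auto simp: cong_def)
      moreover have N': "R.eqm M (- N) (-4)" using R.eqm_uminus[OF N] v(1)[OF i] by simp
      moreover have "R.eqm M T (- N)"
        by (rule R.eqm_trans[OF _ R.eqm_sym[OF N']]) (use T v(1)[OF i] in simp)
      ultimately show ?thesis using r mem lit by simp
    next
      case ii
      then have "\<exists>r\<in>{2, -2, 8, -8}. [Mstar = r] (mod 17)" using l(2) by (auto simp: cong_def)
      moreover have N': "R.eqm M N 0" using N v(2)[OF ii] by simp
      moreover have "R.eqm M T N"
        by (rule R.eqm_trans[OF _ R.eqm_sym[OF N']]) (use T v(2)[OF ii] in simp)
      ultimately show ?thesis using r mem lit by simp
    next
      case iii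
      then have "\<exists>r\<in>{3, -3, 5, -5, 6, -6, 7, -7}. [Mstar = r] (mod 17)"
        using l(2) by (auto simp: cong_def)
      moreover have "R.eqm M T 0" "R.eqm M N (-2)" using T N v(3)[OF iii] by simp_all
      ultimately show ?thesis using r mem lit by simp
    next
      case iv
      have "[Mstar = -1] (mod 17)" using l(2) unfolding iv by (simp add: cong_def)
      moreover have "\<zeta> ^ (1 * l) + \<zeta> ^ (15 * (1 * l)) = -2"
        unfolding iv by (simp add: zeta16_numeral_reduce)
      then have a2: "R.eqm M a (-2)" using power_residue_M(2)[OF ctx p l(2)] unfolding a_def by simp
      have m2: "-2 \<in> R16" by (intro R.closed)
      have c: "R.eqm M (f a) (-2)" "f a \<in> R16" if "field_hom_on L2 f" "f \<zeta> = \<zeta> ^ k" for f k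
        using eqm_hom[OF that a2 a m2] hom_fixes_Rats[OF subfield_L2 that(1), of "-2"]
          hom_R16_closed[OF that a] by simp_all
      note c3 = c[OF sigma3_hom sigma3_zeta] and c5 = c[OF sigma_homs(1,2)] and c7 = c[OF sigma_homs(3,4)]
      note I = R.eqm_add R.eqm_mult R.closed a2 a c3 c5 c7
      \<comment> \<open>All four conjugates are -2, which yields the elementary symmetric functions
        of four copies of -2.\<close>
      have "R.eqm M X ((-2) + (-2) + (-2) + (-2))" unfolding XYZW by (intro I)
      moreover have "R.eqm M Y ((-2) * (-2) + (-2) * (-2) + (-2) * (-2) + (-2) * (-2) + (-2) * (-2) + (-2) * (-2))"
        unfolding XYZW by (intro I)
      moreover have "R.eqm M Z ((-2) * (-2) * (-2) + (-2) * (-2) * (-2) + (-2) * (-2) * (-2) + (-2) * (-2) * (-2))"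
        unfolding XYZW by (intro I)
      moreover have "R.eqm M W ((-2) * (-2) * (-2) * (-2))" unfolding XYZW by (intro I)
      ultimately show ?thesis using r mem lit by simp
    qed
  next
    assume cond: "?i \<or> ?ii \<or> ?iii \<or> ?iv"
    \<comment> \<open>Every alternative names a nonzero class of \<open>Mstar\<close> modulo 17;
      this makes 17 invertible modulo \<open>M\<close> before any congruence is translated.\<close>
    then have n0: "\<not> [Mstar = 0] (mod 17)" by (auto simp: cong_def)
    note r = r[OF n0]
    have cop: "coprime M 17" by (rule M_coprime_17[OF ctx n0])
    obtain k where k: "n = k + 7" using n by (intro that[of "n - 7"]) simp
    have oM: "odd M" using M unfolding k by (auto simp: power_add)
    have ord: "2 ^ (n - 3) dvd q ^ 4 - 1" if q: "prime q" "int q dvd M" for q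
    proof -
      have oq: "odd q" using oM q(2) by (metis dvd_trans even_of_nat)
      have q17: "q \<noteq> 17" using q(2) cop by auto
      have b: "\<alpha> ^ h \<in> R16" "\<alpha> ^ h * cnj (\<alpha> ^ h) = 1" if "\<alpha> \<in> R16" "\<alpha> * cnj \<alpha> = 1" for \<alpha>
        using that by (simp_all add: R.power_closed flip: power_mult_distrib)
      \<comment> \<open>In cases (i) to (iv), \<open>Suc (i + j)\<close> is n - 2, n - 1, n and n -
        3; the last attains the bound.\<close>
      have conclude: ?thesis
        if \<alpha>: "\<alpha> \<in> R16" "\<alpha> * cnj \<alpha> = 1" and e: "R.eqm (int q) ((\<alpha> ^ (h * 2 ^ i)) ^ (2 ^ j)) (-1)"
          and ij: "n - 3 \<le> Suc (i + j)" for \<alpha> i j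
      proof -
        have "(\<alpha> ^ (h * 2 ^ i)) ^ (2 ^ j) = (\<alpha> ^ h) ^ (2 ^ (i + j))"
          by (simp only: power_mult power_add)
        then have "2 ^ Suc (i + j) dvd q ^ 4 - 1"
          using two_power_dvd_of_order[OF q(1) oq q17 b[OF \<alpha>], of "i + j"] e by simp
        then show ?thesis using le_imp_power_dvd[OF ij] dvd_trans by blast
      qed
      note ev = R.eqm_dvd[OF _ q(2)]
      note root = quadratic_root_eqm[OF t]
      from cond show ?thesis
      proof (elim disjE conjE)
        assume "rat_cong M T (- N)" "rat_cong M (- N) (-4)"
        then have e: "R.eqm M T (- N)" "R.eqm M (- N) (-4)" using r mem lit by simp_all
        have "R.eqm (int q) T (-4)" by (rule ev[OF R.eqm_trans[OF e]])
        moreover have "R.eqm (int q) N 4" using ev[OF R.eqm_uminus[OF e(2)]] by simp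
        ultimately have "R.eqm (int q) (t\<^sup>2) (- 4 * t - 4)" unfolding TN by (rule root)
        then have "R.eqm (int q) (alpha1 (prime8 1) ^ (h * 2 ^ (n - 3))) (-1)"
          unfolding t_def by (rule power_eqm_minus_one_quadratic[OF q(1) oq alpha_closed(1) alpha_norm(1)])
        then show ?thesis using conclude[OF alpha_closed(1) alpha_norm(1), of "n - 3" 0] by simp
      next
        assume "rat_cong M T N" "rat_cong M N 0"
        then have e: "R.eqm M T N" "R.eqm M N 0" using r mem lit by simp_all
        have "R.eqm (int q) T 0" by (rule ev[OF R.eqm_trans[OF e]])
        moreover have "R.eqm (int q) N 0" by (rule ev[OF e(2)])
        ultimately have "R.eqm (int q) (t\<^sup>2) (0 * t - 0)" unfolding TN by (rule root)
        then have "R.eqm (int q) ((alpha1 (prime8 1) ^ (h * 2 ^ (n - 3)))\<^sup>2) (-1)"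
          unfolding t_def
          by (intro power_eqm_minus_one_square[OF q(1) oq alpha_closed(1) alpha_norm(1)]) simp
        then show ?thesis using conclude[OF alpha_closed(1) alpha_norm(1), of "n - 3" 1] by simp
      next
        assume "rat_cong M T 0" "rat_cong M N (-2)"
        then have e: "R.eqm M T 0" "R.eqm M N (-2)" using r mem lit by simp_all
        have "R.eqm (int q) (t\<^sup>2) (0 * t - (-2))"
          using ev[OF e(1)] ev[OF e(2)] unfolding TN by (rule root)
        then have "R.eqm (int q) ((alpha1 (prime8 1) ^ (h * 2 ^ (n - 3))) ^ 4) (-1)"
          unfolding t_def
          by (intro power_eqm_minus_one_fourth[OF q(1) oq alpha_closed(1) alpha_norm(1)]) simp
        then show ?thesis using conclude[OF alpha_closed(1) alpha_norm(1), of "n - 3" 2] by simp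
      next
        assume "rat_cong M X (-8)" "rat_cong M Y 24" "rat_cong M Z (-32)" "rat_cong M W 16"
        then have e: "R.eqm M X (-8)" "R.eqm M Y 24" "R.eqm M Z (-32)" "R.eqm M W 16"
          using r mem lit by simp_all
        have "R.eqm (int q) ((a + 2) ^ 4) 0"
          using e[THEN ev] unfolding XYZW by (intro quartic_root_eqm[OF a])
        then have "R.eqm (int q) (alpha2 (prime16 1) ^ (h * 2 ^ (n - 4))) (-1)"
          unfolding a_def by (rule power_eqm_minus_one_quartic[OF q(1) oq alpha_closed(2) alpha_norm(2)])
        then show ?thesis using conclude[OF alpha_closed(2) alpha_norm(2), of "n - 4" 0] by simp
      qed
    qed
    show "prime M"
    proof (rule prime_of_large_divisors[where B = "2 ^ (n - 3)"])
      show "1 < M" using M_ge[OF ctx] by simp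
      define P :: int where "P = 2 ^ k"
      have P1: "1 \<le> P" unfolding P_def by simp
      have "int h < int (2 ^ (n - 6))" using h_less by simp
      \<comment> \<open>With \<open>n = k + 7\<close> the bound is h < 2^(k+1) = 2 P. Integrality
        leaves a margin of 128 P below (16 P)^2, which absorbs the + 1 in \<open>M\<close>.\<close>
      then have "int h \<le> 2 * P - 1" unfolding P_def k by simp
      then have "int h * (128 * P) \<le> (2 * P - 1) * (128 * P)" using P1 by (intro mult_right_mono) auto
      moreover have "M \<le> int h * (128 * P) + 1" using M unfolding k P_def by (auto simp: power_add)
      moreover have "(2 * P - 1) * (128 * P) = (16 * P)\<^sup>2 - 128 * P" by (simp add: power2_eq_square algebra_simps)
      ultimately have "M < (16 * P)\<^sup>2" using P1 by linarith
      then show "M < (2 ^ (n - 3))\<^sup>2" unfolding P_def k by (simp add: power_add mult.commute)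
      fix q assume q: "prime q" "int q dvd M"
      have oq: "odd (int q)" using oM q(2) by (metis dvd_trans)
      have q1: "1 < int q" using prime_gt_1_nat[OF q(1)] by simp
      have k3: "n - 3 = k + 4" "n - 7 = k" unfolding k by simp_all
      have "int (2 ^ (n - 3)) dvd int (q ^ 4 - 1)" using ord[OF q] unfolding int_dvd_int_iff .
      moreover have "int (q ^ 4 - 1) = int q ^ 4 - 1" using q1 by (simp add: of_nat_diff)
      ultimately have "2 ^ (k + 4) dvd int q ^ 4 - 1" unfolding k3 by simp
      \<comment> \<open>A prime divisor below 2^(n-3) would be one of the excluded
        \<open>Q\<close>.\<close>
      from fourth_root_of_unity[OF oq this] show "2 ^ (n - 3) \<le> int q"
        using Q[OF q1] q(2) unfolding k3 by (meson not_le)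
    qed simp
  qed
  then show ?thesis unfolding \<pi> T_def N_def X_def Y_def Z_def W_def .
qed

end
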